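(* Let $G=\mathcal{R}$ and let $A=[a_1\ a_2\ \ldots\ a_m]^T\in\mathfrak{m}\cdot M_{m,1}$. Let $\overline{a_i}$ denote the class of $a_i$ in $\mathfrak{m}/\mathfrak{m}^2$. 1. If $m>s$ then $$\dim_K\left(M_{m,1}/\widetilde T_A(GA)\right)=\infty.$$ If in addition there is some $k\in\mathbb{N}$ such that the orbit map $G^{(l)}\to G^{(l)}\mathrm{jet}_l(A)$ is separable for all $l\ge k$, then $A$ is not finitely right determined. 2. If $m\le s$ and $\{\overline{a_i}\}_{i=1,\ldots,m}$ is linearly independent in the $K$-vector space $\mathfrak{m}/\mathfrak{m}^2$, then $A$ is finitely right determined. If $m>1$ and there is some $k\in\mathbb{N}$ such that the orbit map $G^{(l)}\to G^{(l)}\mathrm{jet}_l(A)$ is separable for all $l\ge k$, then the converse also holds (i.e. if $A$ is finitely right determined, then $m\le s$ and $\{\overline{a_i}\}$ is linearly independent in $\mathfrak{m}/\mathfrak{m}^2$).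
   Context: $K$ is a field of arbitrary characteristic, $R=K[[x_1,\ldots,x_s]]$ is the formal power series ring with maximal ideal $\mathfrak{m}$, and $M_{m,1}$ is the $R$-module of $m\times1$ matrices (columns) with entries in $R$. $\mathcal{R}=\mathrm{Aut}(R)$ is the group of $K$-algebra automorphisms of $R$, acting on $M_{m,1}$ entrywise by $\phi(A)=[\phi(a_i)]$; $GA$ is the orbit of $A$. $A$ is finitely right determined (finitely $\mathcal{R}$-determined) if there is a positive integer $k$ such that every $B\in M_{m,1}$ with $B-A\in\mathfrak{m}^{k+1}\cdot M_{m,1}$ lies in the orbit $\mathcal{R}A$. The tangent image is $\widetilde T_A(\mathcal{R}A)=\mathfrak{m}\cdot\langle\frac{\partial A}{\partial x_1},\ldots,\frac{\partial A}{\partial x_s}\rangle\subset M_{m,1}$, where $\frac{\partial A}{\partial x_\nu}=[\frac{\partial a_i}{\partial x_\nu}]$ and $\langle\ \rangle$ denotes the generated $R$-submodule. $\mathrm{jet}_l(A)$ is the class of $A$ in $M^{(l)}_{m,1}=M_{m,1}/\mathfrak{m}^{l+1}M_{m,1}$. $G^{(l)}=\{\mathrm{jet}_l(\phi)\mid\phi\in\mathcal{R}\}$ with $\mathrm{jet}_l(\phi)(x_i)=\mathrm{jet}_l(\phi(x_i))$ is an affine algebraic group with $\mathrm{jet}_l(g)\mathrm{jet}_l(h)=\mathrm{jet}_l(gh)$, acting algebraically on $M^{(l)}_{m,1}$ by $(\mathrm{jet}_l(g),\mathrm{jet}_l(A))\mapsto\mathrm{jet}_l(gA)$, everything defined over $K$.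 The orbit map sends $\mathrm{jet}_l(g)$ to $\mathrm{jet}_l(gA)$. "Separable" means: after base change to an algebraic closure of $K$, the induced extension of fields of rational functions (from the function field of the orbit to that of the group) is separably generated. *)

theory Defs
  imports
    "HOL-Analysis.Finite_Cartesian_Product"
    "HOL-Library.Poly_Mapping"
    "HOL-Library.Extended_Nat"
    "HOL-Algebra.Algebraic_Closure_Type"
    "HOL-Algebra.Generated_Fields"
    "HOL-Algebra.Polynomial_Divisibility"
begin

section \<open>Multivariate formal power series\<close>

text \<open>
  The variables of \<open>('s, 'a) mps\<close> are indexed by the type \<open>'s\<close>; the ring \<open>K[[x\<^sub>1, \<dots>, x\<^sub>s]]\<close> is
  obtained for a finite type \<open>'s\<close> with \<open>s\<close> elements (so \<open>s \<ge> 1\<close>). A monomial is given by its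
  exponent vector.
\<close>

typedef ('s, 'a) mps = "UNIV :: (('s \<Rightarrow>\<^sub>0 nat) \<Rightarrow> 'a) set"
  morphisms mps_nth Abs_mps ..

setup_lifting type_definition_mps

lemma mps_eqI: "(\<And>\<alpha>. mps_nth f \<alpha> = mps_nth g \<alpha>) \<Longrightarrow> f = g"
  by (simp add: mps_nth_inject[symmetric] fun_eq_iff)

definition splits :: "('s \<Rightarrow>\<^sub>0 nat) \<Rightarrow> (('s \<Rightarrow>\<^sub>0 nat) \<times> ('s \<Rightarrow>\<^sub>0 nat)) set" where
  "splits \<alpha> = {(\<beta>, \<gamma>). \<beta> + \<gamma> = \<alpha>}"

lemma finite_splits [simp]: "finite (splits \<alpha>)"
proof -
  define N where "N = (\<Sum>i\<in>Poly_Mapping.keys \<alpha>. Poly_Mapping.lookup \<alpha> i)"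
  define F where "F = {f :: 'a \<Rightarrow> nat. \<forall>x. (x \<in> Poly_Mapping.keys \<alpha> \<longrightarrow> f x \<in> {..N}) \<and>
      (x \<notin> Poly_Mapping.keys \<alpha> \<longrightarrow> f x = 0)}"
  have finF: "finite F"
    unfolding F_def by (rule finite_set_of_finite_funs) auto
  have bound: "Poly_Mapping.lookup \<beta> \<in> F" if "\<beta> + \<gamma> = \<alpha>" for \<beta> \<gamma>
  proof -
    have le: "Poly_Mapping.lookup \<beta> x \<le> Poly_Mapping.lookup \<alpha> x" for x
      using that by (auto simp: lookup_add)
    have "Poly_Mapping.lookup \<alpha> x \<le> N" if "x \<in> Poly_Mapping.keys \<alpha>" for x
      unfolding N_def using that by (intro member_le_sum) auto
    moreover have "Poly_Mapping.lookup \<beta> x = 0" if "x \<notin> Poly_Mapping.keys \<alpha>" for x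
      using le[of x] that by (simp add: in_keys_iff)
    ultimately show ?thesis
      unfolding F_def using le by (auto intro: order_trans)
  qed
  have fin: "finite (Poly_Mapping.lookup -` F)"
    by (rule finite_vimageI[OF finF]) (simp add: inj_on_def lookup_inject)
  have "splits \<alpha> \<subseteq> (Poly_Mapping.lookup -` F) \<times> (Poly_Mapping.lookup -` F)"
  proof (rule subrelI)
    fix \<beta> \<gamma> assume "(\<beta>, \<gamma>) \<in> splits \<alpha>"
    hence eq: "\<beta> + \<gamma> = \<alpha>" "\<gamma> + \<beta> = \<alpha>"
      by (simp_all add: splits_def add.commute)
    show "(\<beta>, \<gamma>) \<in> (Poly_Mapping.lookup -` F) \<times> (Poly_Mapping.lookup -` F)"
      using bound[OF eq(1)] bound[OF eq(2)] by simp_all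
  qed
  thus ?thesis
    using fin by (meson finite_SigmaI finite_subset)
qed

lemma sum_splits_swap:
  "(\<Sum>(\<beta>, \<gamma>)\<in>splits \<alpha>. h \<beta> \<gamma>) = (\<Sum>(\<beta>, \<gamma>)\<in>splits \<alpha>. h \<gamma> \<beta>)"
  by (rule sum.reindex_bij_witness[of _ prod.swap prod.swap]) (auto simp: splits_def add.commute)

instantiation mps :: (type, comm_ring_1) comm_ring_1
begin

lift_definition zero_mps :: "('a, 'b) mps" is "\<lambda>_. 0" .
lift_definition one_mps :: "('a, 'b) mps" is "\<lambda>\<alpha>. if \<alpha> = 0 then 1 else 0" .
lift_definition plus_mps :: "('a, 'b) mps \<Rightarrow> ('a, 'b) mps \<Rightarrow> ('a, 'b) mps"
  is "\<lambda>f g \<alpha>. f \<alpha> + g \<alpha>" .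
lift_definition minus_mps :: "('a, 'b) mps \<Rightarrow> ('a, 'b) mps \<Rightarrow> ('a, 'b) mps"
  is "\<lambda>f g \<alpha>. f \<alpha> - g \<alpha>" .
lift_definition uminus_mps :: "('a, 'b) mps \<Rightarrow> ('a, 'b) mps"
  is "\<lambda>f \<alpha>. - f \<alpha>" .
lift_definition times_mps :: "('a, 'b) mps \<Rightarrow> ('a, 'b) mps \<Rightarrow> ('a, 'b) mps"
  is "\<lambda>f g \<alpha>. \<Sum>(\<beta>, \<gamma>)\<in>splits \<alpha>. f \<beta> * g \<gamma>" .

instance
proof
  fix f g h :: "('a, 'b) mps"
  show "f * g = g * f"
    by transfer (rule ext, subst sum_splits_swap, simp add: mult.commute)
  show "(f + g) * h = f * h + g * h"
    by transfer (simp add: fun_eq_iff distrib_right sum.distrib case_prod_unfold)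
  show "1 * f = f"
  proof (transfer, rule ext)
    fix f :: "('a \<Rightarrow>\<^sub>0 nat) \<Rightarrow> 'b" and \<alpha>
    have "(\<Sum>(\<beta>, \<gamma>)\<in>splits \<alpha>. (if \<beta> = 0 then 1 else 0) * f \<gamma>)
        = (\<Sum>(\<beta>, \<gamma>)\<in>{(0 :: 'a \<Rightarrow>\<^sub>0 nat, \<alpha>)}. (if \<beta> = 0 then 1 else 0) * f \<gamma>)"
      by (rule sum.mono_neutral_right[OF finite_splits]) (auto simp: splits_def split: if_splits)
    thus "(\<Sum>(\<beta>, \<gamma>)\<in>splits \<alpha>. (if \<beta> = 0 then 1 else 0) * f \<gamma>) = f \<alpha>"
      by simp
  qed
  show "f * g * h = f * (g * h)"
  proof (transfer, rule ext)
    fix f g h :: "('a \<Rightarrow>\<^sub>0 nat) \<Rightarrow> 'b" and \<alpha>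
    have "(\<Sum>(\<delta>, \<gamma>)\<in>splits \<alpha>. (\<Sum>(\<beta>, \<epsilon>)\<in>splits \<delta>. f \<beta> * g \<epsilon>) * h \<gamma>)
        = (\<Sum>(p, q)\<in>Sigma (splits \<alpha>) (\<lambda>p. splits (fst p)). f (fst q) * g (snd q) * h (snd p))"
      by (subst sum.Sigma[symmetric]) (auto simp: case_prod_unfold sum_distrib_right)
    also have "\<dots> = (\<Sum>(p, q)\<in>Sigma (splits \<alpha>) (\<lambda>p. splits (snd p)). f (fst p) * (g (fst q) * h (snd q)))"
      by (rule sum.reindex_bij_witness[of _
            "\<lambda>(p, q). ((fst p + fst q, snd q), (fst p, fst q))"
            "\<lambda>(p, q). ((fst q, snd q + snd p), (snd q, snd p))"])
         (auto simp: splits_def add.assoc mult.assoc)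
    also have "\<dots> = (\<Sum>(\<beta>, \<delta>)\<in>splits \<alpha>. f \<beta> * (\<Sum>(\<epsilon>, \<gamma>)\<in>splits \<delta>. g \<epsilon> * h \<gamma>))"
      by (subst sum.Sigma[symmetric]) (auto simp: case_prod_unfold sum_distrib_left)
    finally show "(\<Sum>(\<delta>, \<gamma>)\<in>splits \<alpha>. (\<Sum>(\<beta>, \<epsilon>)\<in>splits \<delta>. f \<beta> * g \<epsilon>) * h \<gamma>)
        = (\<Sum>(\<beta>, \<delta>)\<in>splits \<alpha>. f \<beta> * (\<Sum>(\<epsilon>, \<gamma>)\<in>splits \<delta>. g \<epsilon> * h \<gamma>))" .
  qed
  show "(0 :: ('a, 'b) mps) \<noteq> 1"
    by transfer (metis zero_neq_one)
qed (transfer; simp add: fun_eq_iff algebra_simps)+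

end

lift_definition mps_const :: "'a::comm_ring_1 \<Rightarrow> ('s, 'a) mps"
  is "\<lambda>c \<alpha>. if \<alpha> = 0 then c else 0" .

lift_definition mps_var :: "'s \<Rightarrow> ('s, 'a::comm_ring_1) mps"
  is "\<lambda>i \<alpha>. if \<alpha> = Poly_Mapping.single i 1 then 1 else 0" .

lift_definition mps_map :: "('a \<Rightarrow> 'b) \<Rightarrow> ('s, 'a) mps \<Rightarrow> ('s, 'b) mps"
  is "\<lambda>h f \<alpha>. h (f \<alpha>)" .

lift_definition mps_pderiv :: "'s \<Rightarrow> ('s, 'a::comm_ring_1) mps \<Rightarrow> ('s, 'a) mps"
  is "\<lambda>\<nu> f \<alpha>. of_nat (Poly_Mapping.lookup \<alpha> \<nu> + 1) * f (\<alpha> + Poly_Mapping.single \<nu> 1)" .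

definition max_ideal :: "('s, 'a::comm_ring_1) mps set" where
  "max_ideal = {f. mps_nth f 0 = 0}"


section \<open>Ideals, submodules and quotient vector spaces\<close>

text \<open>
  \<^term>\<open>module.span\<close> applied to \<^term>\<open>(*)\<close> is the generated ideal, applied to \<^term>\<open>(*s)\<close>
  the generated submodule of the module of columns.
\<close>

fun ideal_power :: "'r::comm_ring_1 set \<Rightarrow> nat \<Rightarrow> 'r set" where
  "ideal_power I 0 = UNIV"
| "ideal_power I (Suc n) = module.span (*) {a * b | a b. a \<in> I \<and> b \<in> ideal_power I n}"

definition ideal_smult :: "'r::comm_ring_1 set \<Rightarrow> ('r ^ 'm) set \<Rightarrow> ('r ^ 'm) set" where
  "ideal_smult I N = module.span (*s) {a *s v | a v. a \<in> I \<and> v \<in> N}"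

text \<open>The class of \<open>v\<close> in the quotient \<open>V/T\<close> of a vector space by a subspace.\<close>

definition quotient_class :: "'v::ab_group_add set \<Rightarrow> 'v \<Rightarrow> 'v set" where
  "quotient_class T v = {w. w - v \<in> T}"

text \<open>
  The dimension of \<open>V/T\<close>: the least size of a finite set of vectors whose classes span \<open>V/T\<close>,
  and \<open>\<infinity>\<close> (the infimum of the empty set) if there is none.
\<close>

definition quotient_dim :: "('k::field \<Rightarrow> 'v::ab_group_add \<Rightarrow> 'v) \<Rightarrow> 'v set \<Rightarrow> enat" where
  "quotient_dim smul T =
     (INF S\<in>{S. finite S \<and> (\<forall>v. \<exists>u\<in>module.span smul S. quotient_class T v = quotient_class T u)}.
        enat (card S))"

text \<open>Linear independence of the family of the classes of the \<open>v i\<close> in \<open>V/T\<close>.\<close>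

definition independent_mod ::
  "('k::field \<Rightarrow> 'v::ab_group_add \<Rightarrow> 'v) \<Rightarrow> 'v set \<Rightarrow> ('m::finite \<Rightarrow> 'v) \<Rightarrow> bool" where
  "independent_mod smul T v \<longleftrightarrow>
     (\<forall>c. quotient_class T (\<Sum>i\<in>UNIV. smul (c i) (v i)) = quotient_class T 0 \<longrightarrow> (\<forall>i. c i = 0))"


section \<open>Right equivalence of columns of power series\<close>

definition mps_automorphisms :: "(('s, 'k::field) mps \<Rightarrow> ('s, 'k) mps) set" where
  "mps_automorphisms = {\<phi>. bij \<phi> \<and> (\<forall>f g. \<phi> (f + g) = \<phi> f + \<phi> g) \<and>
     (\<forall>f g. \<phi> (f * g) = \<phi> f * \<phi> g) \<and> (\<forall>c. \<phi> (mps_const c) = mps_const c)}"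

definition map_col :: "('a \<Rightarrow> 'b) \<Rightarrow> 'a ^ 'm \<Rightarrow> 'b ^ 'm" where
  "map_col \<phi> A = (\<chi> i. \<phi> (A $ i))"

definition right_orbit :: "('s, 'k::field) mps ^ 'm \<Rightarrow> (('s, 'k) mps ^ 'm) set" where
  "right_orbit A = (\<lambda>\<phi>. map_col \<phi> A) ` mps_automorphisms"

definition finitely_right_determined :: "('s, 'k::field) mps ^ 'm \<Rightarrow> bool" where
  "finitely_right_determined A \<longleftrightarrow>
     (\<exists>k>0. \<forall>B. B - A \<in> ideal_smult (ideal_power max_ideal (k + 1)) UNIV \<longrightarrow> B \<in> right_orbit A)"

definition tangent_image :: "('s, 'k::field) mps ^ 'm \<Rightarrow> (('s, 'k) mps ^ 'm) set" where
  "tangent_image A =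
     ideal_smult max_ideal (module.span (*s) (range (\<lambda>\<nu>. map_col (mps_pderiv \<nu>) A)))"


section \<open>Function fields and separably generated extensions\<close>

text \<open>
  Points of affine space are functions \<^typ>\<open>'i \<Rightarrow> 'f\<close>. If \<open>'f\<close> is algebraically closed and \<open>V\<close> is
  irreducible and locally closed, then the ring \<open>function_field V\<close> is the field of rational
  functions on \<open>V\<close>: its elements are the classes of the fractions \<open>p/q\<close> of polynomial functions,
  \<open>q\<close> not vanishing identically on \<open>V\<close>, up to equality on \<open>V\<close>.
\<close>

inductive_set poly_funs :: "(('i \<Rightarrow> 'f::field) \<Rightarrow> 'f) set" where
  const: "(\<lambda>_. c) \<in> poly_funs"
| coord: "(\<lambda>x. x i) \<in> poly_funs"
| add: "p \<in> poly_funs \<Longrightarrow> q \<in> poly_funs \<Longrightarrow> (\<lambda>x. p x + q x) \<in> poly_funs"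
| mult: "p \<in> poly_funs \<Longrightarrow> q \<in> poly_funs \<Longrightarrow> (\<lambda>x. p x * q x) \<in> poly_funs"

type_synonym ('i, 'f) fraction = "(('i \<Rightarrow> 'f) \<Rightarrow> 'f) \<times> (('i \<Rightarrow> 'f) \<Rightarrow> 'f)"

definition fractions :: "('i \<Rightarrow> 'f::field) set \<Rightarrow> ('i, 'f) fraction set" where
  "fractions V = {(p, q). p \<in> poly_funs \<and> q \<in> poly_funs \<and> (\<exists>x\<in>V. q x \<noteq> 0)}"

definition fraction_rel ::
  "('i \<Rightarrow> 'f::field) set \<Rightarrow> (('i, 'f) fraction \<times> ('i, 'f) fraction) set" where
  "fraction_rel V = {((p, q), (p', q')). (p, q) \<in> fractions V \<and> (p', q') \<in> fractions V \<and>
     (\<forall>x\<in>V. p x * q' x = p' x * q x)}"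

definition function_field :: "('i \<Rightarrow> 'f::field) set \<Rightarrow> ('i, 'f) fraction set ring" where
  "function_field V =
    \<lparr>carrier = fractions V // fraction_rel V,
     monoid.mult = (\<lambda>C D. \<Union>(p, q)\<in>C. \<Union>(p', q')\<in>D.
        fraction_rel V `` {(\<lambda>x. p x * p' x, \<lambda>x. q x * q' x)}),
     monoid.one = fraction_rel V `` {(\<lambda>_. 1, \<lambda>_. 1)},
     ring.zero = fraction_rel V `` {(\<lambda>_. 0, \<lambda>_. 1)},
     ring.add = (\<lambda>C D. \<Union>(p, q)\<in>C. \<Union>(p', q')\<in>D.
        fraction_rel V `` {(\<lambda>x. p x * q' x + p' x * q x, \<lambda>x. q x * q' x)})\<rparr>"

text \<open>
  For a morphism \<open>f\<close> from \<open>V\<close> onto \<open>W\<close>, the induced homomorphism \<open>p/q \<mapsto> (p \<circ> f)/(q \<circ> f)\<close> from the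
  function field of \<open>W\<close> to that of \<open>V\<close>. As \<open>f\<close> is only given on \<open>V\<close>, the image is described as the
  class of the fractions of polynomials in the coordinates of \<open>V\<close> that agree with it on \<open>V\<close>.
\<close>

definition pullback ::
  "('i \<Rightarrow> 'f::field) set \<Rightarrow> (('i \<Rightarrow> 'f) \<Rightarrow> ('j \<Rightarrow> 'f)) \<Rightarrow> ('j, 'f) fraction set \<Rightarrow> ('i, 'f) fraction set"
where
  "pullback V f C =
     {(p', q') \<in> fractions V. \<exists>(p, q)\<in>C. \<forall>x\<in>V. p' x * q (f x) = p (f x) * q' x}"

text \<open>
  The field extensions below are given by a field \<open>L\<close> and the carrier \<open>F\<close> of a subfield.
  As in HOL-Algebra, univariate polynomials are lists whose head is the leading coefficient.
\<close>

definition list_pderiv :: "('a, 'b) ring_scheme \<Rightarrow> 'a list \<Rightarrow> 'a list" where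
  "list_pderiv L p = ring.normalize L
     (map (\<lambda>i. add_pow L (length p - 1 - i) (p ! i)) [0..<length p - 1])"

definition separable_over :: "('a, 'b) ring_scheme \<Rightarrow> 'a set \<Rightarrow> 'a \<Rightarrow> bool" where
  "separable_over L F x \<longleftrightarrow> (\<exists>p\<in>carrier (univ_poly L F).
     pirreducible\<^bsub>L\<^esub> F p \<and> ring.eval L p x = \<zero>\<^bsub>L\<^esub> \<and>
     (\<forall>d\<in>carrier (univ_poly L F).
        d divides\<^bsub>univ_poly L F\<^esub> p \<and> d divides\<^bsub>univ_poly L F\<^esub> list_pderiv L p \<longrightarrow>
        d \<in> Units (univ_poly L F)))"

text \<open>
  \<open>S\<close> is algebraically independent over \<open>F\<close> if no non-trivial polynomial relation
  \<open>\<Sum>\<^sub>\<alpha> c\<^sub>\<alpha> \<Prod>\<^sub>s s\<^bsup>\<alpha>(s)\<^esup> = 0\<close> holds, where the \<open>c\<^sub>\<alpha>\<close> are in \<open>F\<close> and the variables are the elements of \<open>S\<close>.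
\<close>

definition algebraically_independent :: "('a, 'b) ring_scheme \<Rightarrow> 'a set \<Rightarrow> 'a set \<Rightarrow> bool" where
  "algebraically_independent L F S \<longleftrightarrow>
     (\<forall>(E :: ('a \<Rightarrow>\<^sub>0 nat) set) c. finite E \<and> (\<forall>\<alpha>\<in>E. Poly_Mapping.keys \<alpha> \<subseteq> S) \<and> c ` E \<subseteq> F \<and>
        (\<Oplus>\<^bsub>L\<^esub>\<alpha>\<in>E. c \<alpha> \<otimes>\<^bsub>L\<^esub> (\<Otimes>\<^bsub>L\<^esub>s\<in>Poly_Mapping.keys \<alpha>. s [^]\<^bsub>L\<^esub> Poly_Mapping.lookup \<alpha> s)) = \<zero>\<^bsub>L\<^esub> \<longrightarrow>
        (\<forall>\<alpha>\<in>E. c \<alpha> = \<zero>\<^bsub>L\<^esub>))"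

definition separably_generated :: "('a, 'b) ring_scheme \<Rightarrow> 'a set \<Rightarrow> bool" where
  "separably_generated L F \<longleftrightarrow>
     (\<exists>S\<subseteq>carrier L. algebraically_independent L F S \<and>
        (\<forall>x\<in>carrier L. separable_over L (generate_field L (F \<union> S)) x))"


section \<open>Jets and the orbit map\<close>

text \<open>
  The class of \<open>A\<close> modulo \<open>\<mm>\<^sup>l\<^sup>+\<^sup>1\<close> is represented by the coefficients of \<open>A\<close> in degrees
  at most \<open>l\<close>, which are the coordinates of the finite-dimensional space of \<open>l\<close>-jets; the remaining
  coordinates are set to \<open>0\<close>.
\<close>

definition mono_degree :: "('s::finite \<Rightarrow>\<^sub>0 nat) \<Rightarrow> nat" where
  "mono_degree \<alpha> = (\<Sum>i\<in>UNIV. Poly_Mapping.lookup \<alpha> i)"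

definition jet :: "nat \<Rightarrow> ('s::finite, 'k::field) mps ^ 'm \<Rightarrow> ('m \<times> ('s \<Rightarrow>\<^sub>0 nat) \<Rightarrow> 'k)" where
  "jet l A = (\<lambda>(i, \<alpha>). if mono_degree \<alpha> \<le> l then mps_nth (A $ i) \<alpha> else 0)"

definition jet_aut ::
  "nat \<Rightarrow> (('s::finite, 'k::field) mps \<Rightarrow> ('s, 'k) mps) \<Rightarrow> ('s \<times> ('s \<Rightarrow>\<^sub>0 nat) \<Rightarrow> 'k)" where
  "jet_aut l \<phi> = jet l (\<chi> i. \<phi> (mps_var i))"

definition jet_group :: "nat \<Rightarrow> ('s::finite \<times> ('s \<Rightarrow>\<^sub>0 nat) \<Rightarrow> 'k::field) set" where
  "jet_group l = jet_aut l ` mps_automorphisms"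

definition orbit_map ::
  "nat \<Rightarrow> ('s::finite, 'k::field) mps ^ 'm \<Rightarrow>
   ('s \<times> ('s \<Rightarrow>\<^sub>0 nat) \<Rightarrow> 'k) \<Rightarrow> ('m \<times> ('s \<Rightarrow>\<^sub>0 nat) \<Rightarrow> 'k)" where
  "orbit_map l A g = (THE y. \<exists>\<phi>\<in>mps_automorphisms. jet_aut l \<phi> = g \<and> y = jet l (map_col \<phi> A))"

definition jet_orbit ::
  "nat \<Rightarrow> ('s::finite, 'k::field) mps ^ 'm \<Rightarrow> ('m \<times> ('s \<Rightarrow>\<^sub>0 nat) \<Rightarrow> 'k) set" where
  "jet_orbit l A = orbit_map l A ` jet_group l"

text \<open>
  The base change to the algebraic closure of the group of \<open>l\<close>-jets over \<open>K\<close> (which, as a variety, is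
  the space of \<open>s\<close>-tuples of polynomials of degree at most \<open>l\<close> without constant term and with
  invertible linear part) is the group of \<open>l\<close>-jets formed over the algebraic closure.
  For finite \<open>K\<close> it is not determined by the \<open>K\<close>-rational points.
\<close>

definition orbit_map_separable :: "nat \<Rightarrow> ('s::finite, 'k::field) mps ^ 'm \<Rightarrow> bool" where
  "orbit_map_separable l A \<longleftrightarrow>
     (let A' = map_col (mps_map to_ac) A;
          G = (jet_group l :: ('s \<times> ('s \<Rightarrow>\<^sub>0 nat) \<Rightarrow> 'k alg_closure) set)
      in separably_generated (function_field G)
           (pullback G (orbit_map l A') ` carrier (function_field (jet_orbit l A'))))"

end

theory Submission
  imports Defs "HOL-Analysis.Determinants" "HOL-Computational_Algebra.Polynomial"
begin

text \<open>
  The infinite codimension for \<open>m > s\<close> is a dimension count modulo high powers of \<open>\<mm>\<close>. If the linear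
  parts of the \<open>a\<^sub>i\<close> are independent, the \<open>a\<^sub>i\<close> extend to a coordinate system, and so does every \<open>B\<close>
  with the same linear parts; the two coordinate changes compose to an automorphism from \<open>A\<close> to \<open>B\<close>.

  Conversely, let \<open>m > 1\<close>, let \<open>f \<in> \<mm>\<^sup>2\<close> be a non-trivial combination of the \<open>a\<^sub>i\<close> and let \<open>g\<close> be another
  entry. If \<open>A\<close> is determined, so is the pair \<open>(f, g)\<close>, and its high order terms may be replaced such
  that \<open>f\<close> and \<open>g\<close> are polynomials with convenient leading forms. Let \<open>I\<close> be the ideal of the
  \<open>2 \<times> 2\<close> minors of the Jacobian matrix. The leading forms make the polynomials a finitely generated
  module over \<open>K[g]\<close> modulo \<open>I\<close>. Hence there is a relation \<open>\<Sum>\<^sub>i c\<^sub>i(g) f\<^sup>i \<in> I\<close>. The pair is equivalent to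
  \<open>(f + g\<^sup>a, g)\<close> for all large \<open>a\<close>, which has the same ideal \<open>I\<close>, so \<open>\<Sum>\<^sub>i c\<^sub>i(g) (f + g\<^sup>a)\<^sup>i \<in> I\<close> for all
  large \<open>a\<close>, and eliminating between these relations gives \<open>g\<^sup>M \<in> I\<close>. As some power of each variable
  lies in \<open>I + (g)\<close>, the ideal \<open>I\<close> contains a power of each variable. This contradicts the case of the
  Eagon-Northcott height bound needed here, which Cramer's rule proves directly.
\<close>

text \<open>Determinacy supplies automorphisms and nothing infinitesimal, so the converse rests on
  an object that automorphisms transport: the ideal of Jacobian minors. Adding \<open>g^a\<close> to
  \<open>f\<close> is a row operation on the Jacobian matrix. Hence \<open>I\<close> stays literally
  the same while the relation varies with \<open>a\<close>, and the coefficients \<open>c_i\<close>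
  do not depend on \<open>a\<close>; both facts are what makes elimination possible. The relation
  comes from counting over the polynomial ring, so its top coefficient need not be 1; but a nonzero
  polynomial in \<open>g\<close> is a power of \<open>g\<close> times a unit, and therefore a power
  of \<open>g\<close> is what comes out. The leading forms are those of highest degree:
  \<open>g\<close> ends in the sum of the \<open>x_j^d\<close>, \<open>f\<close> in the sum of the
  \<open>x_j^(d + e_j)\<close>. All these exponents are prime to a positive characteristic and so
  survive differentiation, and the \<open>e_j\<close> are pairwise distinct, so the two products in
  a minor have different degrees. The condition that \<open>f\<close> lies in the square of the
  maximal ideal makes the first Jacobian row vanish at the origin, which keeps \<open>I\<close> a
  proper ideal.\<close>

no_notation fps_nth (infixl "$" 75)

section \<open>Arithmetic of formal power series: order, degree, completeness, units\<close>

subsection \<open>Monomials\<close>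

lemma lookup_le_mono_degree: "Poly_Mapping.lookup \<alpha> i \<le> mono_degree \<alpha>"
  unfolding mono_degree_def by (rule member_le_sum) auto

lemma finite_mono_degree_le: "finite {\<alpha> :: 's::finite \<Rightarrow>\<^sub>0 nat. mono_degree \<alpha> \<le> n}"
proof -
  have "Poly_Mapping.lookup ` {\<alpha> :: 's \<Rightarrow>\<^sub>0 nat. mono_degree \<alpha> \<le> n} \<subseteq> Pi UNIV (\<lambda>_. {..n})"
    using lookup_le_mono_degree order_trans by fastforce
  moreover have "finite (Pi (UNIV :: 's set) (\<lambda>_. {..n}))"
    using finite_PiE[of "UNIV :: 's set" "\<lambda>_. {..n}"] by (simp add: PiE_def)
  ultimately have "finite (Poly_Mapping.lookup ` {\<alpha> :: 's \<Rightarrow>\<^sub>0 nat. mono_degree \<alpha> \<le> n})"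
    by (rule finite_subset)
  thus ?thesis
    by (rule finite_imageD) (simp add: inj_on_def lookup_inject)
qed

lemma mono_degree_add: "mono_degree (\<alpha> + \<beta>) = mono_degree \<alpha> + mono_degree \<beta>"
  by (simp add: mono_degree_def lookup_add sum.distrib)

lemma mono_degree_zero [simp]: "mono_degree 0 = 0"
  by (simp add: mono_degree_def)

lemma mono_degree_single [simp]: "mono_degree (Poly_Mapping.single i n) = n"
  by (simp add: mono_degree_def lookup_single when_def)

lemma mono_degree_eq_0_iff: "mono_degree \<alpha> = 0 \<longleftrightarrow> \<alpha> = 0"
  by (auto simp: mono_degree_def intro!: poly_mapping_eqI)

lemma single_add_cases:
  fixes \<alpha> :: "'s \<Rightarrow>\<^sub>0 nat"
  assumes "Poly_Mapping.lookup \<alpha> i \<ge> n"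
  obtains \<beta> where "\<alpha> = \<beta> + Poly_Mapping.single i n"
proof
  show "\<alpha> = (\<alpha> - Poly_Mapping.single i n) + Poly_Mapping.single i n"
    using assms by (intro poly_mapping_eqI) (auto simp: lookup_add lookup_minus lookup_single when_def)
qed

subsection \<open>Order and degree of power series\<close>

lemma mps_nth_zero [simp]: "mps_nth 0 \<alpha> = 0" by transfer simp
lemma mps_nth_one: "mps_nth 1 \<alpha> = (if \<alpha> = 0 then 1 else 0)" by transfer simp
lemma mps_nth_add [simp]: "mps_nth (f + g) \<alpha> = mps_nth f \<alpha> + mps_nth g \<alpha>" by transfer simp
lemma mps_nth_diff [simp]: "mps_nth (f - g) \<alpha> = mps_nth f \<alpha> - mps_nth g \<alpha>" by transfer simp
lemma mps_nth_uminus [simp]: "mps_nth (- f) \<alpha> = - mps_nth f \<alpha>" by transfer simp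
lemma mps_nth_mult: "mps_nth (f * g) \<alpha> = (\<Sum>(\<beta>, \<gamma>)\<in>splits \<alpha>. mps_nth f \<beta> * mps_nth g \<gamma>)"
  by transfer simp
lemma mps_nth_sum: "mps_nth (sum f S) \<alpha> = (\<Sum>i\<in>S. mps_nth (f i) \<alpha>)"
  by (induction S rule: infinite_finite_induct) auto
lemma mps_nth_pderiv:
  "mps_nth (mps_pderiv \<nu> f) \<alpha> =
     of_nat (Poly_Mapping.lookup \<alpha> \<nu> + 1) * mps_nth f (\<alpha> + Poly_Mapping.single \<nu> 1)"
  by transfer simp

definition mps_monom :: "('s \<Rightarrow>\<^sub>0 nat) \<Rightarrow> ('s, 'a::comm_ring_1) mps" where
  "mps_monom \<alpha> = Abs_mps (\<lambda>\<beta>. if \<beta> = \<alpha> then 1 else 0)"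

lemma mps_nth_monom: "mps_nth (mps_monom \<alpha>) \<beta> = (if \<beta> = \<alpha> then 1 else 0)"
  by (simp add: mps_monom_def Abs_mps_inverse)

lemma mps_nth_monom_mult:
  "mps_nth (mps_monom \<beta> * f) (\<beta> + \<gamma>) = mps_nth f \<gamma>"
proof -
  have "mps_nth (mps_monom \<beta> * f) (\<beta> + \<gamma>) =
      (\<Sum>(\<delta>, \<epsilon>)\<in>splits (\<beta> + \<gamma>). (if \<delta> = \<beta> then 1 else 0) * mps_nth f \<epsilon>)"
    by (simp add: mps_nth_mult mps_nth_monom)
  also have "\<dots> = (\<Sum>(\<delta>, \<epsilon>)\<in>{(\<beta>, \<gamma>)}. (if \<delta> = \<beta> then 1 else 0) * mps_nth f \<epsilon>)"
    by (rule sum.mono_neutral_right[OF finite_splits]) (auto simp: splits_def split: if_splits)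
  finally show ?thesis by simp
qed

lemma mps_nth_monom_mult_eq_0:
  assumes "\<nexists>\<gamma>. \<alpha> = \<beta> + \<gamma>"
  shows "mps_nth (mps_monom \<beta> * f) \<alpha> = 0"
  unfolding mps_nth_mult
  by (rule sum.neutral) (use assms in \<open>auto simp: splits_def mps_nth_monom\<close>)

lemma mps_monom_mult: "mps_monom \<alpha> * mps_monom \<beta> = mps_monom (\<alpha> + \<beta>)"
proof (rule mps_eqI)
  fix \<gamma>
  show "mps_nth (mps_monom \<alpha> * mps_monom \<beta>) \<gamma> = mps_nth (mps_monom (\<alpha> + \<beta>) :: ('a, 'b) mps) \<gamma>"
  proof (cases "\<exists>\<delta>. \<gamma> = \<alpha> + \<delta>")
    case True
    thus ?thesis by (auto simp: mps_nth_monom_mult mps_nth_monom)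
  next
    case False
    thus ?thesis by (auto simp: mps_nth_monom_mult_eq_0 mps_nth_monom)
  qed
qed

lemma mps_monom_0: "mps_monom 0 = 1"
  by (rule mps_eqI) (simp add: mps_nth_monom mps_nth_one)

lemma mps_monom_prod: "(\<Prod>i\<in>S. mps_monom (f i)) = mps_monom (\<Sum>i\<in>S. f i)"
  by (induction S rule: infinite_finite_induct) (auto simp: mps_monom_0 mps_monom_mult)

lemma mps_nth_const: "mps_nth (mps_const c) \<alpha> = (if \<alpha> = 0 then c else 0)"
  by transfer simp

lemma mps_nth_const_mult [simp]:
  fixes f :: "('a, 'b::comm_ring_1) mps"
  shows "mps_nth (mps_const c * f) \<alpha> = c * mps_nth f \<alpha>"
proof -
  have "mps_nth (mps_const c * f) \<alpha> =
      (\<Sum>(\<delta>, \<epsilon>)\<in>splits \<alpha>. (if \<delta> = 0 then c else 0) * mps_nth f \<epsilon>)"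
    by (simp add: mps_nth_mult mps_nth_const)
  also have "\<dots> = (\<Sum>(\<delta>, \<epsilon>)\<in>{(0 :: 'a \<Rightarrow>\<^sub>0 nat, \<alpha>)}. (if \<delta> = 0 then c else 0) * mps_nth f \<epsilon>)"
    by (rule sum.mono_neutral_right[OF finite_splits]) (auto simp: splits_def split: if_splits)
  finally show ?thesis by simp
qed

lemma mps_const_add: "mps_const (a + b) = mps_const a + mps_const b"
  by (rule mps_eqI) (simp add: mps_nth_const)
lemma mps_const_mult: "mps_const (a * b) = mps_const a * mps_const b"
  by (rule mps_eqI) (simp add: mps_nth_const)
lemma mps_const_0 [simp]: "mps_const 0 = 0"
  by (rule mps_eqI) (simp add: mps_nth_const)
lemma mps_const_1 [simp]: "mps_const 1 = 1"
  by (rule mps_eqI) (simp add: mps_nth_const mps_nth_one)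
lemma mps_const_of_nat: "of_nat n = mps_const (of_nat n)"
  by (induction n) (auto simp: mps_const_add)
lemma mps_const_uminus: "mps_const (- a) = - mps_const a"
  by (rule mps_eqI) (simp add: mps_nth_const)

lemma mps_var_eq_monom: "mps_var i = mps_monom (Poly_Mapping.single i 1)"
  by (rule mps_eqI) (simp add: mps_nth_monom mps_var.rep_eq)

lemma mps_var_power: "mps_var i ^ n = mps_monom (Poly_Mapping.single i n)"
  by (induction n) (auto simp: mps_monom_0 mps_var_eq_monom mps_monom_mult simp flip: single_add)

text \<open>The n-th power of the maximal ideal in terms of coefficients, see
  \<open>ideal_power_max_ideal\<close>.\<close>

definition ord_ge :: "nat \<Rightarrow> ('s::finite, 'a::comm_ring_1) mps set" where
  "ord_ge n = {f. \<forall>\<alpha>. mono_degree \<alpha> < n \<longrightarrow> mps_nth f \<alpha> = 0}"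

definition deg_le :: "nat \<Rightarrow> ('s::finite, 'a::comm_ring_1) mps set" where
  "deg_le n = {f. \<forall>\<alpha>. n < mono_degree \<alpha> \<longrightarrow> mps_nth f \<alpha> = 0}"

lemma ord_ge_0 [simp]: "ord_ge 0 = UNIV" by (simp add: ord_ge_def)
lemma zero_ord_ge [simp]: "0 \<in> ord_ge n" by (simp add: ord_ge_def)
lemma ord_ge_add: "f \<in> ord_ge n \<Longrightarrow> g \<in> ord_ge n \<Longrightarrow> f + g \<in> ord_ge n"
  by (simp add: ord_ge_def)
lemma ord_ge_diff: "f \<in> ord_ge n \<Longrightarrow> g \<in> ord_ge n \<Longrightarrow> f - g \<in> ord_ge n"
  by (simp add: ord_ge_def)
lemma ord_ge_uminus: "f \<in> ord_ge n \<Longrightarrow> - f \<in> ord_ge n"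
  by (simp add: ord_ge_def)
lemma ord_ge_sum: "(\<And>i. i \<in> S \<Longrightarrow> f i \<in> ord_ge n) \<Longrightarrow> sum f S \<in> ord_ge n"
  by (simp add: ord_ge_def mps_nth_sum)
lemma ord_ge_mono: "m \<le> n \<Longrightarrow> f \<in> ord_ge n \<Longrightarrow> f \<in> ord_ge m"
  by (auto simp: ord_ge_def)

lemma ord_ge_mult:
  assumes "f \<in> ord_ge m" "g \<in> ord_ge n"
  shows "f * g \<in> ord_ge (m + n)"
  unfolding ord_ge_def
proof (intro CollectI allI impI)
  fix \<alpha> :: "'a \<Rightarrow>\<^sub>0 nat" assume \<alpha>: "mono_degree \<alpha> < m + n"
  show "mps_nth (f * g) \<alpha> = 0"
    unfolding mps_nth_mult
  proof (rule sum.neutral, safe)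
    fix \<beta> \<gamma> assume "(\<beta>, \<gamma>) \<in> splits \<alpha>"
    hence "mono_degree \<beta> + mono_degree \<gamma> < m + n"
      using \<alpha> by (simp add: splits_def flip: mono_degree_add)
    hence "mono_degree \<beta> < m \<or> mono_degree \<gamma> < n" by linarith
    thus "mps_nth f \<beta> * mps_nth g \<gamma> = 0"
      using assms by (auto simp: ord_ge_def)
  qed
qed

lemma ord_ge_mult_left: "f \<in> ord_ge n \<Longrightarrow> g * f \<in> ord_ge n"
  using ord_ge_mult[of g 0 f n] by simp
lemma ord_ge_mult_right: "f \<in> ord_ge n \<Longrightarrow> f * g \<in> ord_ge n"
  using ord_ge_mult[of f n g 0] by simp

lemma ord_ge_power: "f \<in> ord_ge m \<Longrightarrow> f ^ n \<in> ord_ge (m * n)"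
  by (induction n) (auto intro: ord_ge_mult)

text \<open>The powers of the maximal ideal intersect in zero. Identities between maps on power
  series are proved below by pushing the order of the difference beyond every
  \<open>n\<close>.\<close>

lemma ord_ge_all_imp_0:
  assumes "\<And>n. f \<in> ord_ge n" shows "f = 0"
proof (rule mps_eqI)
  fix \<alpha> show "mps_nth f \<alpha> = mps_nth 0 \<alpha>"
    using assms[of "Suc (mono_degree \<alpha>)"] by (simp add: ord_ge_def)
qed

lemma ord_ge_1_eq: "ord_ge (Suc 0) = max_ideal" "ord_ge 1 = max_ideal"
  by (auto simp: ord_ge_def max_ideal_def mono_degree_eq_0_iff)

lemma mps_monom_ord_ge: "mono_degree \<alpha> \<ge> n \<Longrightarrow> mps_monom \<alpha> \<in> ord_ge n"
  by (auto simp: ord_ge_def mps_nth_monom)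

lemma mps_var_ord_ge [simp]: "mps_var i \<in> ord_ge 1" "mps_var i \<in> ord_ge (Suc 0)"
  by (auto simp: mps_var_eq_monom intro!: mps_monom_ord_ge)

lemma ord_ge_pderiv: "f \<in> ord_ge (Suc n) \<Longrightarrow> mps_pderiv \<nu> f \<in> ord_ge n"
  by (auto simp: ord_ge_def mps_nth_pderiv mono_degree_add)

lemma deg_le_add: "f \<in> deg_le n \<Longrightarrow> g \<in> deg_le n \<Longrightarrow> f + g \<in> deg_le n"
  by (simp add: deg_le_def)
lemma deg_le_diff: "f \<in> deg_le n \<Longrightarrow> g \<in> deg_le n \<Longrightarrow> f - g \<in> deg_le n"
  by (simp add: deg_le_def)
lemma deg_le_sum: "(\<And>i. i \<in> S \<Longrightarrow> f i \<in> deg_le n) \<Longrightarrow> sum f S \<in> deg_le n"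
  by (simp add: deg_le_def mps_nth_sum)
lemma deg_le_mono: "m \<le> n \<Longrightarrow> f \<in> deg_le m \<Longrightarrow> f \<in> deg_le n"
  by (auto simp: deg_le_def)
lemma mps_monom_deg_le: "mono_degree \<alpha> \<le> n \<Longrightarrow> mps_monom \<alpha> \<in> deg_le n"
  by (auto simp: deg_le_def mps_nth_monom)
lemma mps_const_deg_le: "mps_const c \<in> deg_le n"
  by (auto simp: deg_le_def mps_nth_const)
lemma deg_le_const_mult: "f \<in> deg_le n \<Longrightarrow> mps_const c * f \<in> deg_le n"
  by (auto simp: deg_le_def)
lemma deg_le_pderiv: "f \<in> deg_le n \<Longrightarrow> mps_pderiv \<nu> f \<in> deg_le (n - 1)"
  by (auto simp: deg_le_def mps_nth_pderiv mono_degree_add)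

lemma deg_le_mult:
  assumes "f \<in> deg_le m" "g \<in> deg_le n"
  shows "f * g \<in> deg_le (m + n)"
  unfolding deg_le_def
proof (intro CollectI allI impI)
  fix \<alpha> :: "'a \<Rightarrow>\<^sub>0 nat" assume \<alpha>: "m + n < mono_degree \<alpha>"
  show "mps_nth (f * g) \<alpha> = 0"
    unfolding mps_nth_mult
  proof (rule sum.neutral, safe)
    fix \<beta> \<gamma> assume "(\<beta>, \<gamma>) \<in> splits \<alpha>"
    hence "m + n < mono_degree \<beta> + mono_degree \<gamma>"
      using \<alpha> by (simp add: splits_def flip: mono_degree_add)
    hence "m < mono_degree \<beta> \<or> n < mono_degree \<gamma>" by linarith
    thus "mps_nth f \<beta> * mps_nth g \<gamma> = 0"
      using assms by (auto simp: deg_le_def)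
  qed
qed

lemma deg_le_power: "f \<in> deg_le m \<Longrightarrow> f ^ n \<in> deg_le (m * n)"
proof (induction n)
  case 0
  show ?case using mps_const_deg_le[of 1] by simp
qed (auto intro: deg_le_mult)

lemma deg_le_expand:
  assumes "f \<in> deg_le n"
  shows "f = (\<Sum>\<alpha> | mono_degree \<alpha> \<le> n. mps_const (mps_nth f \<alpha>) * mps_monom \<alpha>)"
proof (rule mps_eqI)
  fix \<beta>
  have "mps_nth (\<Sum>\<alpha> | mono_degree \<alpha> \<le> n. mps_const (mps_nth f \<alpha>) * mps_monom \<alpha>) \<beta>
      = (\<Sum>\<alpha> | mono_degree \<alpha> \<le> n. if \<alpha> = \<beta> then mps_nth f \<beta> else 0)"
    unfolding mps_nth_sum by (rule sum.cong) (auto simp: mps_nth_monom)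
  also have "\<dots> = mps_nth f \<beta>"
    using assms by (auto simp: sum.delta[OF finite_mono_degree_le] deg_le_def not_le)
  finally show "mps_nth f \<beta> =
      mps_nth (\<Sum>\<alpha> | mono_degree \<alpha> \<le> n. mps_const (mps_nth f \<alpha>) * mps_monom \<alpha>) \<beta>"
    by (rule sym)
qed

definition mps_trunc :: "nat \<Rightarrow> ('s::finite, 'a::comm_ring_1) mps \<Rightarrow> ('s, 'a) mps" where
  "mps_trunc n f = Abs_mps (\<lambda>\<alpha>. if mono_degree \<alpha> \<le> n then mps_nth f \<alpha> else 0)"

lemma mps_nth_trunc: "mps_nth (mps_trunc n f) \<alpha> = (if mono_degree \<alpha> \<le> n then mps_nth f \<alpha> else 0)"
  by (simp add: mps_trunc_def Abs_mps_inverse)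

lemma mps_trunc_deg_le: "mps_trunc n f \<in> deg_le n"
  by (simp add: deg_le_def mps_nth_trunc)

lemma mps_trunc_diff_ord_ge: "mps_trunc n f - f \<in> ord_ge (Suc n)"
  by (simp add: ord_ge_def mps_nth_trunc)

text \<open>Completeness: a coefficient of degree \<open>d\<close> no longer changes from
  \<open>r d\<close> on, so reading it off there defines the limit.\<close>

lemma mps_limit:
  fixes r :: "nat \<Rightarrow> ('s::finite, 'a::comm_ring_1) mps"
  assumes "\<And>n. r (Suc n) - r n \<in> ord_ge (Suc n)"
  obtains l where "\<And>n. l - r n \<in> ord_ge (Suc n)"
proof
  define l where "l = Abs_mps (\<lambda>\<alpha>. mps_nth (r (mono_degree \<alpha>)) \<alpha>)"
  have step: "mps_nth (r n) \<alpha> = mps_nth (r m) \<alpha>" if "mono_degree \<alpha> \<le> m" "m \<le> n" for \<alpha> m n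
    using \<open>m \<le> n\<close>
  proof (induction n rule: dec_induct)
    case (step n)
    have "mps_nth (r (Suc n) - r n) \<alpha> = 0"
      using assms[of n] that(1) step.hyps unfolding ord_ge_def by simp
    thus ?case using step by simp
  qed simp
  show "l - r n \<in> ord_ge (Suc n)" for n
    unfolding ord_ge_def
  proof (intro CollectI allI impI)
    fix \<alpha> :: "'s \<Rightarrow>\<^sub>0 nat" assume "mono_degree \<alpha> < Suc n"
    thus "mps_nth (l - r n) \<alpha> = 0"
      using step[of \<alpha> "mono_degree \<alpha>" n] by (simp add: l_def Abs_mps_inverse)
  qed
qed

text \<open>Each non-constant monomial is assigned to one of the variables dividing it.\<close>

lemma mps_decompose:
  fixes f :: "('s::finite, 'a::comm_ring_1) mps"
  obtains h where "f = mps_const (mps_nth f 0) + (\<Sum>i\<in>UNIV. mps_var i * h i)"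
    and "\<And>n i. f \<in> ord_ge (Suc n) \<Longrightarrow> h i \<in> ord_ge n"
proof
  define ch :: "('s \<Rightarrow>\<^sub>0 nat) \<Rightarrow> 's" where "ch \<alpha> = (SOME i. Poly_Mapping.lookup \<alpha> i > 0)" for \<alpha>
  have ch: "Poly_Mapping.lookup \<alpha> (ch \<alpha>) > 0" if "\<alpha> \<noteq> 0" for \<alpha>
    using that someI_ex[of "\<lambda>i. Poly_Mapping.lookup \<alpha> i > 0"]
    unfolding ch_def by (metis gr_zeroI lookup_zero poly_mapping_eqI)
  define h where "h i = Abs_mps (\<lambda>\<beta>. if ch (\<beta> + Poly_Mapping.single i 1) = i
     then mps_nth f (\<beta> + Poly_Mapping.single i 1) else 0)" for i
  have h: "mps_nth (h i) \<beta> = (if ch (\<beta> + Poly_Mapping.single i 1) = i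
     then mps_nth f (\<beta> + Poly_Mapping.single i 1) else 0)" for i \<beta>
    by (simp add: h_def Abs_mps_inverse)
  have vh: "mps_nth (mps_var i * h i) \<alpha> = (if \<alpha> \<noteq> 0 \<and> ch \<alpha> = i then mps_nth f \<alpha> else 0)" for i \<alpha>
  proof (cases "\<exists>\<gamma>. \<alpha> = Poly_Mapping.single i 1 + \<gamma>")
    case True
    then obtain \<gamma> where \<gamma>: "\<alpha> = Poly_Mapping.single i 1 + \<gamma>" by blast
    have "\<alpha> \<noteq> 0"
      using \<gamma> by (metis add_eq_0_iff_both_eq_0 mono_degree_add mono_degree_single mono_degree_zero zero_neq_one)
    thus ?thesis
      using \<gamma> by (simp only: mps_var_eq_monom mps_nth_monom_mult h) (auto simp: add.commute)
  next
    case False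
    have "\<not> (\<alpha> \<noteq> 0 \<and> ch \<alpha> = i)"
      using False ch[of \<alpha>] single_add_cases[of 1 \<alpha> i] by (metis One_nat_def Suc_leI add.commute)
    moreover have "mps_nth (mps_var i * h i) \<alpha> = 0"
      using False unfolding mps_var_eq_monom by (rule mps_nth_monom_mult_eq_0)
    ultimately show ?thesis by auto
  qed
  show "f = mps_const (mps_nth f 0) + (\<Sum>i\<in>UNIV. mps_var i * h i)"
    by (rule mps_eqI) (auto simp: mps_nth_sum vh mps_nth_const)
  show "h i \<in> ord_ge n" if "f \<in> ord_ge (Suc n)" for n i
    using that by (auto simp: ord_ge_def h mono_degree_add)
qed

subsection \<open>Units\<close>

text \<open>The inverse is the limit of the partial geometric sums.\<close>

lemma mps_one_minus_unit:
  fixes h :: "('s::finite, 'a::comm_ring_1) mps"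
  assumes "h \<in> ord_ge 1"
  shows "(1 - h) dvd 1"
proof -
  define r where "r n = (\<Sum>i\<le>n. h ^ i)" for n
  have hp: "h ^ n \<in> ord_ge n" for n
    using ord_ge_power[OF assms, of n] by simp
  obtain l where l: "\<And>n. l - r n \<in> ord_ge (Suc n)"
    by (rule mps_limit[of r]) (auto simp: r_def intro: hp simp del: power_Suc)
  have geo: "(1 - h) * r n = 1 - h ^ Suc n" for n
  proof (induction n)
    case (Suc n)
    have "r (Suc n) = r n + h ^ Suc n" by (simp add: r_def)
    hence "(1 - h) * r (Suc n) = (1 - h) * r n + (1 - h) * h ^ Suc n"
      by (simp only: distrib_left)
    thus ?case by (simp only: Suc) (simp add: algebra_simps)
  qed (simp add: r_def)
  have "(1 - h) * l - 1 \<in> ord_ge n" for n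
  proof -
    have "(1 - h) * l - 1 = (1 - h) * (l - r n) - h ^ Suc n"
      using geo[of n] by (simp add: algebra_simps)
    also have "\<dots> \<in> ord_ge (Suc n)"
      by (intro ord_ge_diff ord_ge_mult_left l hp)
    finally show ?thesis by (rule ord_ge_mono[rotated]) simp
  qed
  from ord_ge_all_imp_0[OF this] have "(1 - h) * l = 1" by simp
  thus ?thesis by (metis dvd_triv_left)
qed

lemma mps_unit_iff:
  fixes f :: "('s::finite, 'a::field) mps"
  shows "f dvd 1 \<longleftrightarrow> mps_nth f 0 \<noteq> 0"
proof
  assume "f dvd 1"
  then obtain g where g: "1 = f * g" by auto
  have "mps_nth (f * g) 0 \<noteq> 0" by (simp flip: g add: mps_nth_one)
  thus "mps_nth f 0 \<noteq> 0"
    using ord_ge_mult_right[of f 1 g] by (auto simp: ord_ge_1_eq max_ideal_def)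
next
  assume f0: "mps_nth f 0 \<noteq> 0"
  define h where "h = 1 - mps_const (inverse (mps_nth f 0)) * f"
  have "h \<in> ord_ge 1"
    using f0 by (simp add: ord_ge_1_eq max_ideal_def h_def mps_nth_one)
  from mps_one_minus_unit[OF this] have "mps_const (inverse (mps_nth f 0)) * f dvd 1"
    by (simp add: h_def)
  thus "f dvd 1" using dvd_mult_right by blast
qed

subsection \<open>Powers of the maximal ideal\<close>

lemma module_mult: "Modules.module ((*) :: 'r::comm_ring_1 \<Rightarrow> 'r \<Rightarrow> 'r)"
  by unfold_locales (auto simp: algebra_simps)

lemma module_vec: "Modules.module ((*s) :: 'r::comm_ring_1 \<Rightarrow> 'r ^ 'm \<Rightarrow> 'r ^ 'm)"
  by unfold_locales (auto simp: vec_eq_iff algebra_simps)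

lemma ideal_power_max_ideal: "ideal_power max_ideal n = (ord_ge n :: ('s::finite, 'a::comm_ring_1) mps set)"
proof (induction n)
  case 0
  show ?case by simp
next
  case (Suc n)
  let ?G = "{a * b |a b :: ('s, 'a) mps. a \<in> max_ideal \<and> b \<in> ideal_power max_ideal n}"
  interpret Modules.module "(*) :: ('s, 'a) mps \<Rightarrow> _" by (rule module_mult)
  have "subspace (ord_ge (Suc n) :: ('s, 'a) mps set)"
    by (auto simp: subspace_def intro: ord_ge_add ord_ge_mult_left)
  moreover have "?G \<subseteq> ord_ge (Suc n)"
    unfolding Suc unfolding ord_ge_1_eq(1)[symmetric] using ord_ge_mult[of _ 1 _ n] by auto
  ultimately have "span ?G \<subseteq> ord_ge (Suc n)"
    using span_minimal by blast
  moreover have "f \<in> span ?G" if f: "f \<in> ord_ge (Suc n)" for f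
  proof -
    obtain h where h: "f = mps_const (mps_nth f 0) + (\<Sum>i\<in>UNIV. mps_var i * h i)"
      and hn: "\<And>n i. f \<in> ord_ge (Suc n) \<Longrightarrow> h i \<in> ord_ge n"
      using mps_decompose[of f] by blast
    have "mps_nth f 0 = 0" using f by (auto simp: ord_ge_def)
    have "mps_var i * h i \<in> span ?G" for i
      using hn[OF f, of i] mps_var_ord_ge(1)[of i]
      unfolding Suc unfolding ord_ge_1_eq(2)[symmetric] by (intro span_base) blast
    hence "(\<Sum>i\<in>UNIV. mps_var i * h i) \<in> span ?G"
      by (intro span_sum)
    with \<open>mps_nth f 0 = 0\<close> h show ?thesis
      by simp
  qed
  ultimately show ?case by auto
qed

lemma ideal_smult_ideal_power:
  "ideal_smult (ideal_power max_ideal n) UNIV =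
     {A :: ('s::finite, 'a::comm_ring_1) mps ^ 'm::finite. \<forall>i. A $ i \<in> ord_ge n}"
proof -
  let ?G = "{a *s v |a (v :: ('s, 'a) mps ^ 'm). a \<in> ord_ge n \<and> v \<in> UNIV}"
  interpret Modules.module "(*s) :: ('s, 'a) mps \<Rightarrow> ('s, 'a) mps ^ 'm \<Rightarrow> _" by (rule module_vec)
  have "subspace {A :: ('s, 'a) mps ^ 'm. \<forall>i. A $ i \<in> ord_ge n}"
    by (auto simp: subspace_def intro: ord_ge_add ord_ge_mult_left)
  hence "span ?G \<subseteq> {A. \<forall>i. A $ i \<in> ord_ge n}"
    by (rule span_minimal[rotated]) (auto intro: ord_ge_mult_right)
  moreover have "A \<in> span ?G" if A: "\<forall>i. A $ i \<in> ord_ge n" for A :: "('s, 'a) mps ^ 'm"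
  proof -
    have "A = (\<Sum>i\<in>UNIV. (A $ i) *s axis i 1)"
      by (simp add: vec_eq_iff axis_def if_distrib sum.delta' cong: if_cong)
    also have "\<dots> \<in> span ?G"
      using A by (intro span_sum span_base) auto
    finally show ?thesis .
  qed
  ultimately show ?thesis
    unfolding ideal_smult_def ideal_power_max_ideal by blast
qed

lemma ideal_smult_max_ideal:
  "ideal_smult max_ideal UNIV =
     {A :: ('s::finite, 'a::comm_ring_1) mps ^ 'm::finite. \<forall>i. A $ i \<in> ord_ge 1}"
proof -
  have "max_ideal = (ideal_power max_ideal 1 :: ('s, 'a) mps set)"
    by (simp only: ideal_power_max_ideal ord_ge_1_eq)
  thus ?thesis using ideal_smult_ideal_power by metis
qed

section \<open>Linear algebra over commutative rings and the ideal of minors\<close>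

subsection \<open>Linear systems with more unknowns than equations\<close>

lemma ex_nontrivial_solution:
  fixes a :: "'i \<Rightarrow> 'j \<Rightarrow> 'r::idom"
  assumes "finite Y" "finite Z" "card Y < card Z"
  shows "\<exists>c. (\<exists>x\<in>Z. c x \<noteq> 0) \<and> (\<forall>y\<in>Y. (\<Sum>x\<in>Z. c x * a x y) = 0)"
  using assms
proof (induction Y arbitrary: Z a rule: finite_induct)
  case empty
  then obtain x where "x \<in> Z" by fastforce
  thus ?case by (intro exI[of _ "\<lambda>_. 1"]) auto
next
  case (insert y Y)
  show ?case
  proof (cases "\<exists>x\<in>Z. a x y \<noteq> 0")
    case False
    have "card Y < card Z" using insert by simp
    from insert.IH[OF insert.prems(1) this, of a] False show ?thesis by auto
  next
    case True
    then obtain x0 where x0: "x0 \<in> Z" "a x0 y \<noteq> 0" by blast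
    have "card Y < card (Z - {x0})" using insert x0 by simp
    from insert.IH[OF finite_Diff[OF insert.prems(1)] this, of "\<lambda>x z. a x0 y * a x z - a x y * a x0 z"]
    obtain c x1 where c: "x1 \<in> Z - {x0}" "c x1 \<noteq> 0"
      "\<And>z. z \<in> Y \<Longrightarrow> (\<Sum>x\<in>Z - {x0}. c x * (a x0 y * a x z - a x y * a x0 z)) = 0"
      by blast
    define S where "S = (\<Sum>x\<in>Z - {x0}. c x * a x y)"
    define c' where "c' x = (if x = x0 then - S else a x0 y * c x)" for x
    have sum_c': "(\<Sum>x\<in>Z. c' x * a x z) = a x0 y * (\<Sum>x\<in>Z - {x0}. c x * a x z) - S * a x0 z" for z
    proof -
      have "(\<Sum>x\<in>Z. c' x * a x z) = c' x0 * a x0 z + (\<Sum>x\<in>Z - {x0}. c' x * a x z)"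
        using x0 insert.prems by (simp add: sum.remove)
      also have "(\<Sum>x\<in>Z - {x0}. c' x * a x z) = a x0 y * (\<Sum>x\<in>Z - {x0}. c x * a x z)"
        unfolding sum_distrib_left by (rule sum.cong) (auto simp: c'_def)
      finally show ?thesis by (simp add: c'_def)
    qed
    have "(\<Sum>x\<in>Z. c' x * a x z) = 0" if "z \<in> insert y Y" for z
    proof (cases "z = y")
      case True
      thus ?thesis unfolding sum_c' by (simp add: S_def)
    next
      case False
      have "(\<Sum>x\<in>Z - {x0}. c x * (a x0 y * a x z - a x y * a x0 z))
          = a x0 y * (\<Sum>x\<in>Z - {x0}. c x * a x z) - S * a x0 z"
        by (simp add: S_def sum_distrib_left sum_distrib_right algebra_simps sum_subtractf)
      thus ?thesis using c(3)[of z] False that by (simp add: sum_c')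
    qed
    moreover have "c' x1 \<noteq> 0" using c x0 by (auto simp: c'_def)
    ultimately show ?thesis using c(1) by blast
  qed
qed

subsection \<open>Cramer's rule over a commutative ring\<close>

text \<open>After expanding the replaced row linearly, every term except j = k has two equal
  rows.\<close>

lemma cramer_comm_ring_transpose:
  fixes A :: "'a::comm_ring_1 ^ 'n::finite ^ 'n"
  shows "det (\<chi> i. if i = k then (\<Sum>j\<in>UNIV. x $ j *s row j A) else row i A) = x $ k * det A"
proof -
  have "det (\<chi> i. if i = k then (\<Sum>j\<in>UNIV. x $ j *s row j A) else row i A) =
      (\<Sum>j\<in>UNIV. det (\<chi> i. if i = k then x $ j *s row j A else row i A))"
    by (rule det_linear_row_sum) simp
  also have "\<dots> = (\<Sum>j\<in>UNIV. x $ j * det (\<chi> i. if i = k then row j A else row i A))"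
    by (simp add: det_row_mul)
  also have "\<dots> = (\<Sum>j\<in>UNIV. if j = k then x $ k * det A else 0)"
  proof (rule sum.cong[OF refl])
    fix j
    show "x $ j * det (\<chi> i. if i = k then row j A else row i A) = (if j = k then x $ k * det A else 0)"
    proof (cases "j = k")
      case True
      have "(\<chi> i. if i = k then row j A else row i A) = A"
        using True by (simp add: vec_eq_iff row_def)
      thus ?thesis using True by simp
    next
      case False
      hence "det (\<chi> i. if i = k then row j A else row i A) = 0"
        by (intro det_identical_rows[of j k]) (auto simp: row_def vec_eq_iff)
      thus ?thesis using False by simp
    qed
  qed
  also have "\<dots> = x $ k * det A" by simp
  finally show ?thesis .
qed

lemma cramer_comm_ring:
  fixes A :: "'a::comm_ring_1 ^ 'n::finite ^ 'n"
  shows "det (\<chi> i j. if j = k then (A *v x) $ i else A $ i $ j) = x $ k * det A"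
proof -
  have "Finite_Cartesian_Product.transpose (\<chi> i j. if j = k then (A *v x) $ i else A $ i $ j) =
      (\<chi> i. if i = k then (\<Sum>j\<in>UNIV. x $ j *s row j (Finite_Cartesian_Product.transpose A)) else row i (Finite_Cartesian_Product.transpose A))"
    by (auto simp: vec_eq_iff Finite_Cartesian_Product.transpose_def row_def matrix_vector_mult_def mult.commute)
  from arg_cong[OF this, of det] show ?thesis
    unfolding det_transpose cramer_comm_ring_transpose .
qed

text \<open>Each product in the Leibniz formula has exactly one factor from column
  \<open>k\<close>.\<close>

lemma det_column_in_ideal:
  fixes A :: "'a::comm_ring_1 ^ 'n::finite ^ 'n"
  assumes "\<And>i. A $ i $ k \<in> J" "0 \<in> J" "\<And>a b. a \<in> J \<Longrightarrow> b \<in> J \<Longrightarrow> a + b \<in> J"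
    "\<And>a b. b \<in> J \<Longrightarrow> a * b \<in> J"
  shows "det A \<in> J"
proof -
  have *: "sum f S \<in> J" if "\<And>x. x \<in> S \<Longrightarrow> f x \<in> J" for S and f :: "('n \<Rightarrow> 'n) \<Rightarrow> 'a"
    using that assms by (induction S rule: infinite_finite_induct) auto
  have "(\<Prod>i\<in>UNIV. A $ i $ p i) \<in> J" if p: "p permutes UNIV" for p
  proof -
    obtain i where i: "p i = k" using surjD[OF permutes_surj[OF p], of k] by blast
    have "(\<Prod>i\<in>UNIV. A $ i $ p i) = (\<Prod>i\<in>UNIV - {i}. A $ i $ p i) * (A $ i $ p i)"
      by (subst prod.remove[of _ i]) (auto simp: mult.commute)
    thus ?thesis using assms(1,4) i by simp
  qed
  thus ?thesis unfolding det_def by (intro *) (auto intro: assms(4))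
qed

subsection \<open>Matrices expressing powers of the variables by the variables\<close>

text \<open>For finitely many variables, the ideal generated by the N-th powers of the variables in
  \<open>L\<close>: membership in a monomial ideal can be tested on each monomial that
  occurs.\<close>

definition pow_ideal :: "nat \<Rightarrow> 's set \<Rightarrow> ('s, 'a::comm_ring_1) mps set" where
  "pow_ideal N L = {f. \<forall>\<alpha>. mps_nth f \<alpha> \<noteq> 0 \<longrightarrow> (\<exists>l\<in>L. N \<le> Poly_Mapping.lookup \<alpha> l)}"

lemma pow_ideal_add:
  assumes "f \<in> pow_ideal N L" "g \<in> pow_ideal N L"
  shows "f + g \<in> pow_ideal N L"
  unfolding pow_ideal_def
proof (intro CollectI allI impI)
  fix \<alpha> assume "mps_nth (f + g) \<alpha> \<noteq> 0"
  hence "mps_nth f \<alpha> \<noteq> 0 \<or> mps_nth g \<alpha> \<noteq> 0" by auto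
  thus "\<exists>l\<in>L. N \<le> Poly_Mapping.lookup \<alpha> l"
    using assms unfolding pow_ideal_def by blast
qed

lemma pow_ideal_zero: "0 \<in> pow_ideal N L"
  by (simp add: pow_ideal_def)

lemma pow_ideal_mult:
  assumes "g \<in> pow_ideal N L" shows "f * g \<in> pow_ideal N L"
  unfolding pow_ideal_def
proof (intro CollectI allI impI)
  fix \<alpha> assume "mps_nth (f * g) \<alpha> \<noteq> 0"
  then obtain \<beta> \<gamma> where "(\<beta>, \<gamma>) \<in> splits \<alpha>" "mps_nth f \<beta> * mps_nth g \<gamma> \<noteq> 0"
    unfolding mps_nth_mult by (metis (mono_tags, lifting) case_prodE sum.neutral split_conv surj_pair)
  hence "\<alpha> = \<beta> + \<gamma>" "mps_nth g \<gamma> \<noteq> 0" by (auto simp: splits_def)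
  moreover from this obtain l where "l \<in> L" "N \<le> Poly_Mapping.lookup \<gamma> l"
    using assms by (auto simp: pow_ideal_def)
  ultimately show "\<exists>l\<in>L. N \<le> Poly_Mapping.lookup \<alpha> l"
    by (intro bexI[of _ l]) (auto simp: lookup_add)
qed

lemma pow_ideal_mono: "L \<subseteq> L' \<Longrightarrow> f \<in> pow_ideal N L \<Longrightarrow> f \<in> pow_ideal N L'"
  unfolding pow_ideal_def by blast

lemma mps_var_power_pow_ideal: "l \<in> L \<Longrightarrow> mps_var l ^ N \<in> pow_ideal N L"
  unfolding mps_var_power pow_ideal_def mem_Collect_eq mps_nth_monom
  by (auto split: if_splits intro!: bexI[of _ l])

text \<open>Multiplication by \<open>x_r\<close> changes none of the exponents that membership
  inspects.\<close>

lemma pow_ideal_var_cancel: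
  assumes "mps_var r * f \<in> pow_ideal N L" "r \<notin> L"
  shows "f \<in> pow_ideal N L"
  unfolding pow_ideal_def
proof (intro CollectI allI impI)
  fix \<alpha> assume "mps_nth f \<alpha> \<noteq> 0"
  hence "mps_nth (mps_var r * f) (Poly_Mapping.single r 1 + \<alpha>) \<noteq> 0"
    unfolding mps_var_eq_monom mps_nth_monom_mult .
  then obtain l where "l \<in> L" "N \<le> Poly_Mapping.lookup (Poly_Mapping.single r 1 + \<alpha>) l"
    using assms(1) by (auto simp: pow_ideal_def)
  with assms(2) show "\<exists>l\<in>L. N \<le> Poly_Mapping.lookup \<alpha> l"
    by (intro bexI[of _ l]) (auto simp: lookup_add lookup_single when_def split: if_splits)
qed

text \<open>
  Both \<open>e\<close> and the diagonal matrix with entries \<open>x\<^sub>l\<^bsup>N-1\<^esup>\<close> map \<open>(x\<^sub>1, \<dots>, x\<^sub>s)\<close> to the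
  \<open>N\<close>-th powers; replacing one row of the first by the corresponding row of the second changes
  the determinant only modulo \<open>(x\<^sub>1\<^sup>N, \<dots>, x\<^sub>s\<^sup>N)\<close>, by Cramer's rule.
\<close>

lemma det_variable_power_matrix_nonzero:
  fixes e :: "('s::finite, 'a::comm_ring_1) mps ^ 's ^ 's"
  assumes e: "\<And>l. (\<Sum>k\<in>UNIV. e $ l $ k * mps_var k) = mps_var l ^ N"
    and N: "N > 0"
  shows "det e \<noteq> 0"
proof -
  define D :: "('s, 'a) mps ^ 's ^ 's" where
    "D = (\<chi> l k. if l = k then mps_var l ^ (N - 1) else 0)"
  have D: "(\<Sum>k\<in>UNIV. D $ l $ k * mps_var k) = mps_var l ^ N" for l
  proof -
    have "(\<Sum>k\<in>UNIV. D $ l $ k * mps_var k) = (\<Sum>k\<in>UNIV. if k = l then mps_var l ^ (N - 1) * mps_var l else 0)"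
      by (rule sum.cong) (auto simp: D_def)
    also have "\<dots> = mps_var l ^ N" using N by (cases N) (auto simp: mult.commute)
    finally show ?thesis .
  qed
  define H where "H S = (\<chi> l. if l \<in> S then e $ l else D $ l)" for S
  \<comment> \<open>Rows of \<open>D\<close> are exchanged for rows of \<open>e\<close> one at a
    time; \<open>S\<close> holds the rows already exchanged.\<close>
  have "det (H S) - det D \<in> pow_ideal N UNIV" for S :: "'s set"
  proof (induction S rule: infinite_finite_induct)
    case empty
    have "H {} = D" by (simp add: H_def vec_eq_iff)
    thus ?case by (simp add: pow_ideal_zero)
  next
    case (insert r S)
    \<comment> \<open>By linearity in row \<open>r\<close>, \<open>det Z\<close> is the error of one
      exchange. Row \<open>r\<close> of \<open>Z\<close> annihilates the vector of variables, since
      both rows map it to the same power.\<close>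
    define Z where "Z = (\<chi> l. if l = r then e $ r - D $ r else H S $ l)"
    have eq: "det (H (insert r S)) = det Z + det (H S)"
    proof -
      have "det (\<chi> l. if l = r then (e $ r - D $ r) + D $ r else H S $ l) =
          det (\<chi> l. if l = r then e $ r - D $ r else H S $ l) +
          det (\<chi> l. if l = r then D $ r else H S $ l)"
        by (rule det_row_add)
      moreover have "(\<chi> l. if l = r then (e $ r - D $ r) + D $ r else H S $ l) = H (insert r S)"
        by (auto simp: H_def vec_eq_iff)
      moreover have "(\<chi> l. if l = r then D $ r else H S $ l) = H S"
        using insert by (auto simp: H_def vec_eq_iff)
      ultimately show ?thesis by (simp add: Z_def)
    qed
    let ?x = "(\<chi> k. mps_var k) :: ('s, 'a) mps ^ 's"
    have Zr: "(Z *v ?x) $ r = 0"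
      using e[of r] D[of r] by (simp add: Z_def matrix_vector_mult_def algebra_simps sum_subtractf)
    have Zl: "(Z *v ?x) $ l = mps_var l ^ N" if "l \<noteq> r" for l
      using e[of l] D[of l] that by (simp add: Z_def H_def matrix_vector_mult_def)
    \<comment> \<open>The column inserted by Cramer's rule has entry 0 in row \<open>r\<close> and
      N-th powers of the other variables elsewhere, so the ideal does not involve
      \<open>x_r\<close>, which can then be cancelled.\<close>
    have "det (\<chi> i j. if j = r then (Z *v ?x) $ i else Z $ i $ j) \<in> pow_ideal N (- {r})"
    proof (rule det_column_in_ideal[where k = r])
      fix i
      show "(\<chi> i j. if j = r then (Z *v ?x) $ i else Z $ i $ j) $ i $ r \<in> pow_ideal N (- {r})"
        by (cases "i = r") (auto simp: Zr Zl pow_ideal_zero mps_var_power_pow_ideal)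
    qed (auto intro: pow_ideal_zero pow_ideal_add pow_ideal_mult)
    hence "mps_var r * det Z \<in> pow_ideal N (- {r})"
      by (simp add: cramer_comm_ring)
    hence "det Z \<in> pow_ideal N (- {r})"
      by (rule pow_ideal_var_cancel) simp
    hence "det Z \<in> pow_ideal N UNIV"
      by (rule pow_ideal_mono[rotated]) simp
    moreover have "det (H (insert r S)) - det D = det Z + (det (H S) - det D)"
      by (simp add: eq)
    ultimately show ?case using insert.IH pow_ideal_add by metis
  qed auto
  from this[of UNIV] have *: "det e - det D \<in> pow_ideal N UNIV"
    by (simp add: H_def)
  show ?thesis
  proof
    assume "det e = 0"
    hence "(-1) * (- det D) \<in> pow_ideal N UNIV"
      using * by (intro pow_ideal_mult) simp
    hence detD: "det D \<in> pow_ideal N UNIV" by simp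
    \<comment> \<open>\<open>det D\<close> is the monomial with all exponents N - 1, divisible by no
      N-th power of a variable.\<close>
    define \<alpha> :: "'s \<Rightarrow>\<^sub>0 nat" where "\<alpha> = (\<Sum>l\<in>UNIV. Poly_Mapping.single l (N - 1))"
    have "det D = (\<Prod>l\<in>UNIV. D $ l $ l)"
      by (rule det_diagonal) (simp add: D_def)
    also have "\<dots> = (\<Prod>l\<in>UNIV. mps_monom (Poly_Mapping.single l (N - 1)))"
      by (simp add: D_def mps_var_power)
    also have "\<dots> = mps_monom \<alpha>"
      by (simp add: \<alpha>_def mps_monom_prod)
    finally have "mps_nth (det D) \<alpha> \<noteq> 0" by (simp add: mps_nth_monom)
    then obtain l where "N \<le> Poly_Mapping.lookup \<alpha> l"
      using detD by (auto simp: pow_ideal_def)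
    moreover have "Poly_Mapping.lookup \<alpha> l = N - 1"
      by (simp add: \<alpha>_def lookup_sum lookup_single when_def)
    ultimately show False using N by simp
  qed
qed

subsection \<open>The ideal of minors of a matrix with two rows\<close>

definition minors_ideal :: "('s::finite \<Rightarrow> 'r::comm_ring_1) \<Rightarrow> ('s \<Rightarrow> 'r) \<Rightarrow> 'r set" where
  "minors_ideal u v = {\<Sum>i\<in>UNIV. \<Sum>j\<in>UNIV. r i j * (u i * v j - u j * v i) | r. True}"

lemma minors_ideal_add:
  assumes "a \<in> minors_ideal u v" "b \<in> minors_ideal u v"
  shows "a + b \<in> minors_ideal u v"
proof -
  obtain r r' where "a = (\<Sum>i\<in>UNIV. \<Sum>j\<in>UNIV. r i j * (u i * v j - u j * v i))"
    "b = (\<Sum>i\<in>UNIV. \<Sum>j\<in>UNIV. r' i j * (u i * v j - u j * v i))"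
    using assms by (auto simp: minors_ideal_def)
  hence "a + b = (\<Sum>i\<in>UNIV. \<Sum>j\<in>UNIV. (r i j + r' i j) * (u i * v j - u j * v i))"
    by (simp only: distrib_right sum.distrib)
  thus ?thesis unfolding minors_ideal_def by (intro CollectI exI[of _ "\<lambda>i j. r i j + r' i j"]) auto
qed

lemma minors_ideal_mult:
  assumes "a \<in> minors_ideal u v"
  shows "c * a \<in> minors_ideal u v"
proof -
  obtain r where "a = (\<Sum>i\<in>UNIV. \<Sum>j\<in>UNIV. r i j * (u i * v j - u j * v i))"
    using assms by (auto simp: minors_ideal_def)
  hence "c * a = (\<Sum>i\<in>UNIV. \<Sum>j\<in>UNIV. (c * r i j) * (u i * v j - u j * v i))"
    by (simp only: sum_distrib_left mult.assoc)
  thus ?thesis unfolding minors_ideal_def by (intro CollectI exI[of _ "\<lambda>i j. c * r i j"]) auto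
qed

lemma minors_ideal_zero: "0 \<in> minors_ideal u v"
  unfolding minors_ideal_def by (intro CollectI exI[of _ "\<lambda>_ _. 0"]) auto

lemma minors_ideal_sum: "(\<And>i. i \<in> S \<Longrightarrow> f i \<in> minors_ideal u v) \<Longrightarrow> sum f S \<in> minors_ideal u v"
  by (induction S rule: infinite_finite_induct) (auto intro: minors_ideal_zero minors_ideal_add)

lemma minors_ideal_minor: "u k * v l - u l * v k \<in> minors_ideal u v"
proof -
  have "(\<Sum>i\<in>UNIV. \<Sum>j\<in>UNIV. (if i = k \<and> j = l then 1 else 0) * (u i * v j - u j * v i)) =
      (\<Sum>i\<in>UNIV. \<Sum>j\<in>UNIV. if j = l then (if i = k then u i * v j - u j * v i else 0) else 0)"
    by (intro sum.cong) auto
  also have "\<dots> = u k * v l - u l * v k" by simp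
  finally show ?thesis
    unfolding minors_ideal_def by (intro CollectI exI[of _ "\<lambda>i j. if i = k \<and> j = l then 1 else 0"]) auto
qed

text \<open>With antisymmetrized coefficients \<open>b\<close> involves only \<open>v\<close>, and
  summing \<open>b i * w i\<close> yields the same combination of the minors of \<open>w\<close> and
  \<open>v\<close>. This is \<open>a\<close> for w = u and 0 for w = v. Collecting the factors of
  the \<open>v j\<close> gives the last claim.\<close>

lemma minors_ideal_cofactors:
  assumes "a \<in> minors_ideal u v"
  obtains b where "(\<Sum>i\<in>UNIV. b i * u i) = a" "(\<Sum>i\<in>UNIV. b i * v i) = 0"
    "\<exists>c. a = (\<Sum>i\<in>UNIV. c i * v i)"
proof -
  obtain r where a: "a = (\<Sum>i\<in>UNIV. \<Sum>j\<in>UNIV. r i j * (u i * v j - u j * v i))"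
    using assms by (auto simp: minors_ideal_def)
  define b where "b i = (\<Sum>j\<in>UNIV. (r i j - r j i) * v j)" for i
  have bw: "(\<Sum>i\<in>UNIV. b i * w i) = (\<Sum>i\<in>UNIV. \<Sum>j\<in>UNIV. r i j * (w i * v j - w j * v i))" for w
  proof -
    have "(\<Sum>i\<in>UNIV. b i * w i) = (\<Sum>i\<in>UNIV. \<Sum>j\<in>UNIV. r i j * w i * v j)
        - (\<Sum>i\<in>UNIV. \<Sum>j\<in>UNIV. r j i * w i * v j)"
      unfolding b_def sum_distrib_right left_diff_distrib sum_subtractf
      by (simp add: mult_ac)
    also have "(\<Sum>i\<in>UNIV. \<Sum>j\<in>UNIV. r j i * w i * v j) = (\<Sum>i\<in>UNIV. \<Sum>j\<in>UNIV. r i j * w j * v i)"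
      by (rule sum.swap)
    finally show ?thesis by (simp add: right_diff_distrib sum_subtractf mult_ac)
  qed
  have "(\<Sum>i\<in>UNIV. b i * v i) = 0"
    unfolding bw by (intro sum.neutral ballI) (simp add: mult.commute)
  moreover have "(\<Sum>i\<in>UNIV. b i * u i) = a" by (simp add: bw a)
  moreover have "a = (\<Sum>j\<in>UNIV. (\<Sum>i\<in>UNIV. (r i j - r j i) * u i) * v j)"
  proof -
    have "a = (\<Sum>i\<in>UNIV. \<Sum>j\<in>UNIV. (r i j - r j i) * u i * v j)"
      unfolding a bw[of u, symmetric] b_def sum_distrib_right by (simp add: mult_ac)
    thus ?thesis by (subst (asm) sum.swap) (simp add: sum_distrib_right)
  qed
  ultimately show ?thesis by (intro that[of b] exI)
qed

text \<open>
  If \<open>x\<^sub>l\<^sup>N = \<Sum>\<^sub>i b\<^sub>l\<^sub>i u\<^sub>i\<close> and \<open>\<Sum>\<^sub>i b\<^sub>l\<^sub>i v\<^sub>i = 0\<close>, then \<open>det b = 0\<close>. On the other hand, writing \<open>u\<close> as a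
  combination \<open>c x\<close> of the variables makes \<open>b c\<close> a matrix with \<open>(b c) x = x\<^sup>N\<close>, whose determinant
  cannot vanish.
\<close>

lemma minors_ideal_not_primary:
  fixes u v :: "'s::finite \<Rightarrow> ('s, 'a::comm_ring_1) mps"
  assumes u: "\<And>i. u i \<in> ord_ge 1"
    and x: "\<And>l. mps_var l ^ N \<in> minors_ideal u v"
    and N: "N > 0"
  shows False
proof -
  have "\<forall>l. \<exists>b. (\<Sum>i\<in>UNIV. b i * u i) = mps_var l ^ N \<and> (\<Sum>i\<in>UNIV. b i * v i) = 0"
    using minors_ideal_cofactors[OF x] by metis
  then obtain b where b: "\<And>l. (\<Sum>i\<in>UNIV. b l i * u i) = mps_var l ^ N"
    "\<And>l. (\<Sum>i\<in>UNIV. b l i * v i) = 0"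
    by metis
  have "\<forall>i. \<exists>c. u i = (\<Sum>k\<in>UNIV. c k * mps_var k)"
  proof
    fix i
    obtain h where "u i = mps_const (mps_nth (u i) 0) + (\<Sum>k\<in>UNIV. mps_var k * h k)"
      using mps_decompose[of "u i"] by blast
    moreover have "mps_nth (u i) 0 = 0" using u[of i] by (auto simp: ord_ge_def)
    ultimately show "\<exists>c. u i = (\<Sum>k\<in>UNIV. c k * mps_var k)"
      by (intro exI[of _ h]) (simp add: mult.commute)
  qed
  then obtain c where c: "\<And>i. u i = (\<Sum>k\<in>UNIV. c i k * mps_var k)"
    by metis
  define B where "B = (\<chi> l i. b l i)"
  define C where "C = (\<chi> i k. c i k)"
  \<comment> \<open>Since \<open>B v = 0\<close>, Cramer's rule shows that \<open>det B\<close>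
    annihilates every \<open>v i\<close>, hence also \<open>x_l^N\<close>, which is a combination of
    them.\<close>
  have detB: "mps_monom (Poly_Mapping.single l N) * det B = 0" for l
  proof -
    obtain w where w: "mps_var l ^ N = (\<Sum>i\<in>UNIV. w i * v i)"
      using minors_ideal_cofactors[OF x] by metis
    have "v i * det B = 0" for i
    proof -
      have "(B *v (\<chi> i. v i)) = 0"
        by (simp add: vec_eq_iff matrix_vector_mult_def B_def b)
      hence "det (\<chi> j k. if k = i then 0 else B $ j $ k) = v i * det B"
        using cramer_comm_ring[of i B "\<chi> i. v i"] by (simp cong: if_cong)
      moreover have "det (\<chi> j k. if k = i then 0 else B $ j $ k) \<in> {0}"
        by (rule det_column_in_ideal[of _ i]) auto
      ultimately show ?thesis by simp
    qed
    hence "mps_var l ^ N * det B = 0"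
      by (simp add: w sum_distrib_right mult.assoc)
    thus ?thesis by (simp add: mps_var_power)
  qed
  \<comment> \<open>A single variable, here \<open>undefined\<close>, is enough: multiplication by a
    monomial merely shifts exponents.\<close>
  have "det B = 0"
  proof (rule mps_eqI)
    fix \<alpha>
    show "mps_nth (det B) \<alpha> = mps_nth 0 \<alpha>"
      using mps_nth_monom_mult[of "Poly_Mapping.single undefined N" "det B" \<alpha>] detB by simp
  qed
  hence "det (B ** C) = 0" by (simp add: det_mul)
  moreover have "det (B ** C) \<noteq> 0"
  proof (rule det_variable_power_matrix_nonzero[OF _ N])
    fix l
    have "(\<Sum>k\<in>UNIV. (B ** C) $ l $ k * mps_var k) = (\<Sum>k\<in>UNIV. \<Sum>i\<in>UNIV. b l i * c i k * mps_var k)"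
      by (simp add: matrix_matrix_mult_def B_def C_def sum_distrib_right)
    also have "\<dots> = (\<Sum>i\<in>UNIV. \<Sum>k\<in>UNIV. b l i * c i k * mps_var k)"
      by (rule sum.swap)
    also have "\<dots> = (\<Sum>i\<in>UNIV. b l i * u i)"
      by (simp add: c sum_distrib_left mult.assoc)
    finally show "(\<Sum>k\<in>UNIV. (B ** C) $ l $ k * mps_var k) = mps_var l ^ N"
      by (simp add: b)
  qed
  ultimately show False by simp
qed

section \<open>Jacobian minors under automorphisms\<close>

subsection \<open>Derivations and automorphisms\<close>

lemma mps_pderiv_add: "mps_pderiv \<nu> (f + g) = mps_pderiv \<nu> f + mps_pderiv \<nu> g"
  by (rule mps_eqI) (simp add: mps_nth_pderiv algebra_simps)

lemma mps_pderiv_sum: "mps_pderiv \<nu> (sum f S) = (\<Sum>i\<in>S. mps_pderiv \<nu> (f i))"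
proof (induction S rule: infinite_finite_induct)
  case (insert x F)
  thus ?case by (simp add: mps_pderiv_add)
qed (auto intro!: mps_eqI simp: mps_nth_pderiv)

lemma mps_pderiv_const: "mps_pderiv \<nu> (mps_const c) = 0"
proof (rule mps_eqI)
  fix \<alpha> :: "_ \<Rightarrow>\<^sub>0 nat"
  have "\<alpha> + Poly_Mapping.single \<nu> 1 \<noteq> 0"
  proof
    assume "\<alpha> + Poly_Mapping.single \<nu> 1 = 0"
    hence "Poly_Mapping.lookup (\<alpha> + Poly_Mapping.single \<nu> 1) \<nu> = 0" by simp
    thus False by (simp add: lookup_add)
  qed
  thus "mps_nth (mps_pderiv \<nu> (mps_const c)) \<alpha> = mps_nth 0 \<alpha>"
    by (simp add: mps_nth_pderiv mps_nth_const)
qed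

lemma mps_nth_var_mult: "mps_nth (mps_var i * f) (\<alpha> + Poly_Mapping.single i 1) = mps_nth f \<alpha>"
  unfolding mps_var_eq_monom add.commute[of \<alpha>] by (rule mps_nth_monom_mult)

lemma mps_nth_var_mult_eq_0:
  assumes "Poly_Mapping.lookup \<alpha> i = 0"
  shows "mps_nth (mps_var i * f) \<alpha> = 0"
  unfolding mps_var_eq_monom
  by (rule mps_nth_monom_mult_eq_0) (use assms in \<open>auto simp: lookup_add\<close>)

lemma mps_pderiv_var_mult:
  fixes f :: "('s, 'a::comm_ring_1) mps"
  shows "mps_pderiv \<nu> (mps_var i * f) = (if i = \<nu> then f else 0) + mps_var i * mps_pderiv \<nu> f"
proof (rule mps_eqI)
  fix \<alpha> :: "'s \<Rightarrow>\<^sub>0 nat"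
  show "mps_nth (mps_pderiv \<nu> (mps_var i * f)) \<alpha> =
      mps_nth ((if i = \<nu> then f else 0) + mps_var i * mps_pderiv \<nu> f) \<alpha>"
  proof (cases "Poly_Mapping.lookup \<alpha> i = 0")
    case True
    show ?thesis
    proof (cases "i = \<nu>")
      case eq: True
      show ?thesis
        using mps_nth_var_mult[of \<nu> f \<alpha>] mps_nth_var_mult_eq_0[OF True, of "mps_pderiv \<nu> f"] True
        by (simp add: mps_nth_pderiv eq)
    next
      case False
      hence "Poly_Mapping.lookup (\<alpha> + Poly_Mapping.single \<nu> 1) i = 0"
        using True by (simp add: lookup_add lookup_single)
      from mps_nth_var_mult_eq_0[OF this, of f] mps_nth_var_mult_eq_0[OF True, of "mps_pderiv \<nu> f"] False
      show ?thesis
        by (simp add: mps_nth_pderiv)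
    qed
  next
    case False
    then obtain \<beta> where \<beta>: "\<alpha> = \<beta> + Poly_Mapping.single i 1"
      using single_add_cases[of 1 \<alpha> i] by auto
    have "\<alpha> + Poly_Mapping.single \<nu> 1 = (\<beta> + Poly_Mapping.single \<nu> 1) + Poly_Mapping.single i 1"
      by (simp add: \<beta> ac_simps)
    hence "mps_nth (mps_var i * f) (\<alpha> + Poly_Mapping.single \<nu> 1)
        = mps_nth f (\<beta> + Poly_Mapping.single \<nu> 1)"
      by (simp only: mps_nth_var_mult)
    moreover have "mps_nth (mps_var i * mps_pderiv \<nu> f) \<alpha> = mps_nth (mps_pderiv \<nu> f) \<beta>"
      by (simp only: \<beta> mps_nth_var_mult)
    ultimately show ?thesis
      by (auto simp: mps_nth_pderiv \<beta> lookup_add lookup_single when_def algebra_simps)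
  qed
qed

lemma mps_pderiv_1 [simp]: "mps_pderiv \<nu> 1 = 0"
  unfolding mps_const_1[symmetric] by (rule mps_pderiv_const)

lemma mps_pderiv_var:
  fixes \<nu> :: 's
  shows "mps_pderiv \<nu> (mps_var i :: ('s, 'a::comm_ring_1) mps) = (if i = \<nu> then 1 else 0)"
  using mps_pderiv_var_mult[of \<nu> i "1 :: ('s, 'a) mps"] by auto

text \<open>
  The deviation from the Leibniz rule commutes with multiplication of \<open>f\<close> by a variable, so writing
  \<open>f\<close> as a constant plus a combination of the variables raises its order step by step. The same
  argument yields the chain rule below.
\<close>

lemma mps_pderiv_mult:
  fixes f g :: "('s::finite, 'a::comm_ring_1) mps"
  shows "mps_pderiv \<nu> (f * g) = mps_pderiv \<nu> f * g + f * mps_pderiv \<nu> g"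
proof -
  have "mps_pderiv \<nu> (f * g) - (mps_pderiv \<nu> f * g + f * mps_pderiv \<nu> g) \<in> ord_ge n" for n f
  proof (induction n arbitrary: f)
    case (Suc n)
    obtain h where h: "f = mps_const (mps_nth f 0) + (\<Sum>i\<in>UNIV. mps_var i * h i)"
      using mps_decompose[of f] by blast
    define c where "c = mps_nth f 0"
    have const: "mps_pderiv \<nu> (mps_const c * g) = mps_const c * mps_pderiv \<nu> g"
      by (rule mps_eqI) (simp add: mps_nth_pderiv mult.left_commute)
    have f: "f = mps_const c + (\<Sum>i\<in>UNIV. mps_var i * h i)"
      using h by (simp add: c_def)
    have fg: "f * g = mps_const c * g + (\<Sum>i\<in>UNIV. mps_var i * (h i * g))"
      by (simp only: f distrib_right sum_distrib_right mult.assoc)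
    have "mps_pderiv \<nu> (f * g) - (mps_pderiv \<nu> f * g + f * mps_pderiv \<nu> g) =
        (\<Sum>i\<in>UNIV. mps_pderiv \<nu> (mps_var i * (h i * g))) -
        ((\<Sum>i\<in>UNIV. mps_pderiv \<nu> (mps_var i * h i)) * g + (\<Sum>i\<in>UNIV. mps_var i * h i) * mps_pderiv \<nu> g)"
      unfolding fg unfolding f mps_pderiv_add mps_pderiv_const mps_pderiv_sum const
      by (simp only: distrib_right) simp
    also have "\<dots> = (\<Sum>i\<in>UNIV. mps_var i *
        (mps_pderiv \<nu> (h i * g) - (mps_pderiv \<nu> (h i) * g + h i * mps_pderiv \<nu> g)))"
      unfolding sum_distrib_right sum.distrib[symmetric] sum_subtractf[symmetric]
      by (rule sum.cong[OF refl], unfold mps_pderiv_var_mult) (simp add: algebra_simps)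
    also have "\<dots> \<in> ord_ge (Suc n)"
      using ord_ge_mult[OF mps_var_ord_ge(1) Suc] by (intro ord_ge_sum) simp
    finally show ?case .
  qed simp
  from ord_ge_all_imp_0[OF this] show ?thesis by simp
qed

lemma mps_pderiv_power:
  fixes f :: "('s::finite, 'a::comm_ring_1) mps"
  shows "mps_pderiv \<nu> (f ^ Suc n) = of_nat (Suc n) * f ^ n * mps_pderiv \<nu> f"
proof (induction n)
  case (Suc n)
  have "mps_pderiv \<nu> (f ^ Suc (Suc n)) = mps_pderiv \<nu> f * f ^ Suc n + f * mps_pderiv \<nu> (f ^ Suc n)"
    by (subst power_Suc) (rule mps_pderiv_mult)
  thus ?case unfolding Suc by (simp add: algebra_simps)
qed simp

locale mps_automorphism =
  fixes \<phi> :: "('s::finite, 'k::field) mps \<Rightarrow> ('s, 'k) mps"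
  assumes automorphism: "\<phi> \<in> mps_automorphisms"
begin

lemma add: "\<phi> (f + g) = \<phi> f + \<phi> g" using automorphism by (simp add: mps_automorphisms_def)
lemma mult: "\<phi> (f * g) = \<phi> f * \<phi> g" using automorphism by (simp add: mps_automorphisms_def)
lemma const: "\<phi> (mps_const c) = mps_const c" using automorphism by (simp add: mps_automorphisms_def)
lemma bij: "bij \<phi>" using automorphism by (simp add: mps_automorphisms_def)
lemma zero: "\<phi> 0 = 0" using add[of 0 0] by simp
lemma one: "\<phi> 1 = 1" using const[of 1] by simp
lemma diff: "\<phi> (f - g) = \<phi> f - \<phi> g" using add[of "f - g" g] by simp
lemma sum: "\<phi> (sum f S) = (\<Sum>i\<in>S. \<phi> (f i))"
  by (induction S rule: infinite_finite_induct) (auto simp: zero add)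
lemma power: "\<phi> (f ^ n) = \<phi> f ^ n"
  by (induction n) (auto simp: one mult)

text \<open>Continuity is not part of being an automorphism. It follows because units are preserved
  and the non-units form the maximal ideal.\<close>

lemma ord_ge_1:
  assumes "f \<in> ord_ge 1" shows "\<phi> f \<in> ord_ge 1"
proof (rule ccontr)
  assume "\<phi> f \<notin> ord_ge 1"
  hence "\<phi> f dvd 1"
    by (simp add: mps_unit_iff ord_ge_1_eq max_ideal_def)
  then obtain g where "\<phi> f * g = 1" by (metis dvd_def)
  moreover obtain g' where "g = \<phi> g'" using bij by (metis bij_pointE)
  ultimately have "\<phi> (f * g') = \<phi> 1" by (simp add: mult one)
  hence "f * g' = 1" using bij by (simp add: bij_def inj_eq)
  hence "f dvd 1" by (metis dvd_triv_left)
  thus False using assms by (simp add: mps_unit_iff ord_ge_1_eq max_ideal_def)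
qed

lemma chain_rule:
  "mps_pderiv \<nu> (\<phi> f) = (\<Sum>\<mu>\<in>UNIV. \<phi> (mps_pderiv \<mu> f) * mps_pderiv \<nu> (\<phi> (mps_var \<mu>)))"
proof -
  define \<delta> where "\<delta> f = mps_pderiv \<nu> (\<phi> f) -
     (\<Sum>\<mu>\<in>UNIV. \<phi> (mps_pderiv \<mu> f) * mps_pderiv \<nu> (\<phi> (mps_var \<mu>)))" for f
  have \<delta>_const: "\<delta> (mps_const c) = 0" for c
    by (simp add: \<delta>_def const mps_pderiv_const zero)
  have \<delta>_add: "\<delta> (f + g) = \<delta> f + \<delta> g" for f g
    by (simp add: \<delta>_def mps_pderiv_add add algebra_simps sum.distrib)
  have \<delta>_sum: "\<delta> (sum f S) = (\<Sum>i\<in>S. \<delta> (f i))" for f :: "'s \<Rightarrow> _" and S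
  proof (induction S rule: infinite_finite_induct)
    case (insert x S)
    thus ?case by (simp add: \<delta>_add)
  qed (use \<delta>_const[of 0] in simp_all)
  \<comment> \<open>The extra terms of the two product rules cancel, so the defect passes through a
    variable and picks up the factor \<open>\<phi> (mps_var i)\<close> of order at least 1.\<close>
  have \<delta>_var: "\<delta> (mps_var i * h) = \<phi> (mps_var i) * \<delta> h" for i h
  proof -
    have "(\<Sum>\<mu>\<in>UNIV. \<phi> (mps_pderiv \<mu> (mps_var i * h)) * mps_pderiv \<nu> (\<phi> (mps_var \<mu>)))
        = (\<Sum>\<mu>\<in>UNIV. (if \<mu> = i then \<phi> h * mps_pderiv \<nu> (\<phi> (mps_var i)) else 0)
          + \<phi> (mps_var i) * (\<phi> (mps_pderiv \<mu> h) * mps_pderiv \<nu> (\<phi> (mps_var \<mu>))))"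
      by (rule sum.cong[OF refl], unfold mps_pderiv_var_mult add mult) (simp add: zero algebra_simps)
    also have "\<dots> = \<phi> h * mps_pderiv \<nu> (\<phi> (mps_var i)) +
        \<phi> (mps_var i) * (\<Sum>\<mu>\<in>UNIV. \<phi> (mps_pderiv \<mu> h) * mps_pderiv \<nu> (\<phi> (mps_var \<mu>)))"
      by (simp add: sum.distrib sum_distrib_left)
    finally show ?thesis
      by (simp add: \<delta>_def mult mps_pderiv_mult algebra_simps)
  qed
  have "\<delta> f \<in> ord_ge n" for n f
  proof (induction n arbitrary: f)
    case (Suc n)
    obtain h where h: "f = mps_const (mps_nth f 0) + (\<Sum>i\<in>UNIV. mps_var i * h i)"
      using mps_decompose[of f] by blast
    have "\<delta> f = (\<Sum>i\<in>UNIV. \<phi> (mps_var i) * \<delta> (h i))"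
      by (subst h) (simp add: \<delta>_add \<delta>_const \<delta>_sum \<delta>_var)
    also have "\<dots> \<in> ord_ge (Suc n)"
      using ord_ge_mult[OF ord_ge_1[OF mps_var_ord_ge(1)] Suc] by (intro ord_ge_sum) simp
    finally show ?case .
  qed simp
  hence "\<delta> f = 0" by (rule ord_ge_all_imp_0)
  thus ?thesis by (simp add: \<delta>_def)
qed

lemma automorphism_inv: "inv_into UNIV \<phi> \<in> mps_automorphisms"
proof -
  have s: "\<phi> (inv_into UNIV \<phi> f) = f" for f using bij by (simp add: bij_def surj_f_inv_f)
  have i: "inv_into UNIV \<phi> (\<phi> f) = f" for f using bij by (simp add: bij_def)
  have "inv_into UNIV \<phi> (f + g) = inv_into UNIV \<phi> f + inv_into UNIV \<phi> g" for f g
    using i[of "inv_into UNIV \<phi> f + inv_into UNIV \<phi> g"] by (simp add: add s)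
  moreover have "inv_into UNIV \<phi> (f * g) = inv_into UNIV \<phi> f * inv_into UNIV \<phi> g" for f g
    using i[of "inv_into UNIV \<phi> f * inv_into UNIV \<phi> g"] by (simp add: mult s)
  moreover have "inv_into UNIV \<phi> (mps_const c) = mps_const c" for c
    using i[of "mps_const c"] by (simp add: const)
  ultimately show ?thesis
    using bij_imp_bij_inv[OF bij] by (simp add: mps_automorphisms_def)
qed

text \<open>The chain rule for the inverse automorphism, transported by \<open>\<phi>\<close>.\<close>

lemma pderiv_image:
  obtains q where "\<And>\<nu> f. \<phi> (mps_pderiv \<nu> f) = (\<Sum>\<mu>\<in>UNIV. mps_pderiv \<mu> (\<phi> f) * q \<mu> \<nu>)"
proof
  fix \<nu> f
  interpret inv: mps_automorphism "inv_into UNIV \<phi>" by unfold_locales (rule automorphism_inv)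
  have s: "\<phi> (inv_into UNIV \<phi> f) = f" for f using bij by (simp add: bij_def surj_f_inv_f)
  have i: "inv_into UNIV \<phi> (\<phi> f) = f" for f using bij by (simp add: bij_def)
  show "\<phi> (mps_pderiv \<nu> f) =
      (\<Sum>\<mu>\<in>UNIV. mps_pderiv \<mu> (\<phi> f) * \<phi> (mps_pderiv \<nu> (inv_into UNIV \<phi> (mps_var \<mu>))))"
    using arg_cong[OF inv.chain_rule[of \<nu> "\<phi> f"], of \<phi>] by (simp add: i s sum mult)
qed

text \<open>The Cauchy-Binet argument: applying \<open>\<phi>\<close> to the Jacobian matrix of the
  pair gives the Jacobian matrix of the image pair times \<open>q\<close>, so the minors of the
  former are combinations of those of the latter.\<close>

lemma minors_ideal_image:
  assumes "a \<in> minors_ideal (\<lambda>\<nu>. mps_pderiv \<nu> f) (\<lambda>\<nu>. mps_pderiv \<nu> g)"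
  shows "\<phi> a \<in> minors_ideal (\<lambda>\<nu>. mps_pderiv \<nu> (\<phi> f)) (\<lambda>\<nu>. mps_pderiv \<nu> (\<phi> g))"
proof -
  let ?I = "minors_ideal (\<lambda>\<nu>. mps_pderiv \<nu> (\<phi> f)) (\<lambda>\<nu>. mps_pderiv \<nu> (\<phi> g))"
  obtain q where q: "\<And>\<nu> f. \<phi> (mps_pderiv \<nu> f) = (\<Sum>\<mu>\<in>UNIV. mps_pderiv \<mu> (\<phi> f) * q \<mu> \<nu>)"
    using pderiv_image by blast
  have minor: "\<phi> (mps_pderiv i f * mps_pderiv j g - mps_pderiv j f * mps_pderiv i g) \<in> ?I" for i j
  proof -
    have "\<phi> (mps_pderiv i f * mps_pderiv j g - mps_pderiv j f * mps_pderiv i g) =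
        (\<Sum>\<mu>\<in>UNIV. \<Sum>\<mu>'\<in>UNIV. (q \<mu> i * q \<mu>' j) * (mps_pderiv \<mu> (\<phi> f) * mps_pderiv \<mu>' (\<phi> g))) -
        (\<Sum>\<mu>'\<in>UNIV. \<Sum>\<mu>\<in>UNIV. (q \<mu> i * q \<mu>' j) * (mps_pderiv \<mu>' (\<phi> f) * mps_pderiv \<mu> (\<phi> g)))"
      unfolding diff mult q sum_product by (simp add: mult_ac)
    also have "(\<Sum>\<mu>'\<in>UNIV. \<Sum>\<mu>\<in>UNIV. (q \<mu> i * q \<mu>' j) * (mps_pderiv \<mu>' (\<phi> f) * mps_pderiv \<mu> (\<phi> g)))
        = (\<Sum>\<mu>\<in>UNIV. \<Sum>\<mu>'\<in>UNIV. (q \<mu> i * q \<mu>' j) * (mps_pderiv \<mu>' (\<phi> f) * mps_pderiv \<mu> (\<phi> g)))"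
      by (rule sum.swap)
    finally have "\<phi> (mps_pderiv i f * mps_pderiv j g - mps_pderiv j f * mps_pderiv i g) =
      (\<Sum>\<mu>\<in>UNIV. \<Sum>\<mu>'\<in>UNIV. (q \<mu> i * q \<mu>' j) *
         (mps_pderiv \<mu> (\<phi> f) * mps_pderiv \<mu>' (\<phi> g) - mps_pderiv \<mu>' (\<phi> f) * mps_pderiv \<mu> (\<phi> g)))"
      by (simp add: right_diff_distrib sum_subtractf)
    moreover have "mps_pderiv \<mu> (\<phi> f) * mps_pderiv \<mu>' (\<phi> g) - mps_pderiv \<mu>' (\<phi> f) * mps_pderiv \<mu> (\<phi> g) \<in> ?I"
      for \<mu> \<mu>' by (rule minors_ideal_minor)
    ultimately show ?thesis by (simp only: minors_ideal_sum minors_ideal_mult)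
  qed
  obtain r where "a = (\<Sum>i\<in>UNIV. \<Sum>j\<in>UNIV. r i j *
      (mps_pderiv i f * mps_pderiv j g - mps_pderiv j f * mps_pderiv i g))"
    using assms by (auto simp: minors_ideal_def)
  hence "\<phi> a = (\<Sum>i\<in>UNIV. \<Sum>j\<in>UNIV. \<phi> (r i j) *
      \<phi> (mps_pderiv i f * mps_pderiv j g - mps_pderiv j f * mps_pderiv i g))"
    by (simp add: sum mult)
  thus ?thesis by (simp only: minors_ideal_sum minors_ideal_mult minor)
qed

end

text \<open>The gradient of \<open>g^n\<close> is a multiple of that of \<open>g\<close>: a row
  operation, which changes no minor.\<close>

lemma minors_ideal_add_power:
  fixes f g :: "('s::finite, 'a::comm_ring_1) mps"
  assumes "n > 0"
  shows "minors_ideal (\<lambda>\<nu>. mps_pderiv \<nu> (f + g ^ n)) (\<lambda>\<nu>. mps_pderiv \<nu> g) =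
    minors_ideal (\<lambda>\<nu>. mps_pderiv \<nu> f) (\<lambda>\<nu>. mps_pderiv \<nu> g)"
proof -
  obtain m where n: "n = Suc m" using assms gr0_implies_Suc by blast
  have "mps_pderiv i (f + g ^ n) * mps_pderiv j g - mps_pderiv j (f + g ^ n) * mps_pderiv i g =
     mps_pderiv i f * mps_pderiv j g - mps_pderiv j f * mps_pderiv i g" for i j
    unfolding n mps_pderiv_add mps_pderiv_power by (simp add: algebra_simps)
  thus ?thesis by (simp add: minors_ideal_def)
qed

section \<open>Finiteness over \<open>K[g]\<close> and elimination modulo an ideal\<close>

subsection \<open>Evaluation of univariate polynomials\<close>

definition poly_at :: "('s, 'a::comm_ring_1) mps \<Rightarrow> 'a poly \<Rightarrow> ('s, 'a) mps" where
  "poly_at g p = poly (map_poly mps_const p) g"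

lemma poly_at_0 [simp]: "poly_at g 0 = 0"
  by (simp add: poly_at_def)

lemma poly_at_pCons: "poly_at g (pCons a p) = mps_const a + g * poly_at g p"
  by (simp add: poly_at_def map_poly_pCons)

lemma poly_at_add: "poly_at g (p + q) = poly_at g p + poly_at g q"
  by (induction p q rule: poly_induct2) (auto simp: poly_at_pCons mps_const_add algebra_simps)

lemma poly_at_smult: "poly_at g (smult c p) = mps_const c * poly_at g p"
  by (induction p) (auto simp: poly_at_pCons mps_const_mult algebra_simps)

lemma poly_at_mult: "poly_at g (p * q) = poly_at g p * poly_at g q"
  by (induction p) (auto simp: poly_at_pCons poly_at_add poly_at_smult algebra_simps)

lemma poly_at_sum: "poly_at g (sum p S) = (\<Sum>i\<in>S. poly_at g (p i))"
  by (induction S rule: infinite_finite_induct) (auto simp: poly_at_add)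

lemma poly_at_const: "poly_at g [:c:] = mps_const c"
  by (simp add: poly_at_pCons)

lemma poly_at_monom: "poly_at g (Polynomial.monom c n) = mps_const c * g ^ n"
  by (induction n) (auto simp: poly_at_const monom_0 monom_Suc poly_at_pCons mult_ac)

text \<open>Split off the lowest power of the indeterminate. The rest has a nonzero constant term
  and evaluates to a unit.\<close>

lemma poly_at_eq_power_unit:
  fixes g :: "('s::finite, 'k::field) mps"
  assumes "p \<noteq> 0" "g \<in> ord_ge 1"
  obtains n w where "poly_at g p = g ^ n * w" "w dvd 1"
  using assms(1)
proof (induction p arbitrary: thesis)
  case (pCons a p)
  show ?case
  proof (cases "a = 0")
    case True
    hence "p \<noteq> 0" using pCons by auto
    then obtain n w where "poly_at g p = g ^ n * w" "w dvd 1"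
      using pCons.IH by blast
    thus ?thesis
      using True by (intro pCons.prems(1)[of "Suc n" w]) (auto simp: poly_at_pCons)
  next
    case False
    have "g * poly_at g p \<in> ord_ge 1" using assms(2) by (rule ord_ge_mult_right)
    hence "poly_at g (pCons a p) dvd 1"
      using False by (auto simp: mps_unit_iff poly_at_pCons mps_nth_const ord_ge_def)
    thus ?thesis by (intro pCons.prems(1)[of 0]) auto
  qed
qed simp

lemma (in mps_automorphism) poly_at: "\<phi> (poly_at g p) = poly_at (\<phi> g) p"
  by (induction p) (auto simp: poly_at_pCons zero add mult const)

subsection \<open>Ideals containing sums of geometric progressions\<close>

locale mps_ideal =
  fixes I :: "('s::finite, 'k::field) mps set"
  assumes zero: "0 \<in> I"
    and add: "a \<in> I \<Longrightarrow> b \<in> I \<Longrightarrow> a + b \<in> I"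
    and mult: "a \<in> I \<Longrightarrow> c * a \<in> I"
begin

lemma sum: "(\<And>i. i \<in> S \<Longrightarrow> f i \<in> I) \<Longrightarrow> sum f S \<in> I"
  by (induction S rule: infinite_finite_induct) (auto intro: zero add)

lemma diff: "a \<in> I \<Longrightarrow> b \<in> I \<Longrightarrow> a - b \<in> I"
  using add[of a "(-1) * b"] mult[of b "-1"] by simp

lemma unit_cancel: "w * a \<in> I \<Longrightarrow> w dvd 1 \<Longrightarrow> a \<in> I"
proof (elim dvdE)
  fix v assume "w * a \<in> I" "1 = w * v"
  thus "a \<in> I" using mult[of "w * a" v] by (simp add: mult.commute mult.left_commute flip: mult.assoc)
qed

text \<open>
  Subtracting \<open>g\<^sup>n\<close> times the relation for \<open>a\<close> from the one for \<open>a + 1\<close> eliminates the coefficient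
  \<open>q n\<close> and multiplies the other coefficients \<open>q e\<close> by \<open>g\<^sup>e - g\<^sup>n\<close>, a power of \<open>g\<close> times a unit.
\<close>

lemma geometric_elimination:
  assumes "finite E" "g \<in> ord_ge 1"
    and "\<And>a. a \<ge> k \<Longrightarrow> (\<Sum>e\<in>E. q e * g ^ (a * e)) \<in> I"
  shows "\<exists>M. \<forall>e\<in>E. q e * g ^ M \<in> I"
  using assms(1,3)
proof (induction E arbitrary: q rule: finite_induct)
  case (insert n E)
  have unit: "\<exists>w N. g ^ e - g ^ n = g ^ N * w \<and> w dvd 1" if ne: "e \<noteq> n" for e
  proof -
    have u: "(1 - g ^ Suc d) dvd 1" for d
      using ord_ge_mult_right[OF assms(2), of "g ^ d"] by (intro mps_one_minus_unit) simp
    show ?thesis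
    proof (cases "e < n")
      case True
      then obtain d where "n = e + Suc d" using less_imp_Suc_add by auto
      hence "g ^ e - g ^ n = g ^ e * (1 - g ^ Suc d)"
        by (simp only: power_add right_diff_distrib mult_1_right)
      thus ?thesis using u by blast
    next
      case False
      then obtain d where "e = n + Suc d" using ne less_imp_Suc_add[of n e] by auto
      hence "g ^ e - g ^ n = g ^ n * (- (1 - g ^ Suc d))"
        by (simp only: power_add right_diff_distrib mult_1_right) (simp add: algebra_simps)
      moreover have "- (1 - g ^ Suc d) dvd 1" using u[of d] by (subst minus_dvd_iff)
      ultimately show ?thesis by blast
    qed
  qed
  have "(\<Sum>e\<in>E. (q e * (g ^ e - g ^ n)) * g ^ (a * e)) \<in> I" if "a \<ge> k" for a
  proof -
    have "(\<Sum>e\<in>insert n E. q e * g ^ (Suc a * e)) - g ^ n * (\<Sum>e\<in>insert n E. q e * g ^ (a * e)) \<in> I"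
      using that by (intro diff mult insert.prems) auto
    also have "(\<Sum>e\<in>insert n E. q e * g ^ (Suc a * e)) - g ^ n * (\<Sum>e\<in>insert n E. q e * g ^ (a * e)) =
      (\<Sum>e\<in>insert n E. (q e * (g ^ e - g ^ n)) * g ^ (a * e))"
      unfolding sum_distrib_left sum_subtractf[symmetric]
      by (rule sum.cong) (auto simp: power_add algebra_simps)
    also have "\<dots> = (\<Sum>e\<in>E. (q e * (g ^ e - g ^ n)) * g ^ (a * e))"
      using insert by simp
    finally show ?thesis .
  qed
  from insert.IH[OF this] obtain M where M: "\<And>e. e \<in> E \<Longrightarrow> q e * (g ^ e - g ^ n) * g ^ M \<in> I"
    by blast
  have "\<exists>N. q e * g ^ N \<in> I" if "e \<in> E" for e
  proof -
    have "e \<noteq> n" using that insert by auto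
    then obtain w N where w: "g ^ e - g ^ n = g ^ N * w" "w dvd 1" using unit by blast
    have "w * (q e * g ^ (N + M)) \<in> I"
      using M[OF that] by (simp add: w(1) power_add mult_ac)
    thus ?thesis using unit_cancel w(2) by blast
  qed
  then obtain N where N: "\<And>e. e \<in> E \<Longrightarrow> q e * g ^ N e \<in> I" by metis
  \<comment> \<open>The relation for a = k is solved for its term with \<open>q n\<close>, whose
    exponent of \<open>g\<close> is \<open>k * n\<close>; the sum of the \<open>N e\<close> moves
    all other terms into \<open>I\<close>.\<close>
  define L where "L = k * n + (\<Sum>e\<in>E. N e)"
  have large: "q e * g ^ l \<in> I" if "e \<in> E" "l \<ge> (\<Sum>e\<in>E. N e)" for e l
  proof -
    have "N e \<le> l" using that insert.hyps member_le_sum[of e E N] by force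
    hence "q e * g ^ l = g ^ (l - N e) * (q e * g ^ N e)"
      by (simp add: power_add[symmetric] mult.left_commute)
    thus ?thesis using N[OF that(1)] mult by simp
  qed
  have "q n * g ^ L = g ^ (\<Sum>e\<in>E. N e) * (\<Sum>e\<in>insert n E. q e * g ^ (k * e)) -
      (\<Sum>e\<in>E. q e * g ^ (k * e + (\<Sum>e\<in>E. N e)))"
    using insert.hyps by (simp add: L_def power_add algebra_simps sum_distrib_left sum_distrib_right)
  also have "\<dots> \<in> I"
    by (intro diff mult insert.prems sum large) auto
  finally have "q n * g ^ L \<in> I" .
  moreover have "q e * g ^ L \<in> I" if "e \<in> E" for e
    using that by (rule large) (simp add: L_def)
  ultimately show ?case by blast
qed auto

end

lemma mps_ideal_minors: "mps_ideal (minors_ideal u v)"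
  by unfold_locales (auto intro: minors_ideal_zero minors_ideal_add minors_ideal_mult)

subsection \<open>Reduction of monomials by leading forms\<close>

lemma deg_le_mult_le:
  "f \<in> deg_le m \<Longrightarrow> g \<in> deg_le n \<Longrightarrow> m + n \<le> N \<Longrightarrow> f * g \<in> deg_le N"
  using deg_le_mult deg_le_mono by blast

lemma mono_degree_remove:
  "mono_degree \<beta> = Poly_Mapping.lookup \<beta> i + (\<Sum>j\<in>UNIV - {i}. Poly_Mapping.lookup \<beta> j)"
  unfolding mono_degree_def by (rule sum.remove) auto

text \<open>
  If two coordinates of the exponent are large, the monomial reduces to lower degree modulo \<open>I\<close>.
  Otherwise only one coordinate is large, and subtracting a multiple of \<open>g\<close> moves degree from it to
  the other coordinates until a second one becomes large.
\<close>

lemma mps_monom_reduction: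
  fixes I Z :: "('s::finite, 'k::field) mps set" and g G :: "('s, 'k) mps"
  assumes I: "mps_ideal I" "I \<subseteq> Z"
    and Z_add: "\<And>a b. a \<in> Z \<Longrightarrow> b \<in> Z \<Longrightarrow> a + b \<in> Z"
    and Z_const: "\<And>c a. a \<in> Z \<Longrightarrow> mps_const c * a \<in> Z"
    and Z_g: "\<And>a. a \<in> Z \<Longrightarrow> g * a \<in> Z"
    and Z_monom: "\<And>\<beta>. mono_degree \<beta> \<le> CARD('s) * E + d \<Longrightarrow> mps_monom \<beta> \<in> Z"
    and g: "g = G + (\<Sum>j\<in>UNIV. mps_var j ^ d)" "G \<in> deg_le (d - 1)" "d > 0"
    and minors: "\<And>i j. i \<noteq> j \<Longrightarrow> \<exists>c p q L. c \<noteq> 0 \<and> p \<le> E \<and> q \<le> E \<and> 0 < p + q \<and>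
        L \<in> deg_le (p + q - 1) \<and> mps_const c * (mps_var i ^ p * mps_var j ^ q) + L \<in> I"
  shows "mps_monom \<beta> \<in> Z"
proof -
  interpret mps_ideal I by (rule I)
  have Z_zero: "0 \<in> Z" using I(2) zero by blast
  have Z_diff: "a - b \<in> Z" if "a \<in> Z" "b \<in> Z" for a b
    using Z_add[OF that(1) Z_const[OF that(2), of "-1"]] by (simp add: mps_const_uminus)
  have Z_sum: "sum f S \<in> Z" if "\<And>i. i \<in> S \<Longrightarrow> f i \<in> Z" for S and f :: "'c \<Rightarrow> _"
    using that by (induction S rule: infinite_finite_induct) (auto intro: Z_add Z_zero)
  have Z_deg: "f \<in> Z" if "f \<in> deg_le m" "\<And>\<beta>. mono_degree \<beta> \<le> m \<Longrightarrow> mps_monom \<beta> \<in> Z" for f m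
    by (subst deg_le_expand[OF that(1)]) (auto intro!: Z_sum Z_const that(2))
  have "\<forall>\<beta>. mono_degree \<beta> = n \<longrightarrow> mps_monom \<beta> \<in> Z" for n
  proof (induction n rule: less_induct)
    case (less n)
    show ?case
    proof (cases "n \<le> CARD('s) * E + d")
      case True
      thus ?thesis using Z_monom by blast
    next
      case False
      have low: "f \<in> Z" if "f \<in> deg_le m" "m < n" for f m
      proof (rule Z_deg[OF that(1)])
        fix \<beta> :: "'s \<Rightarrow>\<^sub>0 nat" assume "mono_degree \<beta> \<le> m"
        thus "mps_monom \<beta> \<in> Z" using less[of "mono_degree \<beta>"] that(2) by auto
      qed
      \<comment> \<open>Trading \<open>x_i^d\<close> for the other \<open>x_j^d\<close> by means of
        \<open>g\<close> preserves the degree and lowers the exponent of \<open>x_i\<close>; hence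
        the inner induction on that exponent.\<close>
      have large: "mps_monom \<beta> \<in> Z"
        if "mono_degree \<beta> = n" "E \<le> Poly_Mapping.lookup \<beta> i" for \<beta> i
        using that
      proof (induction "Poly_Mapping.lookup \<beta> i" arbitrary: \<beta> rule: less_induct)
        case inner: (less \<beta>)
        show ?case
        proof (cases "\<exists>j. j \<noteq> i \<and> E \<le> Poly_Mapping.lookup \<beta> j")
          case True
          then obtain j where j: "j \<noteq> i" "E \<le> Poly_Mapping.lookup \<beta> j" by blast
          obtain c p q L where c: "c \<noteq> 0" "p \<le> E" "q \<le> E" "0 < p + q" "L \<in> deg_le (p + q - 1)"
            "mps_const c * (mps_var i ^ p * mps_var j ^ q) + L \<in> I"
            using minors[of i j] j by metis
          obtain \<gamma>' where \<gamma>': "\<beta> = \<gamma>' + Poly_Mapping.single i p"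
            using single_add_cases[of p \<beta> i] inner.prems c by auto
          have "q \<le> Poly_Mapping.lookup \<gamma>' j"
            using j c by (simp add: \<gamma>' lookup_add lookup_single)
          then obtain \<gamma> where \<gamma>: "\<gamma>' = \<gamma> + Poly_Mapping.single j q"
            using single_add_cases[of q \<gamma>' j] by auto
          have n: "n = mono_degree \<gamma> + p + q"
            using inner.prems by (simp add: \<gamma>' \<gamma> mono_degree_add)
          have \<beta>: "mps_monom \<beta> = mps_monom \<gamma> * (mps_var i ^ p * mps_var j ^ q)"
            by (simp add: mps_var_power mps_monom_mult \<gamma>' \<gamma> ac_simps)
          have "mps_const (inverse c) * (mps_monom \<gamma> * (mps_const c * (mps_var i ^ p * mps_var j ^ q) + L))
              \<in> Z"
            using I(2) c(6) mult by blast
          moreover have "mps_const (inverse c) * (mps_monom \<gamma> * L) \<in> Z"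
            using c n by (intro low[of _ "n - 1"] deg_le_const_mult
              deg_le_mult_le[OF mps_monom_deg_le[OF order_refl] c(5)]) auto
          moreover have "mps_monom \<beta> =
              mps_const (inverse c) * (mps_monom \<gamma> * (mps_const c * (mps_var i ^ p * mps_var j ^ q) + L))
              - mps_const (inverse c) * (mps_monom \<gamma> * L)"
          proof -
            have "mps_const (inverse c) * mps_const c = (1 :: ('s, 'k) mps)"
              using c(1) by (simp flip: mps_const_mult)
            moreover have "mps_const (inverse c) *
                (mps_monom \<gamma> * (mps_const c * (mps_var i ^ p * mps_var j ^ q) + L))
                - mps_const (inverse c) * (mps_monom \<gamma> * L) =
                (mps_const (inverse c) * mps_const c) * mps_monom \<beta>"
              unfolding \<beta> by (simp add: algebra_simps)
            ultimately show ?thesis by simp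
          qed
          ultimately show ?thesis using Z_diff by simp
        next
          case small: False
          \<comment> \<open>All other exponents are below \<open>E\<close>, so a degree above
            \<open>CARD('s) * E + d\<close> leaves at least d + E for \<open>x_i\<close>: after
            removing \<open>d\<close>, the bound \<open>E\<close> for the inner induction still
            holds.\<close>
          have "(\<Sum>j\<in>UNIV - {i}. Poly_Mapping.lookup \<beta> j) \<le> (\<Sum>j\<in>UNIV - {i}. E)"
            using small by (intro sum_mono) (auto simp: not_le intro: less_imp_le)
          also have "\<dots> = (CARD('s) - 1) * E" by simp
          finally have "n \<le> Poly_Mapping.lookup \<beta> i + (CARD('s) - 1) * E"
            using inner.prems(1) mono_degree_remove[of \<beta> i] by simp
          moreover have "CARD('s) * E = (CARD('s) - 1) * E + E"
            using zero_less_card_finite[where 'a = 's] by (metis Suc_pred' add.commute mult_Suc)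
          ultimately have "d + E \<le> Poly_Mapping.lookup \<beta> i" using False by linarith
          then obtain \<gamma> where \<gamma>: "\<beta> = \<gamma> + Poly_Mapping.single i d"
            using single_add_cases[of d \<beta> i] by auto
          have \<gamma>i: "E \<le> Poly_Mapping.lookup \<gamma> i"
            using \<open>d + E \<le> _\<close> by (simp add: \<gamma> lookup_add)
          have n: "n = mono_degree \<gamma> + d"
            using inner.prems by (simp add: \<gamma> mono_degree_add)
          have "mps_monom (\<gamma> + Poly_Mapping.single j d) \<in> Z" if "j \<noteq> i" for j
            using that \<gamma>i n g(3)
            by (intro inner.hyps) (auto simp: \<gamma> lookup_add lookup_single mono_degree_add)
          hence "(\<Sum>j\<in>UNIV - {i}. mps_monom (\<gamma> + Poly_Mapping.single j d)) \<in> Z"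
            by (intro Z_sum) auto
          moreover have "mps_monom \<gamma> * G \<in> Z"
            using n g(3) by (intro low[of _ "n - 1"]
              deg_le_mult_le[OF mps_monom_deg_le[OF order_refl] g(2)]) auto
          moreover have "g * mps_monom \<gamma> \<in> Z"
            using less[of "mono_degree \<gamma>"] n g(3) by (intro Z_g) auto
          moreover have "mps_monom \<beta> = g * mps_monom \<gamma> - mps_monom \<gamma> * G -
              (\<Sum>j\<in>UNIV - {i}. mps_monom (\<gamma> + Poly_Mapping.single j d))"
          proof -
            have "g * mps_monom \<gamma> = mps_monom \<gamma> * G + (\<Sum>j\<in>UNIV. mps_monom (\<gamma> + Poly_Mapping.single j d))"
              by (simp add: g(1) distrib_right sum_distrib_right mps_var_power mps_monom_mult
                  add.commute mult.commute[of _ G])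
            also have "(\<Sum>j\<in>UNIV. mps_monom (\<gamma> + Poly_Mapping.single j d)) =
                mps_monom \<beta> + (\<Sum>j\<in>UNIV - {i}. mps_monom (\<gamma> + Poly_Mapping.single j d))"
              unfolding \<gamma> by (rule sum.remove) auto
            finally show ?thesis by simp
          qed
          ultimately show ?thesis using Z_diff by simp
        qed
      qed
      have "mps_monom \<beta> \<in> Z" if \<beta>: "mono_degree \<beta> = n" for \<beta>
      proof -
        have "\<exists>i. E \<le> Poly_Mapping.lookup \<beta> i"
        proof (rule ccontr)
          assume "\<not> ?thesis"
          hence "mono_degree \<beta> \<le> (\<Sum>i\<in>(UNIV :: 's set). E)"
            unfolding mono_degree_def by (intro sum_mono) (auto simp: not_le intro: less_imp_le)
          thus False using False \<beta> by simp
        qed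
        thus ?thesis using large[OF \<beta>] by blast
      qed
      thus ?thesis by blast
    qed
  qed
  thus ?thesis by blast
qed

text \<open>\<open>I\<close> plus the \<open>K[g]\<close>-module generated by the finitely many
  monomials up to degree \<open>D\<close>.\<close>

definition monom_module ::
  "('s::finite, 'k::field) mps set \<Rightarrow> ('s, 'k) mps \<Rightarrow> nat \<Rightarrow> ('s, 'k) mps set" where
  "monom_module I g D =
     {r. \<exists>\<iota>\<in>I. \<exists>p. r = \<iota> + (\<Sum>\<alpha> | mono_degree \<alpha> \<le> D. poly_at g (p \<alpha>) * mps_monom \<alpha>)}"

context mps_ideal
begin

lemma monom_module_add:
  assumes "a \<in> monom_module I g D" "b \<in> monom_module I g D"
  shows "a + b \<in> monom_module I g D"
proof -
  obtain \<iota> \<iota>' p p' where ab: "\<iota> \<in> I" "\<iota>' \<in> I"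
    "a = \<iota> + (\<Sum>\<alpha> | mono_degree \<alpha> \<le> D. poly_at g (p \<alpha>) * mps_monom \<alpha>)"
    "b = \<iota>' + (\<Sum>\<alpha> | mono_degree \<alpha> \<le> D. poly_at g (p' \<alpha>) * mps_monom \<alpha>)"
    using assms unfolding monom_module_def by blast
  have "a + b = (\<iota> + \<iota>') +
      (\<Sum>\<alpha> | mono_degree \<alpha> \<le> D. poly_at g (p \<alpha> + p' \<alpha>) * mps_monom \<alpha>)"
    by (simp add: ab poly_at_add distrib_right sum.distrib)
  thus ?thesis using add[OF ab(1,2)] unfolding monom_module_def
    by (intro CollectI bexI[of _ "\<iota> + \<iota>'"] exI[of _ "\<lambda>\<alpha>. p \<alpha> + p' \<alpha>"])
qed

lemma monom_module_poly_mult: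
  assumes "a \<in> monom_module I g D"
  shows "poly_at g q * a \<in> monom_module I g D"
proof -
  obtain \<iota> p where a: "\<iota> \<in> I"
    "a = \<iota> + (\<Sum>\<alpha> | mono_degree \<alpha> \<le> D. poly_at g (p \<alpha>) * mps_monom \<alpha>)"
    using assms unfolding monom_module_def by blast
  have "poly_at g q * a = poly_at g q * \<iota> +
      (\<Sum>\<alpha> | mono_degree \<alpha> \<le> D. poly_at g (q * p \<alpha>) * mps_monom \<alpha>)"
    by (simp add: a poly_at_mult distrib_left sum_distrib_left mult.assoc)
  thus ?thesis using mult[OF a(1), of "poly_at g q"] unfolding monom_module_def
    by (intro CollectI bexI[of _ "poly_at g q * \<iota>"] exI[of _ "\<lambda>\<alpha>. q * p \<alpha>"])
qed

lemma monom_module_ideal: "I \<subseteq> monom_module I g D"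
  unfolding monom_module_def by (intro subsetI CollectI bexI exI[of _ "\<lambda>_. 0"]) auto

lemma monom_module_monom:
  assumes "mono_degree \<beta> \<le> D"
  shows "mps_monom \<beta> \<in> monom_module I g D"
proof -
  have "(\<Sum>\<alpha> | mono_degree \<alpha> \<le> D. poly_at g (if \<alpha> = \<beta> then 1 else 0) * mps_monom \<alpha>) =
      (\<Sum>\<alpha> | mono_degree \<alpha> \<le> D. if \<alpha> = \<beta> then mps_monom \<beta> else 0)"
    by (rule sum.cong) (auto simp: poly_at_const one_pCons)
  also have "\<dots> = mps_monom \<beta>"
    using assms by (simp add: sum.delta[OF finite_mono_degree_le])
  finally have "mps_monom \<beta> = 0 +
      (\<Sum>\<alpha> | mono_degree \<alpha> \<le> D. poly_at g (if \<alpha> = \<beta> then 1 else 0) * mps_monom \<alpha>)"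
    by simp
  thus ?thesis using zero unfolding monom_module_def
    by (intro CollectI bexI[of _ 0] exI[of _ "\<lambda>\<alpha>. if \<alpha> = \<beta> then 1 else 0"])
qed

lemma monom_module_deg_le:
  assumes "\<And>\<beta>. mps_monom \<beta> \<in> monom_module I g D" "f \<in> deg_le n"
  shows "f \<in> monom_module I g D"
proof -
  have *: "mps_const c * a \<in> monom_module I g D" if "a \<in> monom_module I g D" for c a
    using monom_module_poly_mult[OF that, of "[:c:]"] by (simp add: poly_at_const)
  have **: "sum f S \<in> monom_module I g D" if "\<And>i. i \<in> S \<Longrightarrow> f i \<in> monom_module I g D"
    for S and f :: "'c \<Rightarrow> _"
    using that monom_module_ideal zero
    by (induction S rule: infinite_finite_induct) (auto intro: monom_module_add)
  show ?thesis
    by (subst deg_le_expand[OF assms(2)]) (intro ** * assms(1))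
qed

lemma monom_module_family:
  fixes f :: "nat \<Rightarrow> ('s, 'k) mps"
  assumes "\<And>n. f n \<in> monom_module I g D"
  shows "\<exists>\<iota> p. (\<forall>n. \<iota> n \<in> I) \<and> (\<forall>n. f n = \<iota> n +
    (\<Sum>\<alpha> | mono_degree \<alpha> \<le> D. poly_at g (p n \<alpha>) * mps_monom \<alpha>))"
proof -
  have "\<forall>n. \<exists>\<iota> p. \<iota> \<in> I \<and> f n = \<iota> + (\<Sum>\<alpha> | mono_degree \<alpha> \<le> D. poly_at g (p \<alpha>) * mps_monom \<alpha>)"
    using assms unfolding monom_module_def by blast
  thus ?thesis by metis
qed

text \<open>There is one more power of \<open>f\<close> than there are generators, so the
  coefficient vectors are linearly dependent over the polynomial ring. The dependence need not be
  monic; only a nonzero top coefficient is obtained, by cutting off at the last nonzero one.\<close>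

lemma algebraic_relation:
  assumes "\<And>n. f ^ n \<in> monom_module I g D"
  obtains c :: "nat \<Rightarrow> 'k poly" and n
  where "c n \<noteq> 0" "(\<Sum>i\<le>n. poly_at g (c i) * f ^ i) \<in> I"
proof -
  let ?Y = "{\<alpha> :: 's \<Rightarrow>\<^sub>0 nat. mono_degree \<alpha> \<le> D}"
  from monom_module_family[of "\<lambda>i. f ^ i", OF assms]
  obtain \<iota> p where p: "\<And>i. \<iota> i \<in> I"
    "\<And>i. f ^ i = \<iota> i + (\<Sum>\<alpha>\<in>?Y. poly_at g (p i \<alpha>) * mps_monom \<alpha>)"
    by blast
  define N where "N = card ?Y"
  obtain c i0 where c: "i0 \<le> N" "c i0 \<noteq> 0" "\<And>\<alpha>. \<alpha> \<in> ?Y \<Longrightarrow> (\<Sum>i\<le>N. c i * p i \<alpha>) = 0"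
    using ex_nontrivial_solution[OF finite_mono_degree_le, of "{..N}" D p] by (auto simp: N_def)
  define n where "n = Max {i. i \<le> N \<and> c i \<noteq> 0}"
  have fin: "finite {i. i \<le> N \<and> c i \<noteq> 0}" by simp
  have "n \<in> {i. i \<le> N \<and> c i \<noteq> 0}"
    unfolding n_def using c(1,2) by (intro Max_in fin) auto
  hence n: "n \<le> N" "c n \<noteq> 0" by auto
  have above: "c i = 0" if "i \<le> N" "n < i" for i
    using that Max_ge[OF fin, of i] unfolding n_def by fastforce
  have "(\<Sum>i\<le>N. poly_at g (c i) * f ^ i) = (\<Sum>i\<le>N. poly_at g (c i) * \<iota> i) +
      (\<Sum>i\<le>N. \<Sum>\<alpha>\<in>?Y. poly_at g (c i * p i \<alpha>) * mps_monom \<alpha>)"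
    unfolding p(2) by (simp add: distrib_left sum.distrib sum_distrib_left poly_at_mult mult.assoc)
  also have "(\<Sum>i\<le>N. \<Sum>\<alpha>\<in>?Y. poly_at g (c i * p i \<alpha>) * mps_monom \<alpha>) =
      (\<Sum>\<alpha>\<in>?Y. \<Sum>i\<le>N. poly_at g (c i * p i \<alpha>) * mps_monom \<alpha>)"
    by (rule sum.swap)
  also have "\<dots> = (\<Sum>\<alpha>\<in>?Y. poly_at g (\<Sum>i\<le>N. c i * p i \<alpha>) * mps_monom \<alpha>)"
    by (simp add: poly_at_sum sum_distrib_right)
  also have "\<dots> = 0"
    by (rule sum.neutral) (use c(3) in auto)
  finally have "(\<Sum>i\<le>N. poly_at g (c i) * f ^ i) \<in> I"
    using sum[of "{..N}" "\<lambda>i. poly_at g (c i) * \<iota> i"] mult p(1) by simp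
  also have "(\<Sum>i\<le>N. poly_at g (c i) * f ^ i) = (\<Sum>i\<le>n. poly_at g (c i) * f ^ i)"
    using n above by (intro sum.mono_neutral_right) auto
  finally show ?thesis using that n(2) by blast
qed

text \<open>Modulo \<open>I\<close>, \<open>x^(n M)\<close> equals \<open>(g r)^M\<close>, which has
  the factor \<open>g^M\<close>.\<close>

lemma power_eq_mod:
  assumes "x ^ n - g * r \<in> I" "g ^ M \<in> I"
  shows "x ^ (n * M) \<in> I"
proof -
  have "(x ^ n) ^ m - (g * r) ^ m \<in> I" for m
  proof (induction m)
    case (Suc m)
    have "(x ^ n) ^ Suc m - (g * r) ^ Suc m =
        x ^ n * ((x ^ n) ^ m - (g * r) ^ m) + (g * r) ^ m * (x ^ n - g * r)"
      by (simp add: algebra_simps)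
    thus ?case using Suc assms(1) add mult by simp
  qed (simp add: zero)
  moreover have "(g * r) ^ M \<in> I"
    using mult[OF assms(2), of "r ^ M"] by (simp add: power_mult_distrib mult.commute)
  ultimately show ?thesis
    using add by (metis diff_add_cancel power_mult)
qed

text \<open>Modulo \<open>I\<close> and \<open>g\<close> only the constant terms of the coefficients
  survive, so the powers of the variable satisfy a relation over the field. The polynomial in
  \<open>x_l\<close> obtained is a power of \<open>x_l\<close> times a unit.\<close>

lemma var_power_relation:
  assumes "\<And>n. mps_var l ^ n \<in> monom_module I g D"
  obtains n r where "mps_var l ^ n - g * r \<in> I"
proof -
  let ?Y = "{\<alpha> :: 's \<Rightarrow>\<^sub>0 nat. mono_degree \<alpha> \<le> D}"
  from monom_module_family[of "\<lambda>i. mps_var l ^ i", OF assms]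
  obtain \<iota> p where p: "\<And>i. \<iota> i \<in> I"
    "\<And>i. mps_var l ^ i = \<iota> i + (\<Sum>\<alpha>\<in>?Y. poly_at g (p i \<alpha>) * mps_monom \<alpha>)"
    by blast
  have "\<exists>p'. poly_at g q = mps_const (Polynomial.coeff q 0) + g * p'" for q
    by (cases q) (auto simp: poly_at_pCons)
  then obtain T where T: "\<And>q. poly_at g q = mps_const (Polynomial.coeff q 0) + g * T q" by metis
  define N where "N = card ?Y"
  obtain c i0 where c: "i0 \<le> N" "c i0 \<noteq> 0"
    "\<And>\<alpha>. \<alpha> \<in> ?Y \<Longrightarrow> (\<Sum>i\<le>N. c i * Polynomial.coeff (p i \<alpha>) 0) = 0"
    using ex_nontrivial_solution[OF finite_mono_degree_le, of "{..N}" D "\<lambda>i \<alpha>. Polynomial.coeff (p i \<alpha>) 0"]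
    by (auto simp: N_def)
  define P where "P = (\<Sum>i\<le>N. Polynomial.monom (c i) i)"
  have "Polynomial.coeff P i0 = c i0" using c(1) by (simp add: P_def coeff_sum)
  hence "P \<noteq> 0" using c(2) by auto
  obtain n w where w: "poly_at (mps_var l) P = mps_var l ^ n * w" "w dvd 1"
    using poly_at_eq_power_unit[OF \<open>P \<noteq> 0\<close>, of "mps_var l"] mps_var_ord_ge by metis
  define R where "R = (\<Sum>i\<le>N. \<Sum>\<alpha>\<in>?Y. mps_const (c i) * T (p i \<alpha>) * mps_monom \<alpha>)"
  have "poly_at (mps_var l) P = (\<Sum>i\<le>N. mps_const (c i) * mps_var l ^ i)"
    by (simp add: P_def poly_at_sum poly_at_monom)
  also have "\<dots> = (\<Sum>i\<le>N. mps_const (c i) * \<iota> i) +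
      (\<Sum>i\<le>N. \<Sum>\<alpha>\<in>?Y. mps_const (c i) * (poly_at g (p i \<alpha>) * mps_monom \<alpha>))"
    unfolding p(2) by (simp add: distrib_left sum.distrib sum_distrib_left)
  also have "(\<Sum>i\<le>N. \<Sum>\<alpha>\<in>?Y. mps_const (c i) * (poly_at g (p i \<alpha>) * mps_monom \<alpha>)) =
      (\<Sum>i\<le>N. \<Sum>\<alpha>\<in>?Y. mps_const (c i * Polynomial.coeff (p i \<alpha>) 0) * mps_monom \<alpha>) + g * R"
    unfolding T R_def
    by (simp add: sum_distrib_left algebra_simps sum.distrib mps_const_mult)
  also have "(\<Sum>i\<le>N. \<Sum>\<alpha>\<in>?Y. mps_const (c i * Polynomial.coeff (p i \<alpha>) 0) * mps_monom \<alpha>) =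
      (\<Sum>\<alpha>\<in>?Y. \<Sum>i\<le>N. mps_const (c i * Polynomial.coeff (p i \<alpha>) 0) * mps_monom \<alpha>)"
    by (rule sum.swap)
  also have "\<dots> = (\<Sum>\<alpha>\<in>?Y. mps_const (\<Sum>i\<le>N. c i * Polynomial.coeff (p i \<alpha>) 0) * mps_monom \<alpha>)"
  proof (rule sum.cong[OF refl])
    fix \<alpha>
    have "mps_const (sum f {..m}) = (\<Sum>i\<le>m. mps_const (f i) :: ('s, 'k) mps)" for f and m :: nat
      by (induction m) (auto simp: mps_const_add)
    thus "(\<Sum>i\<le>N. mps_const (c i * Polynomial.coeff (p i \<alpha>) 0) * mps_monom \<alpha>) =
        mps_const (\<Sum>i\<le>N. c i * Polynomial.coeff (p i \<alpha>) 0) * mps_monom \<alpha>"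
      by (simp add: sum_distrib_right)
  qed
  also have "\<dots> = 0"
    by (rule sum.neutral) (use c(3) in auto)
  finally have "poly_at (mps_var l) P - g * R = (\<Sum>i\<le>N. mps_const (c i) * \<iota> i)" by simp
  moreover have "(\<Sum>i\<le>N. mps_const (c i) * \<iota> i) \<in> I" by (intro sum mult p(1))
  ultimately have "mps_var l ^ n * w - g * R \<in> I" using w by simp
  moreover obtain v where v: "w * v = 1" using w(2) by (metis dvdE)
  ultimately have "v * (mps_var l ^ n * w - g * R) \<in> I" by (intro mult)
  also have "v * (mps_var l ^ n * w - g * R) = mps_var l ^ n * (w * v) - g * (R * v)"
    by (simp add: algebra_simps)
  finally show ?thesis using that v by simp
qed

text \<open>
  Expanding \<open>\<Sum>\<^sub>i c\<^sub>i(g) (f + g\<^sup>a)\<^sup>i\<close> in powers of \<open>g\<^sup>a\<close>, the coefficient of the highest power is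
  \<open>c\<^sub>n(g)\<close>, which is a power of \<open>g\<close> up to a unit.
\<close>

lemma power_in_ideal_of_translates:
  assumes "g \<in> ord_ge 1" "c n \<noteq> 0"
    and rel: "\<And>a. a > k \<Longrightarrow> (\<Sum>i\<le>n. poly_at g (c i) * (f + g ^ a) ^ i) \<in> I"
  obtains M where "g ^ M \<in> I"
proof -
  \<comment> \<open>The coefficient of \<open>g^(a e)\<close>, which is independent of
    \<open>a\<close>.\<close>
  define q where "q e = (\<Sum>i\<le>n. poly_at g (c i) * (of_nat (i choose e) * f ^ (i - e)))" for e
  have "(\<Sum>e\<le>n. q e * g ^ (a * e)) \<in> I" if "a \<ge> Suc k" for a
  proof -
    have binom: "(f + g ^ a) ^ i = (\<Sum>e\<le>n. of_nat (i choose e) * f ^ (i - e) * g ^ (a * e))"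
      if "i \<le> n" for i
    proof -
      have "(g ^ a + f) ^ i = (\<Sum>e\<le>i. of_nat (i choose e) * (g ^ a) ^ e * f ^ (i - e))"
        by (rule binomial_ring)
      also have "\<dots> = (\<Sum>e\<le>i. of_nat (i choose e) * f ^ (i - e) * g ^ (a * e))"
        by (simp add: mult_ac flip: power_mult)
      also have "\<dots> = (\<Sum>e\<le>n. of_nat (i choose e) * f ^ (i - e) * g ^ (a * e))"
        using that by (intro sum.mono_neutral_left) (auto simp: not_le binomial_eq_0)
      finally show ?thesis by (simp add: add.commute)
    qed
    have "(\<Sum>i\<le>n. poly_at g (c i) * (f + g ^ a) ^ i) =
        (\<Sum>i\<le>n. \<Sum>e\<le>n. poly_at g (c i) * (of_nat (i choose e) * f ^ (i - e) * g ^ (a * e)))"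
      by (rule sum.cong) (auto simp: binom sum_distrib_left)
    also have "\<dots> = (\<Sum>e\<le>n. \<Sum>i\<le>n. poly_at g (c i) * (of_nat (i choose e) * f ^ (i - e) * g ^ (a * e)))"
      by (rule sum.swap)
    also have "\<dots> = (\<Sum>e\<le>n. q e * g ^ (a * e))"
      by (simp add: q_def sum_distrib_right mult.assoc)
    finally show ?thesis using rel[of a] that by simp
  qed
  from geometric_elimination[OF finite_atMost assms(1) this]
  obtain M where "q n * g ^ M \<in> I" by auto
  \<comment> \<open>Only i = n contributes, with binomial coefficient 1 in every
    characteristic.\<close>
  also have "q n = poly_at g (c n)"
  proof -
    have "q n = (\<Sum>i\<le>n. if i = n then poly_at g (c n) else 0)"
      unfolding q_def by (rule sum.cong) (auto simp: binomial_eq_0)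
    thus ?thesis by simp
  qed
  finally have "poly_at g (c n) * g ^ M \<in> I" .
  moreover obtain b w where "poly_at g (c n) = g ^ b * w" "w dvd 1"
    using poly_at_eq_power_unit[OF assms(2,1)] by metis
  ultimately have "w * g ^ (b + M) \<in> I"
    by (simp add: power_add mult_ac)
  thus ?thesis using unit_cancel \<open>w dvd 1\<close> that by blast
qed

end

section \<open>Contradiction for a determined pair\<close>

subsection \<open>Pairs with a vanishing linear part are not determined\<close>

lemma mps_automorphisms_comp:
  "\<phi> \<in> mps_automorphisms \<Longrightarrow> \<psi> \<in> mps_automorphisms \<Longrightarrow> \<phi> \<circ> \<psi> \<in> mps_automorphisms"
  by (auto simp: mps_automorphisms_def intro: bij_comp)

text \<open>Provides exponents q n + 1 that survive differentiation: \<open>q\<close> is the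
  characteristic if that is positive, and 1 otherwise.\<close>

lemma ex_multiples_plus_1_nonzero:
  obtains q :: nat where "q > 0" "\<And>n. of_nat (q * n + 1) \<noteq> (0 :: 'k::field)"
proof (cases "CHAR('k) = 0")
  case True
  have "of_nat (1 * n + 1) \<noteq> (0 :: 'k)" for n
    using True by (simp only: of_nat_eq_0_iff_char_dvd) simp
  thus ?thesis by (rule that[of 1, rotated]) simp
next
  case False
  have "of_nat (CHAR('k) * n + 1) = (1 :: 'k)" for n by simp
  hence "of_nat (CHAR('k) * n + 1) \<noteq> (0 :: 'k)" for n by (metis zero_neq_one)
  thus ?thesis by (rule that[of "CHAR('k)", rotated]) (use False in simp)
qed

lemma mps_pderiv_sum_powers:
  fixes n :: "'s::finite \<Rightarrow> nat"
  assumes "\<And>j. n j > 0"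
  shows "mps_pderiv i (\<Sum>j\<in>UNIV. mps_var j ^ n j :: ('s, 'a::comm_ring_1) mps) =
    mps_const (of_nat (n i)) * mps_var i ^ (n i - 1)"
proof -
  have "mps_pderiv i (mps_var j ^ n j :: ('s, 'a) mps) =
      (if j = i then mps_const (of_nat (n i)) * mps_var i ^ (n i - 1) else 0)" for j
  proof -
    obtain m where m: "n j = Suc m" using assms[of j] gr0_implies_Suc by blast
    show ?thesis
    proof (cases "j = i")
      case True
      hence "n i = Suc m" using m by simp
      thus ?thesis using True by (simp only: mps_pderiv_power mps_pderiv_var mps_const_of_nat) simp
    next
      case False
      thus ?thesis by (simp add: m mps_pderiv_power mps_pderiv_var del: power_Suc)
    qed
  qed
  thus ?thesis by (simp add: mps_pderiv_sum)
qed

lemma mps_var_power_deg_le: "n \<le> m \<Longrightarrow> mps_var i ^ n \<in> deg_le m"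
  by (auto simp: mps_var_power intro: mps_monom_deg_le)

lemma mps_var_power_ord_ge: "m \<le> n \<Longrightarrow> mps_var i ^ n \<in> ord_ge m"
  by (auto simp: mps_var_power intro: mps_monom_ord_ge)

text \<open>The distinct degrees \<open>d + e i\<close> make the leading form of each minor a monomial.\<close>

lemma minor_leading_monomial:
  fixes F G :: "('s::finite, 'k::field) mps" and e :: "'s \<Rightarrow> nat"
  assumes F: "F \<in> deg_le k" and G: "G \<in> deg_le k" and k: "k < d" "d > 1"
    and nz: "of_nat d \<noteq> (0 :: 'k)" "of_nat (d + e i) \<noteq> (0 :: 'k)"
    and ij: "e j < e i"
  defines "f \<equiv> F + (\<Sum>j\<in>UNIV. mps_var j ^ (d + e j))" and "g \<equiv> G + (\<Sum>j\<in>UNIV. mps_var j ^ d)"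
  shows "\<exists>c L. c \<noteq> 0 \<and> L \<in> deg_le ((d + e i - 1) + (d - 1) - 1) \<and>
    mps_const c * (mps_var i ^ (d + e i - 1) * mps_var j ^ (d - 1)) + L
      \<in> minors_ideal (\<lambda>\<nu>. mps_pderiv \<nu> f) (\<lambda>\<nu>. mps_pderiv \<nu> g)"
proof -
  define u where "u \<nu> = mps_const (of_nat (d + e \<nu>)) * (mps_var \<nu> ^ (d + e \<nu> - 1) :: ('s, 'k) mps)" for \<nu>
  define v where "v \<nu> = mps_const (of_nat d) * (mps_var \<nu> ^ (d - 1) :: ('s, 'k) mps)" for \<nu>
  have f: "mps_pderiv \<nu> f = mps_pderiv \<nu> F + u \<nu>" for \<nu>
    using k mps_pderiv_sum_powers[of "\<lambda>j. d + e j" \<nu>] by (simp add: f_def mps_pderiv_add u_def)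
  have g: "mps_pderiv \<nu> g = mps_pderiv \<nu> G + v \<nu>" for \<nu>
    using k mps_pderiv_sum_powers[of "\<lambda>_. d" \<nu>] by (simp add: g_def mps_pderiv_add v_def)
  have dF: "mps_pderiv \<nu> F \<in> deg_le (d - 2)" and dG: "mps_pderiv \<nu> G \<in> deg_le (d - 2)" for \<nu>
    using deg_le_mono[OF _ deg_le_pderiv[OF F]] deg_le_mono[OF _ deg_le_pderiv[OF G]] k by auto
  have u: "u \<nu> \<in> deg_le (d + e \<nu> - 1)" and v: "v \<nu> \<in> deg_le (d - 1)" for \<nu>
    by (auto simp: u_def v_def intro!: deg_le_const_mult mps_var_power_deg_le)
  \<comment> \<open>Everything in the minor except \<open>u i * v j\<close>. The opposite product
    \<open>u j * v i\<close> has smaller degree because e j < e i.\<close>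
  define L where "L = mps_pderiv i F * mps_pderiv j G + mps_pderiv i F * v j + u i * mps_pderiv j G
     - (mps_pderiv j F + u j) * (mps_pderiv i G + v i)"
  have fj: "mps_pderiv j F + u j \<in> deg_le (d + e j - 1)"
    using deg_le_mono[OF _ dF] by (intro deg_le_add u) auto
  have gi: "mps_pderiv i G + v i \<in> deg_le (d - 1)"
    using deg_le_mono[OF _ dG] by (intro deg_le_add v) auto
  have "L \<in> deg_le ((d + e i - 1) + (d - 1) - 1)"
    unfolding L_def
  proof (intro deg_le_add deg_le_diff)
    show "mps_pderiv i F * mps_pderiv j G \<in> deg_le ((d + e i - 1) + (d - 1) - 1)"
      by (rule deg_le_mult_le[OF dF dG]) (use k in linarith)
    show "mps_pderiv i F * v j \<in> deg_le ((d + e i - 1) + (d - 1) - 1)"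
      by (rule deg_le_mult_le[OF dF v]) (use k ij in linarith)
    show "u i * mps_pderiv j G \<in> deg_le ((d + e i - 1) + (d - 1) - 1)"
      by (rule deg_le_mult_le[OF u dG]) (use k in linarith)
    show "(mps_pderiv j F + u j) * (mps_pderiv i G + v i) \<in> deg_le ((d + e i - 1) + (d - 1) - 1)"
      by (rule deg_le_mult_le[OF fj gi]) (use k ij in linarith)
  qed
  moreover have "mps_const (of_nat (d + e i) * of_nat d) *
      (mps_var i ^ (d + e i - 1) * mps_var j ^ (d - 1)) + L =
      mps_pderiv i f * mps_pderiv j g - mps_pderiv j f * mps_pderiv i g"
  proof -
    have "mps_const (of_nat (d + e i) * of_nat d) * (mps_var i ^ (d + e i - 1) * mps_var j ^ (d - 1))
        = u i * v j"
      unfolding u_def v_def mps_const_mult by (simp only: mult_ac)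
    thus ?thesis unfolding f g L_def by (simp add: algebra_simps)
  qed
  moreover have "of_nat (d + e i) * of_nat d \<noteq> (0 :: 'k)" using nz by (simp only: mult_eq_0_iff) simp
  ultimately show ?thesis using minors_ideal_minor by metis
qed

lemma not_determined_pair:
  fixes f g :: "('s::finite, 'k::field) mps"
  assumes f: "f \<in> ord_ge 2" and g: "g \<in> ord_ge 1" and k: "k > 0"
    and det: "\<And>f' g'. f' - f \<in> ord_ge (Suc k) \<Longrightarrow> g' - g \<in> ord_ge (Suc k) \<Longrightarrow>
      \<exists>\<phi>\<in>mps_automorphisms. \<phi> f = f' \<and> \<phi> g = g'"
  shows False
proof -
  obtain q :: nat where q: "q > 0" "\<And>n. of_nat (q * n + 1) \<noteq> (0 :: 'k)"
    using ex_multiples_plus_1_nonzero by blast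
  obtain idx :: "'s \<Rightarrow> nat" where idx: "inj idx"
    using finite_imp_inj_to_nat_seg[OF finite[of "UNIV :: 's set"]] by blast
  \<comment> \<open>Congruent to 1 modulo \<open>q\<close>, so that derivatives survive, and above k
    + 1, so that the added powers exceed the degrees of the truncations.\<close>
  define d where "d = q * Suc k + 1"
  \<comment> \<open>Distinct multiples of \<open>q\<close>, so the exponents d + e j stay congruent
    to 1 and become pairwise different.\<close>
  define e where "e j = q * idx j" for j
  have "Suc k \<le> q * Suc k" using q(1) by (cases q) auto
  hence "Suc k < d" by (simp only: d_def less_Suc_eq_le Suc_eq_plus1[symmetric])
  hence d: "k < d" "d > 1" by simp_all
  have nz: "of_nat d \<noteq> (0 :: 'k)" "of_nat (d + e i) \<noteq> (0 :: 'k)" for i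
  proof -
    show "of_nat d \<noteq> (0 :: 'k)" unfolding d_def by (rule q(2))
    have "d + e i = q * (Suc k + idx i) + 1" by (simp add: d_def e_def algebra_simps)
    thus "of_nat (d + e i) \<noteq> (0 :: 'k)" using q(2) by metis
  qed
  have e_inj: "e i \<noteq> e j" if "i \<noteq> j" for i j
    using that q(1) idx by (simp add: e_def inj_eq)
  define f0 where "f0 = mps_trunc k f + (\<Sum>j\<in>UNIV. mps_var j ^ (d + e j))"
  define g0 where "g0 = mps_trunc k g + (\<Sum>j\<in>UNIV. mps_var j ^ d)"
  define I where "I = minors_ideal (\<lambda>\<nu>. mps_pderiv \<nu> f0) (\<lambda>\<nu>. mps_pderiv \<nu> g0)"
  interpret mps_ideal I unfolding I_def by (rule mps_ideal_minors)
  have f0f: "f0 - f \<in> ord_ge (Suc k)"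
  proof -
    have "f0 - f = (mps_trunc k f - f) + (\<Sum>j\<in>UNIV. mps_var j ^ (d + e j))" by (simp add: f0_def)
    also have "\<dots> \<in> ord_ge (Suc k)"
      using d by (intro ord_ge_add ord_ge_sum mps_var_power_ord_ge mps_trunc_diff_ord_ge) auto
    finally show ?thesis .
  qed
  have g0g: "g0 - g \<in> ord_ge (Suc k)"
  proof -
    have "g0 - g = (mps_trunc k g - g) + (\<Sum>j\<in>UNIV. mps_var j ^ d)" by (simp add: g0_def)
    also have "\<dots> \<in> ord_ge (Suc k)"
      using d by (intro ord_ge_add ord_ge_sum mps_var_power_ord_ge mps_trunc_diff_ord_ge) auto
    finally show ?thesis .
  qed
  have g0: "g0 \<in> ord_ge 1"
    using ord_ge_add[OF g ord_ge_mono[OF _ g0g]] by simp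
  have f0: "f0 \<in> ord_ge 2"
    using ord_ge_add[OF f ord_ge_mono[OF _ f0f]] k by simp
  \<comment> \<open>\<open>E\<close> bounds the degree of \<open>f0\<close> and the exponents in the
    leading monomials of the minors; \<open>D\<close> is the degree up to which the reduction takes
    all monomials as given.\<close>
  define E where "E = d + (\<Sum>j\<in>UNIV. e j)"
  define D where "D = CARD('s) * E + d"
  have e_le: "d + e i - 1 \<le> E" for i
    using member_le_sum[of i UNIV e] by (simp add: E_def)
  have lead: "\<exists>c L. c \<noteq> 0 \<and> L \<in> deg_le ((d + e i - 1) + (d - 1) - 1) \<and>
     mps_const c * (mps_var i ^ (d + e i - 1) * mps_var j ^ (d - 1)) + L \<in> I" if "e j < e i" for i j
    unfolding I_def f0_def g0_def
    by (rule minor_leading_monomial[OF mps_trunc_deg_le mps_trunc_deg_le d nz that])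
  have monom: "mps_monom \<beta> \<in> monom_module I g0 D" for \<beta>
  proof (rule mps_monom_reduction[where I = I and E = E and d = d and g = g0 and G = "mps_trunc k g"])
    show "mps_ideal I" by unfold_locales
    show "mps_const c * a \<in> monom_module I g0 D" if "a \<in> monom_module I g0 D" for c a
      using monom_module_poly_mult[OF that, of "[:c:]"] by (simp add: poly_at_const)
    show "g0 * a \<in> monom_module I g0 D" if "a \<in> monom_module I g0 D" for a
      using monom_module_poly_mult[OF that, of "[:0, 1:]"] by (simp add: poly_at_pCons)
    show "mps_trunc k g \<in> deg_le (d - 1)"
      using d by (intro deg_le_mono[OF _ mps_trunc_deg_le]) auto
    show "\<exists>c p q L. c \<noteq> 0 \<and> p \<le> E \<and> q \<le> E \<and> 0 < p + q \<and>
        L \<in> deg_le (p + q - 1) \<and> mps_const c * (mps_var i ^ p * mps_var j ^ q) + L \<in> I"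
      if "i \<noteq> j" for i j
    proof (cases "e j < e i")
      case True
      from lead[OF this] obtain c L where
        "c \<noteq> 0 \<and> L \<in> deg_le ((d + e i - 1) + (d - 1) - 1) \<and>
          mps_const c * (mps_var i ^ (d + e i - 1) * mps_var j ^ (d - 1)) + L \<in> I"
        by blast
      thus ?thesis using e_le[of i] d
        by (intro exI[of _ c] exI[of _ "d + e i - 1"] exI[of _ "d - 1"] exI[of _ L]) (auto simp: E_def)
    next
      case False
      hence "e i < e j" using e_inj[OF that] by simp
      from lead[OF this] obtain c L where
        "c \<noteq> 0 \<and> L \<in> deg_le ((d + e j - 1) + (d - 1) - 1) \<and>
          mps_const c * (mps_var j ^ (d + e j - 1) * mps_var i ^ (d - 1)) + L \<in> I"
        by blast
      hence "c \<noteq> 0 \<and> L \<in> deg_le ((d - 1) + (d + e j - 1) - 1) \<and>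
          mps_const c * (mps_var i ^ (d - 1) * mps_var j ^ (d + e j - 1)) + L \<in> I"
        by (simp only: mult.commute[of "mps_var i ^ (d - 1)"] add.commute[of "d - 1" "d + e j - 1"]
            simp_thms)
      thus ?thesis using e_le[of j] d
        by (intro exI[of _ c] exI[of _ "d - 1"] exI[of _ "d + e j - 1"] exI[of _ L]) (auto simp: E_def)
    qed
  qed (use d in \<open>auto simp: g0_def D_def intro: monom_module_add monom_module_monom
      monom_module_ideal[THEN subsetD]\<close>)
  \<comment> \<open>Truncation pays off here: \<open>f0\<close> is a polynomial, so all its powers
    lie in the module.\<close>
  have "f0 \<in> deg_le E"
    using d e_le unfolding f0_def E_def
    by (intro deg_le_add deg_le_sum deg_le_mono[OF _ mps_trunc_deg_le] mps_var_power_deg_le)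
       (auto intro: member_le_sum)
  hence "f0 ^ n \<in> monom_module I g0 D" for n
    using monom_module_deg_le[OF monom] deg_le_power by blast
  then obtain c n where c: "c n \<noteq> 0" "(\<Sum>i\<le>n. poly_at g0 (c i) * f0 ^ i) \<in> I"
    by (rule algebraic_relation)
  \<comment> \<open>Both \<open>(f0, g0)\<close> and \<open>(f0 + g0^a, g0)\<close> agree with
    \<open>(f, g)\<close> up to order k, so both are images of it; going through
    \<open>(f, g)\<close> links them by an automorphism fixing \<open>g0\<close>.\<close>
  have translate: "(\<Sum>i\<le>n. poly_at g0 (c i) * (f0 + g0 ^ a) ^ i) \<in> I" if "a > k" for a
  proof -
    have "g0 ^ a \<in> ord_ge (Suc k)"
      using that ord_ge_power[OF g0, of a] by (intro ord_ge_mono[of "Suc k" a]) auto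
    from ord_ge_add[OF f0f this] have "f0 + g0 ^ a - f \<in> ord_ge (Suc k)"
      by (simp add: algebra_simps)
    then obtain \<psi> where \<psi>: "\<psi> \<in> mps_automorphisms" "\<psi> f = f0 + g0 ^ a" "\<psi> g = g0"
      using det g0g by blast
    obtain \<xi> where \<xi>: "\<xi> \<in> mps_automorphisms" "\<xi> f = f0" "\<xi> g = g0"
      using det f0f g0g by blast
    interpret \<xi>: mps_automorphism \<xi> by unfold_locales (rule \<xi>)
    interpret mps_automorphism "\<psi> \<circ> inv_into UNIV \<xi>"
      by unfold_locales (intro mps_automorphisms_comp \<psi> \<xi>.automorphism_inv)
    have inv: "inv_into UNIV \<xi> (\<xi> h) = h" for h
      using \<xi>.bij by (simp add: bij_def)
    have \<phi>: "(\<psi> \<circ> inv_into UNIV \<xi>) f0 = f0 + g0 ^ a" "(\<psi> \<circ> inv_into UNIV \<xi>) g0 = g0"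
      using inv[of f] inv[of g] \<psi> \<xi> by auto
    have "(\<psi> \<circ> inv_into UNIV \<xi>) (\<Sum>i\<le>n. poly_at g0 (c i) * f0 ^ i) \<in>
        minors_ideal (\<lambda>\<nu>. mps_pderiv \<nu> (f0 + g0 ^ a)) (\<lambda>\<nu>. mps_pderiv \<nu> g0)"
      using minors_ideal_image[OF c(2)[unfolded I_def]] by (simp only: \<phi>)
    also have "(\<psi> \<circ> inv_into UNIV \<xi>) (\<Sum>i\<le>n. poly_at g0 (c i) * f0 ^ i) =
        (\<Sum>i\<le>n. poly_at g0 (c i) * (f0 + g0 ^ a) ^ i)"
      by (simp only: sum mult power poly_at \<phi>)
    also have "minors_ideal (\<lambda>\<nu>. mps_pderiv \<nu> (f0 + g0 ^ a)) (\<lambda>\<nu>. mps_pderiv \<nu> g0) = I"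
      unfolding I_def using that by (intro minors_ideal_add_power) simp
    finally show ?thesis .
  qed
  obtain M where M: "g0 ^ M \<in> I"
    using power_in_ideal_of_translates[OF g0 c(1) translate] by blast
  have "\<exists>n. mps_var l ^ n \<in> I" for l
  proof -
    have "mps_var l ^ n \<in> monom_module I g0 D" for n
      unfolding mps_var_power by (rule monom)
    then obtain n r where "mps_var l ^ n - g0 * r \<in> I"
      by (rule var_power_relation)
    thus ?thesis using power_eq_mod M by blast
  qed
  then obtain n where n: "\<And>l. mps_var l ^ n l \<in> I" by metis
  \<comment> \<open>A common exponent for all variables; \<open>Suc\<close> makes it
    positive.\<close>
  define N where "N = Suc (\<Sum>l\<in>UNIV. n l)"
  have "mps_var l ^ N \<in> I" for l
  proof -
    have "n l \<le> N" using member_le_sum[of l UNIV n] by (simp add: N_def)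
    hence "(mps_var l :: ('s, 'k) mps) ^ N = mps_var l ^ (N - n l) * mps_var l ^ n l"
      by (simp flip: power_add)
    thus ?thesis using mult[OF n[of l], of "mps_var l ^ (N - n l)"] by (simp only:)
  qed
  moreover have "mps_pderiv \<nu> f0 \<in> ord_ge 1" for \<nu>
    using f0 ord_ge_pderiv[of f0 1] by (simp add: numeral_2_eq_2)
  ultimately show False
    unfolding I_def using minors_ideal_not_primary[of "\<lambda>\<nu>. mps_pderiv \<nu> f0" N "\<lambda>\<nu>. mps_pderiv \<nu> g0"]
    by (simp add: N_def)
qed

section \<open>Coordinate changes and the two determinacy criteria\<close>

subsection \<open>Substitution homomorphisms\<close>

locale mps_endomorphism =
  fixes \<psi> :: "('s::finite, 'k::field) mps \<Rightarrow> ('s, 'k) mps"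
  assumes add: "\<psi> (f + g) = \<psi> f + \<psi> g"
    and mult: "\<psi> (f * g) = \<psi> f * \<psi> g"
    and const: "\<psi> (mps_const c) = mps_const c"
    and var: "\<psi> (mps_var i) \<in> ord_ge 1"
begin

lemma zero: "\<psi> 0 = 0" using add[of 0 0] by simp
lemma diff: "\<psi> (f - g) = \<psi> f - \<psi> g" using add[of "f - g" g] by simp
lemma sum: "\<psi> (sum f S) = (\<Sum>i\<in>S. \<psi> (f i))"
  by (induction S rule: infinite_finite_induct) (auto simp: zero add)

lemma ord_ge: "f \<in> ord_ge n \<Longrightarrow> \<psi> f \<in> ord_ge n"
proof (induction n arbitrary: f)
  case (Suc n)
  obtain h where h: "f = mps_const (mps_nth f 0) + (\<Sum>i\<in>UNIV. mps_var i * h i)"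
    "\<And>n i. f \<in> ord_ge (Suc n) \<Longrightarrow> h i \<in> ord_ge n"
    using mps_decompose[of f] by blast
  have "mps_nth f 0 = 0" using Suc.prems by (simp add: ord_ge_def)
  hence "f = (\<Sum>i\<in>UNIV. mps_var i * h i)" using h(1) by simp
  hence "\<psi> f = (\<Sum>i\<in>UNIV. \<psi> (mps_var i) * \<psi> (h i))"
    by (metis (no_types, lifting) sum mult sum.cong)
  also have "\<dots> \<in> ord_ge (Suc n)"
    using ord_ge_mult[OF var Suc.IH[OF h(2)[OF Suc.prems]]] by (intro ord_ge_sum) simp
  finally show ?case .
qed simp

end

lemma mps_endomorphism_comp:
  assumes "mps_endomorphism \<phi>" "mps_endomorphism \<psi>"
  shows "mps_endomorphism (\<phi> \<circ> \<psi>)"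
proof -
  interpret \<phi>: mps_endomorphism \<phi> by fact
  interpret \<psi>: mps_endomorphism \<psi> by fact
  show ?thesis
    by unfold_locales
       (simp_all add: \<phi>.add \<psi>.add \<phi>.mult \<psi>.mult \<phi>.const \<psi>.const \<phi>.ord_ge[OF \<psi>.var] del: One_nat_def)
qed

lemma mps_endomorphism_eqI:
  assumes "mps_endomorphism \<phi>" "mps_endomorphism \<psi>" "\<And>i. \<phi> (mps_var i) = \<psi> (mps_var i)"
  shows "\<phi> = \<psi>"
proof
  fix f
  interpret \<phi>: mps_endomorphism \<phi> by fact
  interpret \<psi>: mps_endomorphism \<psi> by fact
  have "\<phi> f - \<psi> f \<in> ord_ge n" for n
  proof (induction n arbitrary: f)
    case (Suc n)
    obtain h where h: "f = mps_const (mps_nth f 0) + (\<Sum>i\<in>UNIV. mps_var i * h i)"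
      using mps_decompose[of f] by blast
    have "\<phi> f - \<psi> f = (\<Sum>i\<in>UNIV. \<phi> (mps_var i) * (\<phi> (h i) - \<psi> (h i)))"
      by (subst (1 2) h)
         (simp add: \<phi>.add \<psi>.add \<phi>.const \<psi>.const \<phi>.sum \<psi>.sum \<phi>.mult \<psi>.mult assms(3)
           right_diff_distrib sum_subtractf)
    also have "\<dots> \<in> ord_ge (Suc n)"
      using ord_ge_mult[OF \<phi>.var Suc] by (intro ord_ge_sum) simp
    finally show ?case .
  qed simp
  hence "\<phi> f - \<psi> f = 0" by (rule ord_ge_all_imp_0)
  thus "\<phi> f = \<psi> f" by simp
qed

lemma mps_endomorphism_id: "mps_endomorphism id"
  by unfold_locales auto

definition power_product :: "('s::finite \<Rightarrow> 'r::comm_ring_1) \<Rightarrow> ('s \<Rightarrow>\<^sub>0 nat) \<Rightarrow> 'r" where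
  "power_product a \<alpha> = (\<Prod>i\<in>UNIV. a i ^ Poly_Mapping.lookup \<alpha> i)"

lemma power_product_add_single:
  "power_product a (\<alpha> + Poly_Mapping.single i 1) = a i * power_product a \<alpha>"
proof -
  have "power_product a (\<alpha> + Poly_Mapping.single i 1) =
      (\<Prod>j\<in>UNIV. a j ^ Poly_Mapping.lookup \<alpha> j * (if j = i then a i else 1))"
    unfolding power_product_def
    by (rule prod.cong) (auto simp: lookup_add lookup_single power_add)
  also have "\<dots> = power_product a \<alpha> * a i"
    by (simp add: prod.distrib power_product_def)
  finally show ?thesis by (simp add: mult.commute)
qed

lemma power_product_ord_ge:
  fixes a :: "'s::finite \<Rightarrow> ('s, 'a::comm_ring_1) mps"
  assumes "\<And>i. a i \<in> ord_ge 1"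
  shows "power_product a \<alpha> \<in> ord_ge (mono_degree \<alpha>)"
proof -
  have "(\<Prod>i\<in>S. a i ^ Poly_Mapping.lookup \<alpha> i) \<in> ord_ge (\<Sum>i\<in>S. Poly_Mapping.lookup \<alpha> i)" for S
    using ord_ge_power[OF assms]
    by (induction S rule: infinite_finite_induct) (auto intro: ord_ge_mult)
  thus ?thesis by (simp add: power_product_def mono_degree_def)
qed

text \<open>The image of \<open>h\<close> is the limit of the substitutions into its truncations,
  which converge because each \<open>a i\<close> has positive order.\<close>

lemma ex_mps_endomorphism:
  fixes a :: "'s::finite \<Rightarrow> ('s, 'k::field) mps"
  assumes a: "\<And>i. a i \<in> ord_ge 1"
  obtains \<psi> where "mps_endomorphism \<psi>" "\<And>i. \<psi> (mps_var i) = a i"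
proof -
  define pol where "pol n h = (\<Sum>\<alpha> | mono_degree \<alpha> \<le> n. mps_const (mps_nth h \<alpha>) * power_product a \<alpha>)"
    for n h
  have "\<forall>h. \<exists>l. \<forall>n. l - pol n h \<in> ord_ge (Suc n)"
  proof
    fix h
    have "pol (Suc n) h - pol n h \<in> ord_ge (Suc n)" for n
    proof -
      have "{\<alpha> :: 's \<Rightarrow>\<^sub>0 nat. mono_degree \<alpha> \<le> Suc n} =
          {\<alpha>. mono_degree \<alpha> \<le> n} \<union> {\<alpha>. mono_degree \<alpha> = Suc n}" by auto
      moreover have "finite {\<alpha> :: 's \<Rightarrow>\<^sub>0 nat. mono_degree \<alpha> = Suc n}"
        by (rule finite_subset[OF _ finite_mono_degree_le[of "Suc n"]]) auto
      ultimately have "pol (Suc n) h = pol n h +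
          (\<Sum>\<alpha> | mono_degree \<alpha> = Suc n. mps_const (mps_nth h \<alpha>) * power_product a \<alpha>)"
        unfolding pol_def using finite_mono_degree_le[of n]
        by (simp only:) (subst sum.union_disjoint, auto)
      moreover have "(\<Sum>\<alpha> | mono_degree \<alpha> = Suc n. mps_const (mps_nth h \<alpha>) * power_product a \<alpha>)
          \<in> ord_ge (Suc n)"
      proof (rule ord_ge_sum)
        fix \<alpha> :: "'s \<Rightarrow>\<^sub>0 nat" assume "\<alpha> \<in> {\<alpha>. mono_degree \<alpha> = Suc n}"
        thus "mps_const (mps_nth h \<alpha>) * power_product a \<alpha> \<in> ord_ge (Suc n)"
          using ord_ge_mult_left[OF power_product_ord_ge[of a \<alpha>, OF a]] by simp
      qed
      ultimately show ?thesis by simp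
    qed
    from mps_limit[of "\<lambda>n. pol n h", OF this]
    show "\<exists>l. \<forall>n. l - pol n h \<in> ord_ge (Suc n)" by metis
  qed
  then obtain \<psi> where \<psi>: "\<And>h n. \<psi> h - pol n h \<in> ord_ge (Suc n)" by metis
  have \<psi>_add: "\<psi> (f + g) = \<psi> f + \<psi> g" for f g
  proof -
    have "\<psi> (f + g) - (\<psi> f + \<psi> g) \<in> ord_ge n" for n
    proof -
      have "pol n (f + g) = pol n f + pol n g"
        by (simp add: pol_def mps_const_add distrib_right sum.distrib)
      hence "\<psi> (f + g) - (\<psi> f + \<psi> g) =
          (\<psi> (f + g) - pol n (f + g)) - (\<psi> f - pol n f) - (\<psi> g - pol n g)" by simp
      also have "\<dots> \<in> ord_ge (Suc n)" by (intro ord_ge_diff \<psi>)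
      finally show ?thesis by (rule ord_ge_mono[rotated]) simp
    qed
    hence "\<psi> (f + g) - (\<psi> f + \<psi> g) = 0" by (rule ord_ge_all_imp_0)
    thus ?thesis by simp
  qed
  have \<psi>_const: "\<psi> (mps_const c) = mps_const c" for c
  proof -
    have "pol n (mps_const c) = mps_const c" for n
    proof -
      have "pol n (mps_const c) =
          (\<Sum>\<alpha> | mono_degree \<alpha> \<le> n. if \<alpha> = (0 :: 's \<Rightarrow>\<^sub>0 nat) then mps_const c * power_product a 0 else 0)"
        unfolding pol_def by (rule sum.cong) (auto simp: mps_nth_const)
      thus ?thesis by (simp add: sum.delta[OF finite_mono_degree_le] power_product_def)
    qed
    hence "\<psi> (mps_const c) - mps_const c \<in> ord_ge n" for n
      using \<psi>[of "mps_const c" n] by (auto intro: ord_ge_mono[of n "Suc n"])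
    hence "\<psi> (mps_const c) - mps_const c = 0" by (rule ord_ge_all_imp_0)
    thus ?thesis by simp
  qed
  have \<psi>_var: "\<psi> (mps_var i * h) = a i * \<psi> h" for i h
  proof -
    \<comment> \<open>Multiplication by a variable shifts the truncation degree by one, and
      monomials free of \<open>x_i\<close> have coefficient 0, so this holds exactly.\<close>
    have pol: "pol (Suc n) (mps_var i * h) = a i * pol n h" for n
    proof -
      let ?F = "\<lambda>\<alpha>. mps_const (mps_nth (mps_var i * h) \<alpha>) * power_product a \<alpha>"
      have "pol (Suc n) (mps_var i * h) =
          (\<Sum>\<alpha>\<in>(\<lambda>\<beta>. \<beta> + Poly_Mapping.single i 1) ` {\<beta>. mono_degree \<beta> \<le> n}. ?F \<alpha>)"
        unfolding pol_def
      proof (rule sum.mono_neutral_right[OF finite_mono_degree_le])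
        show "\<forall>\<alpha>\<in>{\<alpha>. mono_degree \<alpha> \<le> Suc n} -
            (\<lambda>\<beta>. \<beta> + Poly_Mapping.single i 1) ` {\<beta>. mono_degree \<beta> \<le> n}. ?F \<alpha> = 0"
        proof
          fix \<alpha> assume \<alpha>: "\<alpha> \<in> {\<alpha>. mono_degree \<alpha> \<le> Suc n} -
            (\<lambda>\<beta>. \<beta> + Poly_Mapping.single i 1) ` {\<beta>. mono_degree \<beta> \<le> n}"
          have "Poly_Mapping.lookup \<alpha> i = 0"
          proof (rule ccontr)
            assume "Poly_Mapping.lookup \<alpha> i \<noteq> 0"
            then obtain \<beta> where \<beta>: "\<alpha> = \<beta> + Poly_Mapping.single i 1"
              using single_add_cases[of 1 \<alpha> i] by auto
            hence "mono_degree \<beta> \<le> n" using \<alpha> by (simp add: mono_degree_add)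
            thus False using \<alpha> \<beta> by blast
          qed
          thus "?F \<alpha> = 0" by (simp add: mps_nth_var_mult_eq_0)
        qed
      qed (auto simp: mono_degree_add)
      also have "\<dots> = (\<Sum>\<beta> | mono_degree \<beta> \<le> n. ?F (\<beta> + Poly_Mapping.single i 1))"
        by (subst sum.reindex) (auto simp: inj_on_def)
      also have "\<dots> = a i * pol n h"
        unfolding pol_def sum_distrib_left mps_nth_var_mult power_product_add_single
        by (simp add: mult.left_commute)
      finally show ?thesis .
    qed
    have "\<psi> (mps_var i * h) - a i * \<psi> h \<in> ord_ge n" for n
    proof -
      have "\<psi> (mps_var i * h) - a i * \<psi> h =
          (\<psi> (mps_var i * h) - pol (Suc n) (mps_var i * h)) - a i * (\<psi> h - pol n h)"
        unfolding pol by (simp add: algebra_simps)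
      also have "\<dots> \<in> ord_ge n"
        by (rule ord_ge_diff[OF ord_ge_mono[OF _ \<psi>] ord_ge_mult_left[OF ord_ge_mono[OF _ \<psi>]]]) auto
      finally show ?thesis .
    qed
    hence "\<psi> (mps_var i * h) - a i * \<psi> h = 0" by (rule ord_ge_all_imp_0)
    thus ?thesis by simp
  qed
  have \<psi>_zero: "\<psi> 0 = 0" using \<psi>_const[of 0] by simp
  have \<psi>_sum: "\<psi> (sum f S) = (\<Sum>i\<in>S. \<psi> (f i))" for f :: "'s \<Rightarrow> _" and S
    by (induction S rule: infinite_finite_induct) (auto simp: \<psi>_zero \<psi>_add)
  have \<psi>_const_mult: "\<psi> (mps_const c * g) = mps_const c * \<psi> g" for c g
  proof -
    have "\<psi> (mps_const c * g) - mps_const c * \<psi> g \<in> ord_ge n" for n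
    proof -
      have "pol n (mps_const c * g) = mps_const c * pol n g"
        by (simp add: pol_def mps_const_mult sum_distrib_left mult.assoc)
      hence "\<psi> (mps_const c * g) - mps_const c * \<psi> g =
          (\<psi> (mps_const c * g) - pol n (mps_const c * g)) - mps_const c * (\<psi> g - pol n g)"
        by (simp add: algebra_simps)
      also have "\<dots> \<in> ord_ge (Suc n)" by (intro ord_ge_diff ord_ge_mult_left \<psi>)
      finally show ?thesis by (rule ord_ge_mono[rotated]) simp
    qed
    hence "\<psi> (mps_const c * g) - mps_const c * \<psi> g = 0" by (rule ord_ge_all_imp_0)
    thus ?thesis by simp
  qed
  \<comment> \<open>Truncation is not multiplicative; the product rule instead follows from
    linearity and the behaviour on variables, by raising the order of the defect.\<close>
  have \<psi>_mult: "\<psi> (f * g) = \<psi> f * \<psi> g" for f g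
  proof -
    have "\<psi> (f * g) - \<psi> f * \<psi> g \<in> ord_ge n" for n f
    proof (induction n arbitrary: f)
      case (Suc n)
      obtain h where h: "f = mps_const (mps_nth f 0) + (\<Sum>i\<in>UNIV. mps_var i * h i)"
        using mps_decompose[of f] by blast
      define c where "c = mps_nth f 0"
      have f: "f = mps_const c + (\<Sum>i\<in>UNIV. mps_var i * h i)"
        using h by (simp add: c_def)
      have fg: "f * g = mps_const c * g + (\<Sum>i\<in>UNIV. mps_var i * (h i * g))"
        by (simp only: f distrib_right sum_distrib_right mult.assoc)
      have "\<psi> (f * g) - \<psi> f * \<psi> g =
          (\<Sum>i\<in>UNIV. a i * \<psi> (h i * g)) - (\<Sum>i\<in>UNIV. a i * \<psi> (h i)) * \<psi> g"
        unfolding fg unfolding f \<psi>_add \<psi>_const \<psi>_const_mult \<psi>_sum \<psi>_var by (simp add: algebra_simps)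
      also have "\<dots> = (\<Sum>i\<in>UNIV. a i * (\<psi> (h i * g) - \<psi> (h i) * \<psi> g))"
        by (simp add: sum_distrib_right right_diff_distrib sum_subtractf mult.assoc)
      also have "\<dots> \<in> ord_ge (Suc n)"
        using ord_ge_mult[OF a Suc] by (intro ord_ge_sum) simp
      finally show ?case .
    qed simp
    hence "\<psi> (f * g) - \<psi> f * \<psi> g = 0" by (rule ord_ge_all_imp_0)
    thus ?thesis by simp
  qed
  have var: "\<psi> (mps_var i) = a i" for i
    using \<psi>_var[of i 1] \<psi>_const[of 1] by simp
  have "mps_endomorphism \<psi>"
    by unfold_locales (simp_all add: \<psi>_add \<psi>_mult \<psi>_const var a del: One_nat_def)
  thus ?thesis using var by (rule that)
qed

text \<open>\<open>\<theta>\<close> differs from the identity by a map that raises the order. Thus a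
  kernel element has every order, and preimages arise by successive approximation.\<close>

lemma mps_endomorphism_bij_unipotent:
  assumes "mps_endomorphism \<theta>" and \<theta>: "\<And>i. \<theta> (mps_var i) - mps_var i \<in> ord_ge 2"
  shows "bij \<theta>"
proof -
  interpret mps_endomorphism \<theta> by fact
  have raise: "\<theta> f - f \<in> ord_ge (Suc n)" if f: "f \<in> ord_ge n" for f n
    using f
  proof (induction n arbitrary: f)
    case 0
    have *: "mps_nth (\<theta> f) 0 = mps_nth f 0" for f
    proof -
      have "f - mps_const (mps_nth f 0) \<in> ord_ge 1"
        by (auto simp: ord_ge_def mono_degree_eq_0_iff mps_nth_const)
      hence "\<theta> (f - mps_const (mps_nth f 0)) \<in> ord_ge 1" by (rule ord_ge)
      thus ?thesis by (auto simp: diff const ord_ge_def mps_nth_const dest: spec[of _ 0])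
    qed
    show ?case by (auto simp: ord_ge_def mono_degree_eq_0_iff *)
  next
    case (Suc n)
    obtain h where h: "f = mps_const (mps_nth f 0) + (\<Sum>i\<in>UNIV. mps_var i * h i)"
      "\<And>n i. f \<in> ord_ge (Suc n) \<Longrightarrow> h i \<in> ord_ge n"
      using mps_decompose[of f] by blast
    have "mps_nth f 0 = 0" using Suc.prems by (simp add: ord_ge_def)
    hence f: "f = (\<Sum>i\<in>UNIV. mps_var i * h i)" using h(1) by simp
    have hn: "h i \<in> ord_ge n" for i by (rule h(2)[OF Suc.prems])
    have "\<theta> f - f = (\<Sum>i\<in>UNIV. \<theta> (mps_var i) * (\<theta> (h i) - h i) + (\<theta> (mps_var i) - mps_var i) * h i)"
      by (subst (1 2) f) (simp add: sum mult algebra_simps flip: sum_subtractf)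
    also have "\<dots> \<in> ord_ge (Suc (Suc n))"
      using ord_ge_mult[OF var Suc.IH[OF hn]] ord_ge_mult[OF \<theta> hn]
      by (intro ord_ge_sum ord_ge_add) auto
    finally show ?case .
  qed
  have inj: "inj \<theta>"
  proof (rule injI)
    fix f g assume "\<theta> f = \<theta> g"
    hence "\<theta> (f - g) = 0" by (simp add: diff)
    moreover have "f - g \<in> ord_ge n" for n
    proof (induction n)
      case (Suc n)
      from ord_ge_uminus[OF raise[OF this]] \<open>\<theta> (f - g) = 0\<close> show ?case by simp
    qed simp
    hence "f - g = 0" by (rule ord_ge_all_imp_0)
    thus "f = g" by simp
  qed
  have "\<exists>f. \<theta> f = g" for g
  proof -
    \<comment> \<open>Adding the remaining error to the argument replaces it by an error of higher
      order.\<close>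
    define r where "r = rec_nat g (\<lambda>_ r. r + (g - \<theta> r))"
    have r: "r 0 = g" "r (Suc n) = r n + (g - \<theta> (r n))" for n by (simp_all add: r_def)
    have \<delta>: "g - \<theta> (r n) \<in> ord_ge (Suc n)" for n
    proof (induction n)
      case 0
      show ?case using ord_ge_uminus[OF raise[of g 0]] by (simp add: r)
    next
      case (Suc n)
      have "g - \<theta> (r (Suc n)) = - (\<theta> (g - \<theta> (r n)) - (g - \<theta> (r n)))"
        by (simp add: r add)
      also have "\<dots> \<in> ord_ge (Suc (Suc n))" by (rule ord_ge_uminus[OF raise[OF Suc]])
      finally show ?case .
    qed
    obtain l where l: "\<And>n. l - r n \<in> ord_ge (Suc n)"
      using mps_limit[of r] \<delta> by (auto simp: r)
    have "\<theta> l - g \<in> ord_ge n" for n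
    proof -
      have "\<theta> l - g = \<theta> (l - r n) - (g - \<theta> (r n))" by (simp add: diff)
      also have "\<dots> \<in> ord_ge (Suc n)" by (intro ord_ge_diff ord_ge l \<delta>)
      finally show ?thesis by (rule ord_ge_mono[rotated]) simp
    qed
    hence "\<theta> l - g = 0" by (rule ord_ge_all_imp_0)
    thus ?thesis by auto
  qed
  hence "surj \<theta>" by (metis surjI)
  with inj show ?thesis by (simp add: bij_def)
qed

subsection \<open>Linear parts and the inverse function theorem\<close>

text \<open>For a series without constant term, the coordinates of its class modulo the square of
  the maximal ideal.\<close>

definition linear_part :: "('s::finite, 'k::field) mps \<Rightarrow> 'k ^ 's" where
  "linear_part f = (\<chi> j. mps_nth f (Poly_Mapping.single j 1))"

lemma mono_degree_1_cases:
  assumes "mono_degree \<alpha> = 1" obtains i where "\<alpha> = Poly_Mapping.single i 1"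
proof -
  have "\<alpha> \<noteq> 0" using assms by auto
  then obtain i where "Poly_Mapping.lookup \<alpha> i \<noteq> 0"
    by (metis lookup_zero poly_mapping_eqI)
  then obtain \<beta> where \<beta>: "\<alpha> = \<beta> + Poly_Mapping.single i 1"
    using single_add_cases[of 1 \<alpha> i] by auto
  hence "mono_degree \<beta> = 0" using assms by (simp add: mono_degree_add)
  hence "\<beta> = 0" by (simp only: mono_degree_eq_0_iff)
  thus ?thesis using \<beta> that by simp
qed

lemma ord_ge_2_iff:
  assumes "f \<in> ord_ge 1"
  shows "f \<in> ord_ge 2 \<longleftrightarrow> linear_part f = 0"
proof
  assume "linear_part f = 0"
  show "f \<in> ord_ge 2"
    unfolding ord_ge_def
  proof (intro CollectI allI impI)
    fix \<alpha> :: "'a \<Rightarrow>\<^sub>0 nat" assume "mono_degree \<alpha> < 2"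
    then consider "mono_degree \<alpha> = 0" | "mono_degree \<alpha> = 1" by linarith
    thus "mps_nth f \<alpha> = 0"
    proof cases
      case 2
      then obtain i where "\<alpha> = Poly_Mapping.single i 1" by (rule mono_degree_1_cases)
      thus ?thesis using \<open>linear_part f = 0\<close> by (simp add: linear_part_def vec_eq_iff)
    qed (use assms in \<open>auto simp: ord_ge_def\<close>)
  qed
qed (auto simp: ord_ge_def linear_part_def vec_eq_iff)

lemma linear_part_add: "linear_part (f + g) = linear_part f + linear_part g"
  by (simp add: linear_part_def vec_eq_iff)
lemma linear_part_diff: "linear_part (f - g) = linear_part f - linear_part g"
  by (simp add: linear_part_def vec_eq_iff)
lemma linear_part_const_mult: "linear_part (mps_const c * f) = c *s linear_part f"
  by (simp add: linear_part_def vec_eq_iff)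
lemma linear_part_sum: "linear_part (sum f S) = (\<Sum>i\<in>S. linear_part (f i))"
proof (induction S rule: infinite_finite_induct)
  case (insert x F)
  thus ?case by (simp add: linear_part_add)
qed (auto simp: linear_part_def vec_eq_iff)
lemma linear_part_var: "linear_part (mps_var i) = axis i 1"
proof -
  have "Poly_Mapping.single j (1 :: nat) = Poly_Mapping.single i 1 \<longleftrightarrow> j = i" for j
    by (metis lookup_single_eq lookup_single_not_eq one_neq_zero)
  thus ?thesis by (simp add: linear_part_def vec_eq_iff axis_def mps_var.rep_eq del: One_nat_def)
qed

definition linear_form :: "'k::field ^ 's::finite \<Rightarrow> ('s, 'k) mps" where
  "linear_form v = (\<Sum>j\<in>UNIV. mps_const (v $ j) * mps_var j)"

lemma linear_form_ord_ge: "linear_form v \<in> ord_ge 1"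
  unfolding linear_form_def by (intro ord_ge_sum ord_ge_mult_left mps_var_ord_ge)

lemma linear_part_linear_form: "linear_part (linear_form v) = v"
  by (simp add: linear_form_def linear_part_sum linear_part_const_mult linear_part_var
      vec_eq_iff axis_def if_distrib cong: if_cong)

lemma linear_form_axis: "linear_form (axis i 1) = mps_var i"
proof -
  have "linear_form (axis i 1) = (\<Sum>j\<in>UNIV. if j = i then mps_var i else 0)"
    unfolding linear_form_def by (rule sum.cong) (auto simp: axis_def)
  thus ?thesis by simp
qed

lemma (in mps_endomorphism) linear_form:
  "\<psi> (linear_form v) = (\<Sum>j\<in>UNIV. mps_const (v $ j) * \<psi> (mps_var j))"
  by (simp add: linear_form_def sum mult const)

text \<open>The formal inverse function theorem. Composing the substitution with the linear
  substitution of the inverse matrix \<open>M\<close> makes it unipotent, hence bijective;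
  \<open>\<kappa>\<close> then undoes the linear factor.\<close>

lemma ex_automorphism:
  fixes a :: "'s::finite \<Rightarrow> ('s, 'k::field) mps"
  assumes a: "\<And>i. a i \<in> ord_ge 1" and inv: "vec.span (range (\<lambda>i. linear_part (a i))) = UNIV"
  obtains \<psi> where "\<psi> \<in> mps_automorphisms" "\<And>i. \<psi> (mps_var i) = a i"
proof -
  define L :: "'k ^ 's ^ 's" where "L = (\<chi> i. linear_part (a i))"
  have "rows L = range (\<lambda>i. linear_part (a i))"
    by (auto simp: rows_def row_def L_def)
  with inv obtain M where M: "M ** L = mat 1"
    using matrix_left_invertible_span_rows_gen[of L] by auto
  hence M': "L ** M = mat 1" using matrix_left_right_inverse by blast
  obtain \<psi> where \<psi>: "mps_endomorphism \<psi>" "\<And>i. \<psi> (mps_var i) = a i"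
    using ex_mps_endomorphism[of a] a by blast
  obtain \<mu> where \<mu>: "mps_endomorphism \<mu>" "\<And>i. \<mu> (mps_var i) = linear_form (M $ i)"
    using ex_mps_endomorphism[of "\<lambda>i. linear_form (M $ i)"] linear_form_ord_ge by blast
  obtain \<kappa> where \<kappa>: "mps_endomorphism \<kappa>" "\<And>i. \<kappa> (mps_var i) = linear_form (L $ i)"
    using ex_mps_endomorphism[of "\<lambda>i. linear_form (L $ i)"] linear_form_ord_ge by blast
  interpret \<psi>: mps_endomorphism \<psi> by fact
  interpret \<mu>: mps_endomorphism \<mu> by fact
  interpret \<kappa>: mps_endomorphism \<kappa> by fact
  have lin: "(\<Sum>j\<in>UNIV. mps_const (v $ j) * linear_form (N $ j)) = linear_form (v v* N)" for v and N :: "'k ^ 's ^ 's"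
  proof -
    have "(\<Sum>j\<in>UNIV. mps_const (v $ j) * linear_form (N $ j)) =
        (\<Sum>j\<in>UNIV. \<Sum>k\<in>UNIV. mps_const (v $ j * N $ j $ k) * mps_var k)"
      by (simp add: linear_form_def sum_distrib_left mps_const_mult mult.assoc)
    also have "\<dots> = (\<Sum>k\<in>UNIV. \<Sum>j\<in>UNIV. mps_const (v $ j * N $ j $ k) * mps_var k)"
      by (rule sum.swap)
    also have "\<dots> = linear_form (v v* N)"
    proof -
      have "mps_const (sum f S) = (\<Sum>i\<in>S. mps_const (f i) :: ('s, 'k) mps)" for f and S :: "'s set"
        by (induction S rule: infinite_finite_induct) (auto simp: mps_const_add)
      moreover have "(v v* N) $ k = (\<Sum>j\<in>UNIV. v $ j * N $ j $ k)" for k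
        by (simp add: vector_matrix_mult_def mult.commute)
      ultimately show ?thesis by (simp add: linear_form_def sum_distrib_right)
    qed
    finally show ?thesis .
  qed
  have rowmult: "L $ i v* N = (L ** N) $ i" for L N :: "'k ^ 's ^ 's" and i
    by (simp add: vec_eq_iff vector_matrix_mult_def matrix_matrix_mult_def mult.commute)
  have mat_row: "(mat 1 :: 'k ^ 's ^ 's) $ i = axis i 1" for i
    by (auto simp: mat_def axis_def vec_eq_iff)
  have "\<kappa> \<circ> \<mu> = id"
    by (rule mps_endomorphism_eqI[OF mps_endomorphism_comp[OF \<kappa>(1) \<mu>(1)] mps_endomorphism_id])
       (simp add: \<mu>(2) \<kappa>.linear_form \<kappa>(2) lin rowmult M mat_row linear_form_axis)
  moreover have "\<mu> \<circ> \<kappa> = id"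
    by (rule mps_endomorphism_eqI[OF mps_endomorphism_comp[OF \<mu>(1) \<kappa>(1)] mps_endomorphism_id])
       (simp add: \<mu>(2) \<mu>.linear_form \<kappa>(2) lin rowmult M' mat_row linear_form_axis)
  ultimately have bij_\<kappa>: "bij \<kappa>" using o_bij by blast
  have "bij (\<psi> \<circ> \<mu>)"
  proof (rule mps_endomorphism_bij_unipotent[OF mps_endomorphism_comp[OF \<psi>(1) \<mu>(1)]])
    fix i
    have eq: "(\<psi> \<circ> \<mu>) (mps_var i) = (\<Sum>j\<in>UNIV. mps_const (M $ i $ j) * a j)"
      by (simp add: \<mu>(2) \<psi>.linear_form \<psi>(2))
    have "linear_part (\<Sum>j\<in>UNIV. mps_const (M $ i $ j) * a j) = (M ** L) $ i"
      by (simp add: linear_part_sum linear_part_const_mult L_def vec_eq_iff matrix_matrix_mult_def)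
    hence "linear_part ((\<psi> \<circ> \<mu>) (mps_var i) - mps_var i) = 0"
      unfolding eq by (simp add: linear_part_diff M mat_row linear_part_var)
    moreover have "(\<psi> \<circ> \<mu>) (mps_var i) - mps_var i \<in> ord_ge 1"
      unfolding eq by (intro ord_ge_diff ord_ge_sum ord_ge_mult_left a mps_var_ord_ge)
    ultimately show "(\<psi> \<circ> \<mu>) (mps_var i) - mps_var i \<in> ord_ge 2"
      using ord_ge_2_iff by blast
  qed
  hence "bij ((\<psi> \<circ> \<mu>) \<circ> \<kappa>)" using bij_\<kappa> bij_comp by blast
  also have "(\<psi> \<circ> \<mu>) \<circ> \<kappa> = \<psi>" using \<open>\<mu> \<circ> \<kappa> = id\<close> by (simp add: comp_assoc)
  finally have "\<psi> \<in> mps_automorphisms"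
    by (simp add: mps_automorphisms_def \<psi>.add \<psi>.mult \<psi>.const)
  thus ?thesis using \<psi>(2) by (rule that)
qed

subsection \<open>Independent linear parts\<close>

lemma quotient_class_eq_iff:
  assumes "0 \<in> T" "\<And>a b. a \<in> T \<Longrightarrow> b \<in> T \<Longrightarrow> a + b \<in> T" "\<And>a. a \<in> T \<Longrightarrow> - a \<in> T"
  shows "quotient_class T v = quotient_class T w \<longleftrightarrow> v - w \<in> T"
proof
  assume "quotient_class T v = quotient_class T w"
  moreover have "v \<in> quotient_class T v" using assms(1) by (simp add: quotient_class_def)
  ultimately show "v - w \<in> T" by (simp add: quotient_class_def)
next
  assume vw: "v - w \<in> T"
  have "x - v \<in> T \<longleftrightarrow> x - w \<in> T" for x
    using assms(2)[OF _ vw, of "x - v"] assms(2)[OF _ assms(3)[OF vw], of "x - w"] by auto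
  thus "quotient_class T v = quotient_class T w" by (simp add: quotient_class_def)
qed

lemma independent_mod_iff:
  fixes a :: "'m::finite \<Rightarrow> ('s::finite, 'k::field) mps"
  assumes "\<And>i. a i \<in> ord_ge 1"
  shows "independent_mod (\<lambda>c f. mps_const c * f) (ideal_power max_ideal 2) a \<longleftrightarrow>
    (\<forall>c. (\<Sum>i\<in>UNIV. c i *s linear_part (a i)) = 0 \<longrightarrow> (\<forall>i. c i = 0))"
proof -
  have "quotient_class (ord_ge 2) (\<Sum>i\<in>UNIV. mps_const (c i) * a i) = quotient_class (ord_ge 2) 0 \<longleftrightarrow>
      (\<Sum>i\<in>UNIV. c i *s linear_part (a i)) = 0" for c
  proof -
    have "quotient_class (ord_ge 2) (\<Sum>i\<in>UNIV. mps_const (c i) * a i) = quotient_class (ord_ge 2) 0 \<longleftrightarrow>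
        (\<Sum>i\<in>UNIV. mps_const (c i) * a i) \<in> ord_ge 2"
      by (subst quotient_class_eq_iff) (auto intro: ord_ge_add ord_ge_uminus)
    also have "\<dots> \<longleftrightarrow> (\<Sum>i\<in>UNIV. c i *s linear_part (a i)) = 0"
      by (subst ord_ge_2_iff) (auto intro!: ord_ge_sum ord_ge_mult_left assms
          simp: linear_part_sum linear_part_const_mult simp del: One_nat_def)
    finally show ?thesis .
  qed
  thus ?thesis by (simp add: independent_mod_def ideal_power_max_ideal)
qed

lemma independent_imp_card_le:
  fixes v :: "'m::finite \<Rightarrow> 'k::field ^ 's::finite"
  assumes "\<forall>c. (\<Sum>i\<in>UNIV. c i *s v i) = 0 \<longrightarrow> (\<forall>i. c i = 0)"
  shows "CARD('m) \<le> CARD('s)"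
proof (rule ccontr)
  assume "\<not> ?thesis"
  hence "card (UNIV :: 's set) < card (UNIV :: 'm set)" by simp
  from ex_nontrivial_solution[OF finite finite this, of "\<lambda>i j. v i $ j"]
  obtain c i where "c i \<noteq> 0" "\<And>j. (\<Sum>i\<in>UNIV. c i * v i $ j) = 0" by blast
  thus False using assms by (auto simp: vec_eq_iff)
qed

text \<open>A completed basis has as many elements as there are variables and can be indexed by
  them; \<open>\<iota>\<close> records which variable each given vector is assigned to.\<close>

lemma independent_family_extend:
  fixes v :: "'m::finite \<Rightarrow> 'k::field ^ 's::finite"
  assumes v: "\<forall>c. (\<Sum>i\<in>UNIV. c i *s v i) = 0 \<longrightarrow> (\<forall>i. c i = 0)"
  shows "\<exists>(h :: 's \<Rightarrow> 'k ^ 's) (\<iota> :: 'm \<Rightarrow> 's).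
    inj \<iota> \<and> (\<forall>i. h (\<iota> i) = v i) \<and> vec.span (range h) = UNIV"
proof -
  \<comment> \<open>\<open>vec.independent\<close> speaks about the set \<open>range v\<close>, so
    repetitions in the family must be excluded separately.\<close>
  have inj: "inj v"
  proof (rule injI, rule ccontr)
    fix i j assume ij: "v i = v j" "i \<noteq> j"
    define c where "c l = (if l = i then 1 else if l = j then - 1 else 0 :: 'k)" for l
    have "(\<Sum>l\<in>UNIV. c l *s v l) = (\<Sum>l\<in>{i, j}. c l *s v l)"
      by (rule sum.mono_neutral_right) (auto simp: c_def)
    also have "\<dots> = 0" using ij by (simp add: c_def)
    finally have "c i = 0" using v by blast
    thus False by (simp add: c_def)
  qed
  have "vec.independent (range v)"
  proof (rule vec.independent_if_scalars_zero)
    fix f x assume f: "(\<Sum>x\<in>range v. f x *s x) = 0" and x: "x \<in> range v"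
    have "(\<Sum>i\<in>UNIV. f (v i) *s v i) = 0"
      using f by (simp add: sum.reindex[OF inj])
    thus "f x = 0" using v[rule_format, of "\<lambda>i. f (v i)"] x by auto
  qed simp
  then obtain B where B: "range v \<subseteq> B" "vec.independent B" "vec.span B = UNIV"
    using vec.extend_basis_superset vec.independent_extend_basis vec.span_extend_basis by metis
  have "card B = vec.dim (UNIV :: ('k ^ 's) set)"
    by (rule vec.basis_card_eq_dim) (use B in auto)
  hence "card B = CARD('s)"
    by (simp only: vec_dim_card)
  moreover have "finite B" using B(2) by (rule vec.finiteI_independent)
  ultimately obtain h :: "'s \<Rightarrow> 'k ^ 's" where h: "bij_betw h UNIV B"
    using finite_same_card_bij[of "UNIV :: 's set" B] by auto
  define \<iota> where "\<iota> i = inv_into UNIV h (v i)" for i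
  have h\<iota>: "h (\<iota> i) = v i" for i
    using h B(1) unfolding \<iota>_def by (intro f_inv_into_f) (auto simp: bij_betw_def)
  have "inj \<iota>"
    by (rule injI) (metis h\<iota> inj injD)
  moreover have "vec.span (range h) = UNIV" using h B(3) by (simp add: bij_betw_def)
  ultimately show ?thesis using h\<iota> by blast
qed

lemma finitely_right_determined_if_independent:
  fixes A :: "('s::finite, 'k::field) mps ^ 'm::finite"
  assumes A: "\<And>i. A $ i \<in> ord_ge 1"
    and ind: "\<forall>c. (\<Sum>i\<in>UNIV. c i *s linear_part (A $ i)) = 0 \<longrightarrow> (\<forall>i. c i = 0)"
  shows "finitely_right_determined A"
proof -
  obtain h :: "'s \<Rightarrow> 'k ^ 's" and \<iota> :: "'m \<Rightarrow> 's"
    where h: "inj \<iota>" "\<And>i. h (\<iota> i) = linear_part (A $ i)" "vec.span (range h) = UNIV"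
    using independent_family_extend[OF ind] by blast
  have ext: "\<exists>\<psi>\<in>mps_automorphisms. \<forall>i. \<psi> (mps_var (\<iota> i)) = C $ i"
    if C: "\<And>i. C $ i \<in> ord_ge 1" "\<And>i. linear_part (C $ i) = linear_part (A $ i)"
    for C :: "('s, 'k) mps ^ 'm"
  proof -
    \<comment> \<open>The variables outside the range of \<open>\<iota>\<close> receive linear
      forms, chosen to complete the basis.\<close>
    define a where "a j = (if j \<in> range \<iota> then C $ inv_into UNIV \<iota> j else linear_form (h j))" for j
    have a\<iota>: "a (\<iota> i) = C $ i" for i
      unfolding a_def inv_f_f[OF h(1)] by simp
    have "linear_part (a j) = h j" for j
    proof (cases "j \<in> range \<iota>")
      case True
      then obtain i where "j = \<iota> i" by blast
      thus ?thesis by (simp add: a\<iota> C(2) h(2))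
    next
      case False
      thus ?thesis by (simp add: a_def linear_part_linear_form)
    qed
    moreover have "a j \<in> ord_ge 1" for j
      using C(1) linear_form_ord_ge[of "h j"] by (simp add: a_def)
    ultimately obtain \<psi> where \<psi>: "\<psi> \<in> mps_automorphisms" "\<And>j. \<psi> (mps_var j) = a j"
      using ex_automorphism[of a] h(3) by auto
    show ?thesis
      by (rule bexI[OF _ \<psi>(1)]) (simp add: \<psi>(2) a\<iota>)
  qed
  show ?thesis
    unfolding finitely_right_determined_def
  \<comment> \<open>k = 1 suffices: perturbations of order 2 leave all linear parts
    unchanged.\<close>
  proof (intro exI[of _ 1] conjI allI impI)
    fix B assume "B - A \<in> ideal_smult (ideal_power max_ideal (1 + 1)) UNIV"
    hence BA: "B $ i - A $ i \<in> ord_ge 2" for i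
      unfolding ideal_smult_ideal_power by (simp add: numeral_2_eq_2)
    have B: "B $ i \<in> ord_ge 1" for i
      using ord_ge_add[OF A[of i] ord_ge_mono[OF _ BA[of i], of 1]] by simp
    have "linear_part (B $ i - A $ i) = 0" for i
      using BA[of i] by (simp add: ord_ge_2_iff[symmetric] ord_ge_mono[OF _ BA] del: One_nat_def)
    hence "linear_part (B $ i) = linear_part (A $ i)" for i
      by (simp add: linear_part_diff)
    from ext[OF B this] obtain \<beta> where \<beta>: "\<beta> \<in> mps_automorphisms" "\<And>i. \<beta> (mps_var (\<iota> i)) = B $ i"
      by blast
    from ext[OF A refl] obtain \<alpha> where \<alpha>: "\<alpha> \<in> mps_automorphisms" "\<And>i. \<alpha> (mps_var (\<iota> i)) = A $ i"
      by blast
    interpret \<alpha>: mps_automorphism \<alpha> by unfold_locales (rule \<alpha>)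
    have "inv_into UNIV \<alpha> (A $ i) = mps_var (\<iota> i)" for i
      using \<alpha>.bij \<alpha>(2)[of i] by (metis bij_def inv_f_f)
    hence "B = map_col (\<beta> \<circ> inv_into UNIV \<alpha>) A"
      by (simp add: map_col_def vec_eq_iff \<beta>)
    thus "B \<in> right_orbit A"
      unfolding right_orbit_def
      using mps_automorphisms_comp[OF \<beta>(1) \<alpha>.automorphism_inv] by blast
  qed simp
qed

lemma not_finitely_right_determined_if_dependent:
  fixes A :: "('s::finite, 'k::field) mps ^ 'm::finite"
  assumes A: "\<And>i. A $ i \<in> ord_ge 1" and m: "1 < CARD('m)"
    and dep: "\<not> (\<forall>c. (\<Sum>i\<in>UNIV. c i *s linear_part (A $ i)) = 0 \<longrightarrow> (\<forall>i. c i = 0))"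
  shows "\<not> finitely_right_determined A"
proof
  assume "finitely_right_determined A"
  then obtain k where k: "k > 0"
    "\<And>B. B - A \<in> ideal_smult (ideal_power max_ideal (k + 1)) UNIV \<Longrightarrow> B \<in> right_orbit A"
    unfolding finitely_right_determined_def by blast
  obtain c i where c: "(\<Sum>i\<in>UNIV. c i *s linear_part (A $ i)) = 0" "c i \<noteq> 0" using dep by blast
  have "\<exists>j. j \<noteq> i"
  proof (rule ccontr)
    assume "\<not> ?thesis"
    hence "(UNIV :: 'm set) = {i}" by auto
    thus False using m by (metis card_1_singleton_iff less_irrefl One_nat_def)
  qed
  then obtain j where j: "j \<noteq> i" by blast
  define f where "f = (\<Sum>l\<in>UNIV. mps_const (c l) * A $ l)"
  have f1: "f \<in> ord_ge 1" unfolding f_def by (intro ord_ge_sum ord_ge_mult_left A)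
  have "linear_part f = 0"
    using c(1) by (simp add: f_def linear_part_sum linear_part_const_mult)
  hence f: "f \<in> ord_ge 2" using f1 by (simp add: ord_ge_2_iff del: One_nat_def)
  show False
  proof (rule not_determined_pair[OF f A[of j] k(1)])
    fix f' g' assume f': "f' - f \<in> ord_ge (Suc k)" and g': "g' - A $ j \<in> ord_ge (Suc k)"
    \<comment> \<open>Adding \<open>\<delta>\<close> to entry \<open>i\<close> and g' - A $ j to
      entry \<open>j\<close> changes the combination \<open>f\<close> to exactly \<open>f'\<close>;
      this is solvable because \<open>c i\<close> is nonzero.\<close>
    define \<delta> where "\<delta> = mps_const (inverse (c i)) * ((f' - f) - mps_const (c j) * (g' - A $ j))"
    define B where "B = (\<chi> l. A $ l + (if l = i then \<delta> else if l = j then g' - A $ j else 0))"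
    have "\<delta> \<in> ord_ge (Suc k)"
      unfolding \<delta>_def by (intro ord_ge_mult_left ord_ge_diff f' g')
    hence "B - A \<in> ideal_smult (ideal_power max_ideal (k + 1)) UNIV"
      unfolding ideal_smult_ideal_power using g' by (simp add: B_def)
    then obtain \<phi> where \<phi>: "\<phi> \<in> mps_automorphisms" "B = map_col \<phi> A"
      using k(2) unfolding right_orbit_def by blast
    interpret mps_automorphism \<phi> by unfold_locales (rule \<phi>)
    have \<phi>A: "\<phi> (A $ l) = B $ l" for l by (simp add: \<phi>(2) map_col_def)
    have "\<phi> (A $ j) = g'" using j by (simp add: \<phi>A B_def)
    moreover have "\<phi> f = f'"
    proof -
      have ci: "mps_const (c i) * mps_const (inverse (c i)) = (1 :: ('s, 'k) mps)"
        using c(2) by (simp flip: mps_const_mult)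
      have "\<phi> f = (\<Sum>l\<in>UNIV. mps_const (c l) * B $ l)"
        by (simp add: f_def sum mult const \<phi>A)
      also have "\<dots> = (\<Sum>l\<in>UNIV. mps_const (c l) * A $ l + (if l = i then mps_const (c i) * \<delta> else 0) +
          (if l = j then mps_const (c j) * (g' - A $ j) else 0))"
        using j by (intro sum.cong) (auto simp: B_def distrib_left)
      also have "\<dots> = f + mps_const (c i) * \<delta> + mps_const (c j) * (g' - A $ j)"
        by (simp add: sum.distrib f_def)
      also have "mps_const (c i) * \<delta> = (f' - f) - mps_const (c j) * (g' - A $ j)"
        unfolding \<delta>_def mult.assoc[symmetric] ci by simp
      finally show ?thesis by simp
    qed
    ultimately show "\<exists>\<phi>\<in>mps_automorphisms. \<phi> f = f' \<and> \<phi> (A $ j) = g'"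
      using \<phi>(1) by blast
  qed
qed

section \<open>Dimension count and conclusion\<close>

subsection \<open>The codimension of the tangent image\<close>

lemma tangent_imageE:
  fixes A :: "('s::finite, 'k::field) mps ^ 'm::finite"
  assumes "w \<in> tangent_image A"
  obtains r where "w = (\<Sum>\<nu>\<in>UNIV. r \<nu> *s map_col (mps_pderiv \<nu>) A)"
proof -
  interpret Modules.module "(*s) :: ('s, 'k) mps \<Rightarrow> ('s, 'k) mps ^ 'm \<Rightarrow> _" by (rule module_vec)
  define T where "T = {w. \<exists>r. w = (\<Sum>\<nu>\<in>UNIV. r \<nu> *s map_col (mps_pderiv \<nu>) A)}"
  have sub: "subspace T"
    unfolding subspace_def
  proof (intro conjI ballI allI)
    show "0 \<in> T" unfolding T_def by (intro CollectI exI[of _ "\<lambda>_. 0"]) simp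
  next
    fix x y assume "x \<in> T" "y \<in> T"
    then obtain r r' where "x = (\<Sum>\<nu>\<in>UNIV. r \<nu> *s map_col (mps_pderiv \<nu>) A)"
      "y = (\<Sum>\<nu>\<in>UNIV. r' \<nu> *s map_col (mps_pderiv \<nu>) A)"
      unfolding T_def by blast
    hence "x + y = (\<Sum>\<nu>\<in>UNIV. (r \<nu> + r' \<nu>) *s map_col (mps_pderiv \<nu>) A)"
      by (simp only: scale_left_distrib sum.distrib)
    thus "x + y \<in> T" unfolding T_def by (intro CollectI exI[of _ "\<lambda>\<nu>. r \<nu> + r' \<nu>"])
  next
    fix c x assume "x \<in> T"
    then obtain r where "x = (\<Sum>\<nu>\<in>UNIV. r \<nu> *s map_col (mps_pderiv \<nu>) A)"
      unfolding T_def by blast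
    hence "c *s x = (\<Sum>\<nu>\<in>UNIV. (c * r \<nu>) *s map_col (mps_pderiv \<nu>) A)"
      by (simp only: scale_sum_right scale_scale)
    thus "c *s x \<in> T" unfolding T_def by (intro CollectI exI[of _ "\<lambda>\<nu>. c * r \<nu>"])
  qed
  have "map_col (mps_pderiv \<nu>) A \<in> T" for \<nu>
  proof -
    have "(\<Sum>\<mu>\<in>UNIV. (if \<mu> = \<nu> then 1 else 0) *s map_col (mps_pderiv \<mu>) A) =
        (\<Sum>\<mu>\<in>UNIV. if \<mu> = \<nu> then map_col (mps_pderiv \<nu>) A else 0)"
      by (rule sum.cong) auto
    thus ?thesis unfolding T_def by (intro CollectI exI[of _ "\<lambda>\<mu>. if \<mu> = \<nu> then 1 else 0"]) simp
  qed
  hence "span (range (\<lambda>\<nu>. map_col (mps_pderiv \<nu>) A)) \<subseteq> T"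
    by (intro span_minimal sub) auto
  hence "{a *s v |a v. a \<in> max_ideal \<and> v \<in> span (range (\<lambda>\<nu>. map_col (mps_pderiv \<nu>) A))} \<subseteq> T"
    using subspace_scale[OF sub] by blast
  hence "tangent_image A \<subseteq> T"
    unfolding tangent_image_def ideal_smult_def by (intro span_minimal sub)
  thus ?thesis using assms that unfolding T_def by blast
qed

text \<open>The powers 0 to \<open>n\<close> of one variable already give n + 1 monomials.\<close>

lemma card_mono_degree_le_gt: "n < card {\<alpha> :: 's::finite \<Rightarrow>\<^sub>0 nat. mono_degree \<alpha> \<le> n}"
proof -
  have "card ((\<lambda>m. Poly_Mapping.single (undefined :: 's) m) ` {..n}) = card {..n}"
    by (intro card_image inj_onI) (metis lookup_single_eq)
  moreover have "card ((\<lambda>m. Poly_Mapping.single (undefined :: 's) m) ` {..n}) \<le>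
      card {\<alpha> :: 's \<Rightarrow>\<^sub>0 nat. mono_degree \<alpha> \<le> n}"
    by (rule card_mono[OF finite_mono_degree_le]) auto
  ultimately show ?thesis by simp
qed

lemma vector_space_mps_vec:
  "Vector_Spaces.vector_space (\<lambda>c (v :: ('s, 'k::field) mps ^ 'm::finite). mps_const c *s v)"
  by unfold_locales (auto simp: vec_eq_iff mps_const_add mps_const_mult algebra_simps)

text \<open>
  Modulo \<open>\<mm>\<^sup>n\<^sup>+\<^sup>1\<close> the column module has dimension \<open>m D\<close> with \<open>D\<close> the number of monomials of degree at
  most \<open>n\<close>, while a finite set \<open>S\<close> and the \<open>s\<close> partial derivatives span at most \<open>|S| + s D\<close> dimensions.
\<close>

lemma quotient_dim_tangent_image:
  fixes A :: "('s::finite, 'k::field) mps ^ 'm::finite"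
  assumes "CARD('s) < CARD('m)"
  shows "quotient_dim (\<lambda>c v. mps_const c *s v) (tangent_image A) = \<infinity>"
proof -
  interpret Vector_Spaces.vector_space "\<lambda>c (v :: ('s, 'k) mps ^ 'm). mps_const c *s v"
    by (rule vector_space_mps_vec)
  let ?P = "\<lambda>S. finite S \<and> (\<forall>v. \<exists>u\<in>span S. quotient_class (tangent_image A) v = quotient_class (tangent_image A) u)"
  have "\<not> ?P S" for S
  proof
    assume S: "?P S"
    \<comment> \<open>This choice makes the number \<open>D\<close> of monomials exceed |S|, so |S|
      + s D < (s + 1) D \<le> m D.\<close>
    define n where "n = card S"
    define Mon where "Mon = {\<alpha> :: 's \<Rightarrow>\<^sub>0 nat. mono_degree \<alpha> \<le> n}"
    have fin: "finite Mon" unfolding Mon_def by (rule finite_mono_degree_le)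
    have T: "0 \<in> tangent_image A" 
      unfolding tangent_image_def ideal_smult_def by (rule Modules.module.span_zero[OF module_vec])
    have ex: "\<exists>b r. v = (\<Sum>t\<in>S. mps_const (b t) *s t) + (\<Sum>\<nu>\<in>UNIV. r \<nu> *s map_col (mps_pderiv \<nu>) A)" for v
    proof -
      obtain u where u: "u \<in> span S" "quotient_class (tangent_image A) v = quotient_class (tangent_image A) u"
        using S by blast
      have "v \<in> quotient_class (tangent_image A) v" using T by (simp add: quotient_class_def)
      hence "v \<in> quotient_class (tangent_image A) u" by (simp only: u(2))
      hence "v - u \<in> tangent_image A" by (simp add: quotient_class_def)
      then obtain r where r: "v - u = (\<Sum>\<nu>\<in>UNIV. r \<nu> *s map_col (mps_pderiv \<nu>) A)"
        by (rule tangent_imageE)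
      obtain b where b: "u = (\<Sum>t\<in>S. mps_const (b t) *s t)"
        using u(1) span_finite[of S] S by auto
      have "v = u + (v - u)" by simp
      thus ?thesis unfolding r unfolding b by blast
    qed
    define V where "V x = axis (fst x) (mps_monom (snd x) :: ('s, 'k) mps)" for x :: "'m \<times> ('s \<Rightarrow>\<^sub>0 nat)"
    have "\<forall>x. \<exists>b r. V x = (\<Sum>t\<in>S. mps_const (b t) *s t) + (\<Sum>\<nu>\<in>UNIV. r \<nu> *s map_col (mps_pderiv \<nu>) A)"
      using ex by blast
    hence "\<exists>b. \<forall>x. \<exists>r. V x = (\<Sum>t\<in>S. mps_const (b x t) *s t) +
        (\<Sum>\<nu>\<in>UNIV. r \<nu> *s map_col (mps_pderiv \<nu>) A)"
      by (rule choice)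
    then obtain b where "\<forall>x. \<exists>r. V x = (\<Sum>t\<in>S. mps_const (b x t) *s t) +
        (\<Sum>\<nu>\<in>UNIV. r \<nu> *s map_col (mps_pderiv \<nu>) A)"
      by blast
    hence "\<exists>r. \<forall>x. V x = (\<Sum>t\<in>S. mps_const (b x t) *s t) +
        (\<Sum>\<nu>\<in>UNIV. r x \<nu> *s map_col (mps_pderiv \<nu>) A)"
      by (rule choice)
    then obtain r where br: "\<And>x. V x = (\<Sum>t\<in>S. mps_const (b x t) *s t) +
        (\<Sum>\<nu>\<in>UNIV. r x \<nu> *s map_col (mps_pderiv \<nu>) A)"
      by blast
    \<comment> \<open>The equations require a combination of the basis columns \<open>V x\<close> to
      have zero coefficients on \<open>S\<close> and derivative coefficients of order above
      \<open>n\<close>. A solution is a nonzero column with entries of degree at most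
      \<open>n\<close> and order above \<open>n\<close>.\<close>
    define Eq where "Eq = S <+> ((UNIV :: 's set) \<times> Mon)"
    define Unk where "Unk = (UNIV :: 'm set) \<times> Mon"
    define a where "a x y = (case y of Inl t \<Rightarrow> b x t | Inr p \<Rightarrow> mps_nth (r x (fst p)) (snd p))"
      for x and y :: "('s, 'k) mps ^ 'm + 's \<times> ('s \<Rightarrow>\<^sub>0 nat)"
    have card: "card Eq < card Unk"
    proof -
      have "card Eq = n + CARD('s) * card Mon"
        using S fin by (simp add: Eq_def n_def card_Plus card_cartesian_product)
      also have "\<dots> < card Mon + CARD('s) * card Mon"
        using card_mono_degree_le_gt[where 's = 's, of n] by (simp add: Mon_def)
      also have "\<dots> = (CARD('s) + 1) * card Mon" by simp
      also have "\<dots> \<le> CARD('m) * card Mon" using assms by (intro mult_le_mono1) simp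
      finally show ?thesis by (simp add: Unk_def card_cartesian_product)
    qed
    have finEq: "finite Eq" and finUn: "finite Unk" using S fin by (auto simp: Eq_def Unk_def)
    from ex_nontrivial_solution[OF finEq finUn card, of a]
    obtain c x0 where c: "x0 \<in> Unk" "c x0 \<noteq> 0" "\<And>y. y \<in> Eq \<Longrightarrow> (\<Sum>x\<in>Unk. c x * a x y) = 0"
      by blast
    define W where "W = (\<Sum>x\<in>Unk. mps_const (c x) *s V x)"
    define R where "R \<nu> = (\<Sum>x\<in>Unk. mps_const (c x) * r x \<nu>)" for \<nu>
    have W: "W $ i = (\<Sum>\<nu>\<in>UNIV. R \<nu> * mps_pderiv \<nu> (A $ i))" for i
    proof -
      have csum: "mps_const (sum f Z) = (\<Sum>x\<in>Z. mps_const (f x) :: ('s, 'k) mps)" for f and Z :: "('m \<times> ('s \<Rightarrow>\<^sub>0 nat)) set"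
        by (induction Z rule: infinite_finite_induct) (auto simp: mps_const_add)
      have "W $ i = (\<Sum>x\<in>Unk. \<Sum>t\<in>S. mps_const (c x * b x t) * t $ i) +
          (\<Sum>x\<in>Unk. \<Sum>\<nu>\<in>UNIV. mps_const (c x) * r x \<nu> * mps_pderiv \<nu> (A $ i))"
        by (simp add: W_def br map_col_def distrib_left sum.distrib sum_distrib_left mps_const_mult mult.assoc)
      also have "(\<Sum>x\<in>Unk. \<Sum>t\<in>S. mps_const (c x * b x t) * t $ i) =
          (\<Sum>t\<in>S. \<Sum>x\<in>Unk. mps_const (c x * b x t) * t $ i)"
        by (rule sum.swap)
      also have "\<dots> = (\<Sum>t\<in>S. mps_const (\<Sum>x\<in>Unk. c x * b x t) * t $ i)"
        by (simp add: csum sum_distrib_right)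
      also have "\<dots> = 0"
      proof (rule sum.neutral, rule ballI)
        fix t assume "t \<in> S"
        hence "Inl t \<in> Eq" by (auto simp: Eq_def)
        from c(3)[OF this] have "(\<Sum>x\<in>Unk. c x * b x t) = 0" by (simp add: a_def)
        thus "mps_const (\<Sum>x\<in>Unk. c x * b x t) * t $ i = 0" by simp
      qed
      also have "(\<Sum>x\<in>Unk. \<Sum>\<nu>\<in>UNIV. mps_const (c x) * r x \<nu> * mps_pderiv \<nu> (A $ i)) =
          (\<Sum>\<nu>\<in>UNIV. \<Sum>x\<in>Unk. mps_const (c x) * r x \<nu> * mps_pderiv \<nu> (A $ i))"
        by (rule sum.swap)
      finally show ?thesis by (simp add: R_def sum_distrib_right)
    qed
    have "R \<nu> \<in> ord_ge (Suc n)" for \<nu>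
      unfolding ord_ge_def
    proof (intro CollectI allI impI)
      fix \<alpha> :: "'s \<Rightarrow>\<^sub>0 nat" assume "mono_degree \<alpha> < Suc n"
      hence "Inr (\<nu>, \<alpha>) \<in> Eq" by (auto simp: Eq_def Mon_def)
      from c(3)[OF this] show "mps_nth (R \<nu>) \<alpha> = 0"
        by (simp add: R_def mps_nth_sum a_def)
    qed
    hence Word: "W $ i \<in> ord_ge (Suc n)" for i
      unfolding W by (intro ord_ge_sum ord_ge_mult_right)
    obtain i \<alpha> where x0: "x0 = (i, \<alpha>)" by (cases x0)
    have "mono_degree \<alpha> < Suc n" using c(1) by (simp add: x0 Unk_def Mon_def)
    hence "mps_nth (W $ i) \<alpha> = 0" using Word[of i] by (simp add: ord_ge_def)
    moreover have "mps_nth (W $ i) \<alpha> = (\<Sum>x\<in>Unk. if x = x0 then c x0 else 0)"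
      unfolding W_def sum_component mps_nth_sum
      by (rule sum.cong) (auto simp: V_def x0 axis_def mps_nth_monom prod_eq_iff)
    ultimately show False using c(1,2) finUn by simp
  qed
  hence "{S. ?P S} = {}" by blast
  thus ?thesis unfolding quotient_dim_def by (simp only: image_empty) (simp add: top_enat_def)
qed

theorem proposition4p5:
  fixes A :: "('s::finite, 'k::field) mps ^ 'm::finite"
  assumes "A \<in> ideal_smult max_ideal UNIV"
  shows
    "(CARD('s) < CARD('m) \<longrightarrow>
        quotient_dim (\<lambda>c v. mps_const c *s v) (tangent_image A) = \<infinity> \<and>
        ((\<exists>k. \<forall>l\<ge>k. orbit_map_separable l A) \<longrightarrow> \<not> finitely_right_determined A)) \<and>
     (CARD('m) \<le> CARD('s) \<and>
        independent_mod (\<lambda>c f. mps_const c * f) (ideal_power max_ideal 2) (\<lambda>i. A $ i) \<longrightarrow>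
        finitely_right_determined A) \<and>
     (1 < CARD('m) \<and> (\<exists>k. \<forall>l\<ge>k. orbit_map_separable l A) \<and> finitely_right_determined A \<longrightarrow>
        CARD('m) \<le> CARD('s) \<and>
        independent_mod (\<lambda>c f. mps_const c * f) (ideal_power max_ideal 2) (\<lambda>i. A $ i))"
proof -
  have A: "A $ i \<in> ord_ge 1" for i
    using assms by (simp only: ideal_smult_max_ideal) blast
  let ?ind = "independent_mod (\<lambda>c f. mps_const c * f) (ideal_power max_ideal 2) (\<lambda>i. A $ i)"
  note ind = independent_mod_iff[of "\<lambda>i. A $ i", OF A]
  have le: "CARD('m) \<le> CARD('s)" if ?ind
    using that unfolding ind by (rule independent_imp_card_le)
  have determined: "finitely_right_determined A" if ?ind
    using that unfolding ind by (rule finitely_right_determined_if_independent[OF A])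
  have not_determined: "\<not> finitely_right_determined A" if "1 < CARD('m)" "\<not> ?ind"
    using that unfolding ind by (rule not_finitely_right_determined_if_dependent[OF A])
  \<comment> \<open>There is at least one variable, so m > s leaves room for a second entry; by
    \<open>le\<close> the linear parts are then dependent.\<close>
  have "1 < CARD('m)" if "CARD('s) < CARD('m)"
    using that zero_less_card_finite[where 'a = 's] by linarith
  thus ?thesis
    using quotient_dim_tangent_image[of A] le determined not_determined by (meson not_le)
qed

end
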